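(* Let $G$ be a finite group and $(g,h,Q)$ a triple with $g,h\in G$, $Q\le G$, such that $Q$ is normal in $\langle g,h,Q\rangle$, $[g,h]Q\in\mathcal{Z}(\langle g,h,Q\rangle/Q)$, $o(hQ)=2$ and $\mathcal{H}(g,h,Q)\neq1$. Let $H=\langle g,h,Q\rangle$. Then there exists a unique primitive central idempotent $e$ of $\mathbb{Q}H$ such that $$\mathcal{H}(g,h,Q)=\mathrm{SL}_1(\mathbb{Z}H)\cap(1-e+\mathbb{Q}He).$$ Moreover, $\mathcal{H}(g,h,Q)=1-e+V_m$ for $m=o(gQ)|Q|$ (under an identification $\mathbb{Q}He\cong M_2(\mathbb{Q})$). Also, considering any maximal order $\mathcal{O}$ in $\mathbb{Q}He$ (identified with $M_2(\mathbb{Z})$) and denoting by $\Gamma(m)$ the principal congruence subgroup of level $m=o(gQ)|Q|$ in $\mathrm{SL}_1(\mathcal{O})$, one has $$\Gamma(2m)\le V_m\le\Gamma(m)\quad\text{and}\quad[\Gamma(m):V_m]=2.$$ In particular, $\mathcal{H}(g,h,Q)$ is a finite index normal subgroup of $1-e+\mathcal{U}(\mathbb{Z}He)$.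
   Context: $[g,h]=g^{-1}h^{-1}gh$; $o(x)$ is the order of $x$; $\mathcal{U}(\cdot)$ the unit group; $\widetilde{Q}=\sum_{q\in Q}q$; $\widetilde{(\pm g)}_Q=\sum_{i=0}^{o(gQ)-1}(\pm g)^i$. For $(x_1,x_2,y_1,y_2)\in\mathbb{Z}^4$, $$v_{(x_1,x_2,y_1,y_2)}:=1+\frac{1}{2|Q|}\widetilde{Q}(1-[g,h])\Big(h[x_1\widetilde{(-g)}_Q+x_2\widetilde{g}_Q]+y_1\widetilde{(-g)}_Q+y_2\widetilde{g}_Q\Big),$$ and the quadruple is admissible for $(g,h,Q)$ if $y_1+y_2+o(gQ)y_1y_2=o(gQ)x_1x_2$ and $x_2\pm x_1\equiv0\equiv y_2\pm y_1\pmod{2|Q|}$ (both signs). $\mathcal{H}(g,h,Q)$ is the set (in fact group) of all $v_{(x_1,x_2,y_1,y_2)}$ with admissible quadruple. $\mathrm{SL}_1(\mathbb{Z}H)$ is the group of units of $\mathbb{Z}H$ whose projection to every simple component of $\mathbb{Q}H$ has reduced norm $1$ over the centre of that component; $\mathrm{SL}_1(\mathcal{O})$ is the group of elements of reduced norm $1$ of $\mathcal{O}$. For a subset $X\subseteq\mathbb{Q}He$, $1-e+X=\{1-e+x\mid x\in X\}$. $\Gamma(m)$ is the kernel of reduction modulo $m$, i.e. $(1+mM_2(\mathbb{Z}))\cap\mathrm{SL}_2(\mathbb{Z})$. Further, $$V_m=\left\{\begin{pmatrix} 1+m l_2 & m t_1 \\ m t_2 & 1+m l_1 \end{pmatrix}\in\mathrm{SL}_2(\mathbb{Z})\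 \middle|\ l_1,l_2,t_1,t_2\in\mathbb{Z},\ l_1\equiv l_2\text{ and }t_1\equiv t_2\bmod2\right\}.$$ *)

theory Defs
  imports
    "HOL-Algebra.Multiplicative_Group"
    "HOL-Algebra.Subrings"
    "HOL-Algebra.QuotRing"
    "HOL-Number_Theory.Cong"
    "Jordan_Normal_Form.Determinant"
begin

section \<open>Groups\<close>

definition gp_commutator :: "('a, 'm) monoid_scheme \<Rightarrow> 'a \<Rightarrow> 'a \<Rightarrow> 'a" where
  "gp_commutator K g h = inv\<^bsub>K\<^esub> g \<otimes>\<^bsub>K\<^esub> inv\<^bsub>K\<^esub> h \<otimes>\<^bsub>K\<^esub> g \<otimes>\<^bsub>K\<^esub> h"

text \<open>The centre with respect to multiplication; used both for groups and for rings.\<close>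

definition centre :: "('a, 'm) monoid_scheme \<Rightarrow> 'a set" where
  "centre R = {z \<in> carrier R. \<forall>x\<in>carrier R. z \<otimes>\<^bsub>R\<^esub> x = x \<otimes>\<^bsub>R\<^esub> z}"

definition triple_group :: "('a, 'm) monoid_scheme \<Rightarrow> 'a \<Rightarrow> 'a \<Rightarrow> 'a set \<Rightarrow> ('a, 'm) monoid_scheme" where
  "triple_group G g h Q = G\<lparr>carrier := generate G ({g, h} \<union> Q)\<rparr>"

text \<open>The order of \<open>xQ\<close> in \<open>K/Q\<close>, where \<open>Q\<close> is a normal subgroup of \<open>K\<close>.\<close>

definition coset_ord :: "('a, 'm) monoid_scheme \<Rightarrow> 'a set \<Rightarrow> 'a \<Rightarrow> nat" where
  "coset_ord K Q x = group.ord (K Mod Q) (x <#\<^bsub>K\<^esub> Q)"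


section \<open>Rational and integral group rings\<close>

definition ga_basis :: "'a \<Rightarrow> 'a \<Rightarrow> rat" where
  "ga_basis x = (\<lambda>y. if y = x then 1 else 0)"

text \<open>The rational group algebra of a finite group \<open>K\<close>; an element is its coefficient function,
  extended by zero outside \<open>carrier K\<close>.\<close>

definition grp_alg :: "('a, 'm) monoid_scheme \<Rightarrow> (rat, 'a \<Rightarrow> rat) module" where
  "grp_alg K = \<lparr>
     carrier = {a. \<forall>x. x \<notin> carrier K \<longrightarrow> a x = 0},
     monoid.mult = (\<lambda>a b x. \<Sum>(y, z) \<in> {(y, z). y \<in> carrier K \<and> z \<in> carrier K \<and> y \<otimes>\<^bsub>K\<^esub> z = x}. a y * b z),
     monoid.one = ga_basis \<one>\<^bsub>K\<^esub>,
     ring.zero = (\<lambda>x. 0),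
     ring.add = (\<lambda>a b x. a x + b x),
     module.smult = (\<lambda>c a x. c * a x)\<rparr>"

definition int_grp_ring :: "('a, 'm) monoid_scheme \<Rightarrow> (rat, 'a \<Rightarrow> rat) module" where
  "int_grp_ring K = (grp_alg K)\<lparr>carrier := {a \<in> carrier (grp_alg K). range a \<subseteq> \<int>}\<rparr>"


section \<open>Idempotents and simple components\<close>

definition central_idempotent :: "('b, 'm) ring_scheme \<Rightarrow> 'b \<Rightarrow> bool" where
  "central_idempotent A e \<longleftrightarrow> e \<in> centre A \<and> e \<otimes>\<^bsub>A\<^esub> e = e"

definition primitive_central_idempotent :: "('b, 'm) ring_scheme \<Rightarrow> 'b \<Rightarrow> bool" where
  "primitive_central_idempotent A e \<longleftrightarrow>
     central_idempotent A e \<and> e \<noteq> \<zero>\<^bsub>A\<^esub> \<and>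
     (\<forall>e1 e2. central_idempotent A e1 \<and> central_idempotent A e2 \<and>
        e1 \<otimes>\<^bsub>A\<^esub> e2 = \<zero>\<^bsub>A\<^esub> \<and> e = e1 \<oplus>\<^bsub>A\<^esub> e2 \<longrightarrow> e1 = \<zero>\<^bsub>A\<^esub> \<or> e2 = \<zero>\<^bsub>A\<^esub>)"

text \<open>For a central idempotent \<open>e\<close> of a ring containing \<open>R\<close>, the ring \<open>Re\<close> with identity \<open>e\<close>;
  \<open>e\<close> need not lie in \<open>R\<close> (as for \<open>R\<close> the integral group ring).\<close>

definition component :: "('b, 'm) ring_scheme \<Rightarrow> 'b \<Rightarrow> ('b, 'm) ring_scheme" where
  "component R e = R\<lparr>carrier := (\<lambda>a. a \<otimes>\<^bsub>R\<^esub> e) ` carrier R, one := e\<rparr>"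

text \<open>The set \<open>1 - e + T\<close>.\<close>

definition one_minus_plus :: "('b, 'm) ring_scheme \<Rightarrow> 'b \<Rightarrow> 'b set \<Rightarrow> 'b set" where
  "one_minus_plus A e T = (\<lambda>x. \<one>\<^bsub>A\<^esub> \<ominus>\<^bsub>A\<^esub> e \<oplus>\<^bsub>A\<^esub> x) ` T"


section \<open>Reduced norms\<close>

text \<open>Let \<open>A\<close> be a finite-dimensional simple \<open>\<rat>\<close>-algebra with centre \<open>F\<close>. If the complex span of the
  image of a ring homomorphism \<open>\<phi> : A \<rightarrow> M\<^sub>n(\<complex>)\<close> is \<open>M\<^sub>n(\<complex>)\<close>, then \<open>\<phi>\<close> maps \<open>F\<close> to scalar matrices,
  so it provides an embedding \<open>F \<rightarrow> \<complex>\<close>, and the map \<open>A \<otimes>\<^sub>F \<complex> \<rightarrow> M\<^sub>n(\<complex>)\<close> induced by it is surjective. As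
  \<open>A \<otimes>\<^sub>F \<complex>\<close> is simple, this map is an isomorphism. So these are the splittings of \<open>A\<close> over \<open>\<complex>\<close>, for all
  embeddings of the number field \<open>F\<close>; they exist because \<open>\<complex>\<close> is algebraically closed.\<close>

definition complex_splitting :: "('b, 'm) ring_scheme \<Rightarrow> nat \<Rightarrow> ('b \<Rightarrow> complex mat) \<Rightarrow> bool" where
  "complex_splitting A n \<phi> \<longleftrightarrow>
     0 < n \<and> \<phi> \<in> Ring.ring_hom A (ring_mat TYPE(complex) n ()) \<and>
     (\<forall>M \<in> carrier_mat n n. \<exists>S z. finite S \<and> S \<subseteq> carrier A \<and>
        (\<forall>i<n. \<forall>j<n. M $$ (i, j) = (\<Sum>a\<in>S. z a * \<phi> a $$ (i, j))))"

text \<open>\<open>c\<close> is the reduced norm of \<open>a\<close> over the centre of \<open>A\<close>: the element of the centre which every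
  splitting identifies with \<open>det (\<phi> a)\<close>. That such an element exists and is the same for all splittings
  is the usual well-definedness of the reduced norm.\<close>

definition has_reduced_norm :: "('b, 'm) ring_scheme \<Rightarrow> 'b \<Rightarrow> 'b \<Rightarrow> bool" where
  "has_reduced_norm A a c \<longleftrightarrow>
     a \<in> carrier A \<and> c \<in> centre A \<and>
     (\<forall>n \<phi>. complex_splitting A n \<phi> \<longrightarrow> \<phi> c = det (\<phi> a) \<cdot>\<^sub>m 1\<^sub>m n)"

definition SL1_int_grp_ring :: "('a, 'm) monoid_scheme \<Rightarrow> ('a \<Rightarrow> rat) set" where
  "SL1_int_grp_ring K = {u \<in> Units (int_grp_ring K).
     \<forall>e. primitive_central_idempotent (grp_alg K) e \<longrightarrow>
       has_reduced_norm (component (grp_alg K) e) (u \<otimes>\<^bsub>grp_alg K\<^esub> e) e}"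


section \<open>Orders in rational algebras\<close>

text \<open>A \<open>\<int>\<close>-order: a unital subring, finitely generated as an abelian group, which spans \<open>A\<close> over \<open>\<rat>\<close>.\<close>

definition is_order :: "(rat, 'b) module \<Rightarrow> 'b set \<Rightarrow> bool" where
  "is_order A R \<longleftrightarrow>
     subring R A \<and>
     (\<exists>S. finite S \<and> S \<subseteq> R \<and> R = generate (add_monoid A) S) \<and>
     carrier A = {q \<odot>\<^bsub>A\<^esub> x |q x. x \<in> R}"

definition is_maximal_order :: "(rat, 'b) module \<Rightarrow> 'b set \<Rightarrow> bool" where
  "is_maximal_order A R \<longleftrightarrow> is_order A R \<and> (\<forall>R'. is_order A R' \<and> R \<subseteq> R' \<longrightarrow> R' = R)"

definition SL1_order :: "(rat, 'b) module \<Rightarrow> 'b set \<Rightarrow> 'b set" where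
  "SL1_order A R = {x \<in> R. has_reduced_norm A x \<one>\<^bsub>A\<^esub>}"

definition principal_congruence :: "(rat, 'b) module \<Rightarrow> 'b set \<Rightarrow> nat \<Rightarrow> 'b set" where
  "principal_congruence A R m =
     {x \<in> SL1_order A R. \<exists>y\<in>R. x = \<one>\<^bsub>A\<^esub> \<oplus>\<^bsub>A\<^esub> (of_nat m \<odot>\<^bsub>A\<^esub> y)}"


section \<open>Rational and integral matrices\<close>

abbreviation M2Q :: "rat mat ring" where
  "M2Q \<equiv> ring_mat TYPE(rat) 2 ()"

definition M2Z :: "rat mat set" where
  "M2Z = map_mat rat_of_int ` carrier_mat 2 2"

definition V_mats :: "nat \<Rightarrow> rat mat set" where
  "V_mats m = map_mat rat_of_int `
     {M. \<exists>l1 l2 t1 t2. M = mat_of_rows_list 2 [[1 + int m * l2, int m * t1],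
                                                 [int m * t2, 1 + int m * l1]] \<and>
         det M = 1 \<and> [l1 = l2] (mod 2) \<and> [t1 = t2] (mod 2)}"


section \<open>The set \<open>\<H>(g,h,Q)\<close>\<close>

definition set_tilde :: "('a, 'm) monoid_scheme \<Rightarrow> 'a set \<Rightarrow> 'a \<Rightarrow> rat" where
  "set_tilde K Q = (\<Oplus>\<^bsub>grp_alg K\<^esub>q\<in>Q. ga_basis q)"

text \<open>\<open>pow_tilde K Q g u\<close>, applied to \<open>u = g\<close> and \<open>u = -g\<close> in the group algebra, is the sum of the first
  \<open>o(gQ)\<close> powers of \<open>u\<close>.\<close>

definition pow_tilde :: "('a, 'm) monoid_scheme \<Rightarrow> 'a set \<Rightarrow> 'a \<Rightarrow> ('a \<Rightarrow> rat) \<Rightarrow> 'a \<Rightarrow> rat" where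
  "pow_tilde K Q g u = (\<Oplus>\<^bsub>grp_alg K\<^esub>i\<in>{..<coset_ord K Q g}. u [^]\<^bsub>grp_alg K\<^esub> i)"

definition v_elt :: "('a, 'm) monoid_scheme \<Rightarrow> 'a \<Rightarrow> 'a \<Rightarrow> 'a set \<Rightarrow> int \<Rightarrow> int \<Rightarrow> int \<Rightarrow> int \<Rightarrow> 'a \<Rightarrow> rat" where
  "v_elt K g h Q x1 x2 y1 y2 =
    (let A = grp_alg K;
         gm = pow_tilde K Q g (\<ominus>\<^bsub>A\<^esub> ga_basis g);
         gp = pow_tilde K Q g (ga_basis g)
     in \<one>\<^bsub>A\<^esub> \<oplus>\<^bsub>A\<^esub>
        ((1 / (2 * of_nat (card Q))) \<odot>\<^bsub>A\<^esub>
          (set_tilde K Q \<otimes>\<^bsub>A\<^esub> (\<one>\<^bsub>A\<^esub> \<ominus>\<^bsub>A\<^esub> ga_basis (gp_commutator K g h)) \<otimes>\<^bsub>A\<^esub>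
            ((ga_basis h \<otimes>\<^bsub>A\<^esub> ((of_int x1 \<odot>\<^bsub>A\<^esub> gm) \<oplus>\<^bsub>A\<^esub> (of_int x2 \<odot>\<^bsub>A\<^esub> gp)))
              \<oplus>\<^bsub>A\<^esub> (of_int y1 \<odot>\<^bsub>A\<^esub> gm) \<oplus>\<^bsub>A\<^esub> (of_int y2 \<odot>\<^bsub>A\<^esub> gp)))))"

definition admissible :: "('a, 'm) monoid_scheme \<Rightarrow> 'a \<Rightarrow> 'a set \<Rightarrow> int \<Rightarrow> int \<Rightarrow> int \<Rightarrow> int \<Rightarrow> bool" where
  "admissible K g Q x1 x2 y1 y2 \<longleftrightarrow>
    (let n = int (coset_ord K Q g); c = 2 * int (card Q)
     in y1 + y2 + n * y1 * y2 = n * x1 * x2 \<and>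
        [x2 + x1 = 0] (mod c) \<and> [x2 - x1 = 0] (mod c) \<and>
        [y2 + y1 = 0] (mod c) \<and> [y2 - y1 = 0] (mod c))"

text \<open>\<open>K\<close> is meant to be the group generated by \<open>g\<close>, \<open>h\<close> and \<open>Q\<close>.\<close>

definition H_set :: "('a, 'm) monoid_scheme \<Rightarrow> 'a \<Rightarrow> 'a \<Rightarrow> 'a set \<Rightarrow> ('a \<Rightarrow> rat) set" where
  "H_set K g h Q = {v_elt K g h Q x1 x2 y1 y2 |x1 x2 y1 y2. admissible K g Q x1 x2 y1 y2}"

end

theory Submission
  imports Defs
begin

text \<open>Let \<open>a = gQ\<close>, \<open>b = hQ\<close> and \<open>z = [a, b]\<close>, so \<open>z\<close> is central with \<open>z\<^sup>2 = 1\<close>. If \<open>z\<close> were a power of \<open>a\<close>,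
  then \<open>1 - z\<close> would annihilate both sums over \<open>\<langle>a\<rangle>\<close> and the set would be trivial. Hence every element
  of the quotient has a normal form \<open>b\<^sup>j a\<^sup>i z\<^sup>l\<close>, and mapping \<open>a\<close> to \<open>diag(1, -1)\<close> and \<open>b\<close> to the swap
  defines an irreducible representation \<open>\<rho>\<close>, whose image is dihedral of order \<open>8\<close>. By the Schur
  relations, the element of the corresponding simple component with matrix \<open>M\<close> has the coefficient
  \<open>\<langle>\<rho>(k), M\<rangle>/(2m)\<close> at \<open>k\<close>, where \<open>\<langle>_, _\<rangle>\<close> is the Frobenius form. So it is integral if and only if
  \<open>M \<in> m D\<close>, where \<open>D\<close> is the image of the integral group ring: the integral matrices whose two
  diagonal entries, and whose two off-diagonal entries, have the same parity. Both sides of the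
  asserted equality are therefore \<open>1 - e\<close> plus the matrices of determinant \<open>1\<close> in \<open>1 + m D\<close>, which is
  \<open>V_mats m\<close> and is normalised by the units of \<open>D\<close>. Elements of determinant \<open>1\<close> have reduced norm \<open>1\<close>
  as \<open>SL\<^sub>2(\<rat>)\<close> is perfect. An order stabilises a lattice, so it is conjugate into \<open>M2Z\<close>.\<close>

section \<open>Two-by-two matrices\<close>

text \<open>The quotient has 4n elements, n = o(gQ), so the group has order 4m, and Fourier
  inversion for a representation of degree 2 carries the factor 2/(4m) = 1/(2m). As a^n = 1 commutes
  with b, z^n = 1; since z is nontrivial, n and hence m is even. Evenness matters twice: it makes
  the sign (-1)^i well defined, and it forces a + d to be even whenever det(1 + m (a b; c d)) = 1,
  which leaves only the off-diagonal parity free and gives index 2. Under the representation the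
  sums over powers of g and of -g become n E11 and n E22, and h exchanges rows. So a quadruple
  becomes the matrix 1 + n (y2 x1; x2 y1): its determinant condition is the quadratic equation of
  admissibility, and the congruences with both signs say that (y2 x1; x2 y1) is |Q| times a matrix
  with the two parity conditions. The reduced norm quantifies over all complex splittings. They are
  never compared with each other; only the value 1 is tracked, for which multiplicativity of the
  determinant is enough.\<close>

definition mat2 :: "'a \<Rightarrow> 'a \<Rightarrow> 'a \<Rightarrow> 'a \<Rightarrow> 'a mat" where
  "mat2 a b c d = mat_of_rows_list 2 [[a, b], [c, d]]"

lemma mat2_carrier [simp]: "mat2 a b c d \<in> carrier_mat 2 2"
  by (simp add: mat2_def mat_of_rows_list_def numeral_2_eq_2)

lemma mat2_dim [simp]: "dim_row (mat2 a b c d) = 2" "dim_col (mat2 a b c d) = 2"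
  by (simp_all add: mat2_def mat_of_rows_list_def numeral_2_eq_2)

lemma mat2_index [simp]:
  "mat2 a b c d $$ (0, 0) = a" "mat2 a b c d $$ (0, Suc 0) = b"
  "mat2 a b c d $$ (Suc 0, 0) = c" "mat2 a b c d $$ (Suc 0, Suc 0) = d"
  by (simp_all add: mat2_def mat_of_rows_list_def numeral_2_eq_2)

lemma mat2_eqI:
  assumes "A \<in> carrier_mat 2 2" "B \<in> carrier_mat 2 2"
    and "A $$ (0, 0) = B $$ (0, 0)" "A $$ (0, Suc 0) = B $$ (0, Suc 0)"
    and "A $$ (Suc 0, 0) = B $$ (Suc 0, 0)" "A $$ (Suc 0, Suc 0) = B $$ (Suc 0, Suc 0)"
  shows "A = B"
  using assms by (intro eq_matI) (auto simp: less_2_cases_iff)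

lemma mat2_eq_iff [simp]:
  "mat2 a b c d = mat2 a' b' c' d' \<longleftrightarrow> a = a' \<and> b = b' \<and> c = c' \<and> d = d'"
  by (metis mat2_index)

lemma mat2_collapse:
  "A \<in> carrier_mat 2 2 \<Longrightarrow>
    mat2 (A $$ (0, 0)) (A $$ (0, Suc 0)) (A $$ (Suc 0, 0)) (A $$ (Suc 0, Suc 0)) = A"
  by (rule mat2_eqI) auto

lemma mat2_cases:
  assumes "A \<in> carrier_mat 2 2"
  obtains a b c d where "A = mat2 a b c d"
  using mat2_collapse[OF assms] by metis

lemma mat2_add [simp]:
  "mat2 a b c d + mat2 a' b' c' d' = mat2 (a + a') (b + b') (c + c') (d + d')"
  by (rule mat2_eqI) auto

lemma mat2_uminus [simp]:
  fixes a :: "'a :: group_add"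
  shows "- mat2 a b c d = mat2 (- a) (- b) (- c) (- d)"
  by (rule mat2_eqI) auto

lemma mat2_mult [simp]:
  fixes a :: "'a :: semiring_0"
  shows "mat2 a b c d * mat2 a' b' c' d' =
    mat2 (a * a' + b * c') (a * b' + b * d') (c * a' + d * c') (c * b' + d * d')"
  by (rule mat2_eqI) (auto simp: scalar_prod_def numeral_2_eq_2)

lemma mat2_smult [simp]: "k \<cdot>\<^sub>m mat2 a b c d = mat2 (k * a) (k * b) (k * c) (k * d)"
  by (rule mat2_eqI) auto

lemma one_mat2: "1\<^sub>m 2 = mat2 1 0 0 1"
  by (rule mat2_eqI) auto

lemma zero_mat2: "0\<^sub>m 2 2 = mat2 0 0 0 0"
  by (rule mat2_eqI) auto

lemma map_mat_mat2 [simp]: "map_mat f (mat2 a b c d) = mat2 (f a) (f b) (f c) (f d)"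
  by (rule mat2_eqI) auto

lemma det_mat2 [simp]:
  fixes a :: "'a :: comm_ring_1"
  shows "det (mat2 a b c d) = a * d - b * c"
proof -
  have "det (mat2 a b c d) = (\<Sum>j<2. mat2 a b c d $$ (0, j) * cofactor (mat2 a b c d) 0 j)"
    by (rule laplace_expansion_row) auto
  also have "\<dots> = a * d - b * c"
    by (simp add: cofactor_def mat_delete_def det_single numeral_2_eq_2)
  finally show ?thesis .
qed


section \<open>Integral matrices and reduced norms\<close>


lemma M2Z_eq: "M2Z = {mat2 (of_int a) (of_int b) (of_int c) (of_int d) |a b c d. True}"
proof -
  have "map_mat rat_of_int A \<in> {mat2 (of_int a) (of_int b) (of_int c) (of_int d) |a b c d. True}"
    if "A \<in> carrier_mat 2 2" for A
    using that by (cases rule: mat2_cases) auto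
  moreover have "mat2 (of_int a) (of_int b) (of_int c) (of_int d) \<in> M2Z" for a b c d
    unfolding M2Z_def by (rule image_eqI[of _ _ "mat2 a b c d"]) auto
  ultimately show ?thesis unfolding M2Z_def by blast
qed

lemma mat2_in_M2Z [simp]: "mat2 a b c d \<in> M2Z \<longleftrightarrow> a \<in> \<int> \<and> b \<in> \<int> \<and> c \<in> \<int> \<and> d \<in> \<int>"
  unfolding M2Z_eq by (auto elim!: Ints_cases)

lemma M2Z_subset: "M2Z \<subseteq> carrier_mat 2 2"
  by (auto simp: M2Z_eq)

lemma M2Z_cases:
  assumes "X \<in> M2Z"
  obtains a b c d where "X = mat2 (of_int a) (of_int b) (of_int c) (of_int d)"
  using assms unfolding M2Z_eq by blast

text \<open>The image of the integral group ring of the dihedral group of order 8 in its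
  two-dimensional representation.\<close>

definition parity_order :: "rat mat set" where
  "parity_order = {mat2 (of_int a) (of_int b) (of_int c) (of_int d) |a b c d.
     even (a - d) \<and> even (b - c)}"

lemma parity_orderI:
  "\<lbrakk>even (a - d); even (b - c); X = mat2 (of_int a) (of_int b) (of_int c) (of_int d)\<rbrakk>
    \<Longrightarrow> X \<in> parity_order"
  unfolding parity_order_def by blast

lemma parity_order_cases:
  assumes "X \<in> parity_order"
  obtains a b c d where "X = mat2 (of_int a) (of_int b) (of_int c) (of_int d)"
    "even (a - d)" "even (b - c)"
  using assms unfolding parity_order_def by blast

lemma mat2_of_int_in_parity_order [simp]:
  "mat2 (of_int a) (of_int b) (of_int c) (of_int d) \<in> parity_order \<longleftrightarrow> even (a - d) \<and> even (b - c)"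
  unfolding parity_order_def by auto

lemma parity_order_subset: "parity_order \<subseteq> M2Z"
  by (auto simp: parity_order_def)

lemma parity_order_subset_carrier: "parity_order \<subseteq> carrier_mat 2 2"
  using parity_order_subset M2Z_subset by blast

lemma one_in_parity_order: "1\<^sub>m 2 \<in> parity_order"
  by (rule parity_orderI[of 1 1 0 0]) (simp_all add: one_mat2)

lemma parity_order_add: "A \<in> parity_order \<Longrightarrow> B \<in> parity_order \<Longrightarrow> A + B \<in> parity_order"
proof (elim parity_order_cases)
  fix a b c d a' b' c' d'
  assume "A = mat2 (of_int a) (of_int b) (of_int c) (of_int d)" "even (a - d)" "even (b - c)"
    "B = mat2 (of_int a') (of_int b') (of_int c') (of_int d')" "even (a' - d')" "even (b' - c')"
  then show ?thesis
    by (intro parity_orderI[of "a + a'" "d + d'" "b + b'" "c + c'"]) auto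
qed

lemma parity_order_smult: "A \<in> parity_order \<Longrightarrow> of_int k \<cdot>\<^sub>m A \<in> parity_order"
proof (elim parity_order_cases)
  fix a b c d
  assume "A = mat2 (of_int a) (of_int b) (of_int c) (of_int d)" "even (a - d)" "even (b - c)"
  then show ?thesis
    by (intro parity_orderI[of "k * a" "k * d" "k * b" "k * c"]) auto
qed

lemma parity_order_mult:
  assumes "A \<in> parity_order" "B \<in> parity_order"
  shows "A * B \<in> parity_order"
proof -
  obtain a b c d a' b' c' d' where
    A: "A = mat2 (of_int a) (of_int b) (of_int c) (of_int d)" "even (a - d)" "even (b - c)" and
    B: "B = mat2 (of_int a') (of_int b') (of_int c') (of_int d')" "even (a' - d')" "even (b' - c')"
    using assms by (elim parity_order_cases) blast
  show ?thesis
  proof (rule parity_orderI)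
    show "A * B = mat2 (of_int (a * a' + b * c')) (of_int (a * b' + b * d'))
      (of_int (c * a' + d * c')) (of_int (c * b' + d * d'))"
      by (simp add: A B)
  qed (use A B in auto)
qed

lemma two_smult_M2Z: "X \<in> M2Z \<Longrightarrow> of_int 2 \<cdot>\<^sub>m X \<in> parity_order"
proof (elim M2Z_cases)
  fix a b c d
  assume "X = mat2 (of_int a) (of_int b) (of_int c) (of_int d)"
  then show ?thesis
    by (intro parity_orderI[of "2 * a" "2 * d" "2 * b" "2 * c"]) auto
qed

text \<open>Separates the congruence from the determinant, so that closure under products and
  conjugation comes from \<open>parity_order\<close> being a ring. The integral and the rational
  determinant conditions agree by injectivity of \<open>of_int\<close>.\<close>

lemma V_mats_eq:
  "V_mats m = {X. X \<in> carrier_mat 2 2 \<and> det X = 1 \<and> (\<exists>A\<in>parity_order. X = 1\<^sub>m 2 + of_nat m \<cdot>\<^sub>m A)}"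
    (is "_ = ?R")
proof (intro equalityI subsetI)
  fix X assume "X \<in> V_mats m"
  then obtain l1 l2 t1 t2 where
    X: "X = map_mat rat_of_int (mat2 (1 + int m * l2) (int m * t1) (int m * t2) (1 + int m * l1))"
    and d: "det (mat2 (1 + int m * l2) (int m * t1) (int m * t2) (1 + int m * l1)) = 1"
    and c: "[l1 = l2] (mod 2)" "[t1 = t2] (mod 2)"
    unfolding V_mats_def mat2_def by blast
  have "even (l2 - l1)" "even (t1 - t2)"
    using c by (auto simp: cong_iff_dvd_diff dvd_diff_commute)
  moreover have "X = 1\<^sub>m 2 + of_nat m \<cdot>\<^sub>m mat2 (of_int l2) (of_int t1) (of_int t2) (of_int l1)"
    by (simp add: X one_mat2)
  moreover have "det X = 1"
  proof -
    have "det X = of_int (det (mat2 (1 + int m * l2) (int m * t1) (int m * t2) (1 + int m * l1)))"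
      by (simp add: X)
    then show ?thesis by (simp only: d of_int_1)
  qed
  moreover have "X \<in> carrier_mat 2 2" by (simp add: X)
  ultimately show "X \<in> ?R"
    using mat2_of_int_in_parity_order[of l2 t1 t2 l1] by blast
next
  fix X assume "X \<in> ?R"
  then obtain A where A: "A \<in> parity_order" "X = 1\<^sub>m 2 + of_nat m \<cdot>\<^sub>m A" and d: "det X = 1" by blast
  from A(1) obtain a b c e where
    Ae: "A = mat2 (of_int a) (of_int b) (of_int c) (of_int e)" "even (a - e)" "even (b - c)"
    by (rule parity_order_cases)
  let ?M = "mat2 (1 + int m * a) (int m * b) (int m * c) (1 + int m * e)"
  have X: "X = map_mat rat_of_int ?M" by (simp add: A Ae one_mat2)
  have "of_int (det ?M) = det X" by (simp add: X)
  then have "det ?M = 1" using d by (simp only: of_int_eq_1_iff)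
  then have "\<exists>l1 l2 t1 t2. ?M = mat_of_rows_list 2 [[1 + int m * l2, int m * t1],
       [int m * t2, 1 + int m * l1]] \<and> det ?M = 1 \<and> [l1 = l2] (mod 2) \<and> [t1 = t2] (mod 2)"
    using Ae(2,3) by (intro exI[of _ e] exI[of _ a] exI[of _ b] exI[of _ c])
      (simp add: mat2_def cong_iff_dvd_diff dvd_diff_commute)
  then show "X \<in> V_mats m" unfolding V_mats_def X by blast
qed

lemma V_matsI:
  assumes "A \<in> parity_order" "X = 1\<^sub>m 2 + of_nat m \<cdot>\<^sub>m A" "det X = 1"
  shows "X \<in> V_mats m"
proof -
  have "A \<in> carrier_mat 2 2" using assms(1) parity_order_subset_carrier by blast
  then have "X \<in> carrier_mat 2 2" unfolding assms(2) by simp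
  then show ?thesis using assms unfolding V_mats_eq by blast
qed

section \<open>V_m and the principal congruence subgroups as groups of matrices\<close>

definition Gamma_mats :: "nat \<Rightarrow> rat mat set" where
  "Gamma_mats m = {X. X \<in> M2Z \<and> det X = 1 \<and> (\<exists>Y\<in>M2Z. X = 1\<^sub>m 2 + of_nat m \<cdot>\<^sub>m Y)}"

lemma mat2_in_Gamma_mats:
  "mat2 (1 + of_nat m * of_int a) (of_nat m * of_int b) (of_nat m * of_int c) (1 + of_nat m * of_int d)
     \<in> Gamma_mats m \<longleftrightarrow>
   (1 + of_nat m * of_int a) * (1 + of_nat m * of_int d)
     - (of_nat m * of_int b) * (of_nat m * of_int c) = (1 :: rat)"
    (is "?X \<in> _ \<longleftrightarrow> _")
proof -
  have "?X = 1\<^sub>m 2 + (of_nat m :: rat) \<cdot>\<^sub>m mat2 (of_int a) (of_int b) (of_int c) (of_int d)"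
    by (simp add: one_mat2)
  then have "\<exists>Y\<in>M2Z. ?X = 1\<^sub>m 2 + (of_nat m :: rat) \<cdot>\<^sub>m Y" by (rule bexI) simp
  then show ?thesis unfolding Gamma_mats_def by simp
qed

lemma Gamma_mats_cases:
  assumes "X \<in> Gamma_mats m"
  obtains a b c d where
    "X = mat2 (1 + of_nat m * of_int a) (of_nat m * of_int b) (of_nat m * of_int c) (1 + of_nat m * of_int d)"
    "(1 + of_nat m * of_int a) * (1 + of_nat m * of_int d)
      - (of_nat m * of_int b) * (of_nat m * of_int c) = (1 :: rat)"
proof -
  from assms obtain Y where Y: "Y \<in> M2Z" "X = 1\<^sub>m 2 + of_nat m \<cdot>\<^sub>m Y" "det X = 1"
    unfolding Gamma_mats_def by blast
  from Y(1) obtain a b c d where "Y = mat2 (of_int a) (of_int b) (of_int c) (of_int d)"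
    by (rule M2Z_cases)
  with Y(2,3) show ?thesis by (intro that[of a b c d]) (simp_all add: one_mat2)
qed

lemma V_mats_subset_Gamma: "V_mats m \<subseteq> Gamma_mats m"
proof
  fix X assume "X \<in> V_mats m"
  then obtain A where A: "A \<in> parity_order" "X = 1\<^sub>m 2 + of_nat m \<cdot>\<^sub>m A" "det X = 1"
    unfolding V_mats_eq by blast
  moreover from A(1,2) have "X \<in> M2Z" by (elim parity_order_cases) (simp add: one_mat2)
  ultimately show "X \<in> Gamma_mats m"
    using parity_order_subset unfolding Gamma_mats_def by blast
qed

text \<open>1 + 2m Y = 1 + m (2Y), and a matrix with even entries satisfies both parity
  conditions.\<close>

lemma Gamma_double_subset_V: "Gamma_mats (2 * m) \<subseteq> V_mats m"
proof
  fix X assume "X \<in> Gamma_mats (2 * m)"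
  then obtain Y where Y: "Y \<in> M2Z" "X = 1\<^sub>m 2 + of_nat (2 * m) \<cdot>\<^sub>m Y" "det X = 1" "X \<in> M2Z"
    unfolding Gamma_mats_def by blast
  have "X = 1\<^sub>m 2 + of_nat m \<cdot>\<^sub>m (of_int 2 \<cdot>\<^sub>m Y)"
    using Y(1,2) by (elim M2Z_cases) (simp add: one_mat2 algebra_simps)
  moreover have "of_int 2 \<cdot>\<^sub>m Y \<in> parity_order" by (rule two_smult_M2Z) fact
  ultimately show "X \<in> V_mats m" using Y(3) by (intro V_matsI)
qed


text \<open>Stated without an ambient group, so that one proof about matrices serves the unit group
  of every algebra identified with M_2(Q).\<close>

definition mat_group :: "rat mat set \<Rightarrow> bool" where
  "mat_group S \<longleftrightarrow> S \<subseteq> carrier_mat 2 2 \<and> 1\<^sub>m 2 \<in> S \<and> (\<forall>X\<in>S. \<forall>Y\<in>S. X * Y \<in> S) \<and>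
     (\<forall>X\<in>S. \<exists>Y\<in>S. X * Y = 1\<^sub>m 2 \<and> Y * X = 1\<^sub>m 2)"

lemma mat_group_Gamma: "mat_group (Gamma_mats m)"
proof -
  have 1: "1\<^sub>m 2 \<in> Gamma_mats m"
    using mat2_in_Gamma_mats[of m 0 0 0 0] by (simp add: one_mat2)
  have 2: "X * Y \<in> Gamma_mats m" if X: "X \<in> Gamma_mats m" and Y: "Y \<in> Gamma_mats m" for X Y
  proof -
    obtain a b c d where
      Xe: "X = mat2 (1 + of_nat m * of_int a) (of_nat m * of_int b) (of_nat m * of_int c) (1 + of_nat m * of_int d)"
      using X by (rule Gamma_mats_cases)
    obtain a' b' c' d' where
      Ye: "Y = mat2 (1 + of_nat m * of_int a') (of_nat m * of_int b') (of_nat m * of_int c') (1 + of_nat m * of_int d')"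
      using Y by (rule Gamma_mats_cases)
    let ?Z = "mat2 (of_int (a + a' + int m * (a * a' + b * c'))) (of_int (b + b' + int m * (a * b' + b * d')))
       (of_int (c + c' + int m * (c * a' + d * c'))) (of_int (d + d' + int m * (c * b' + d * d'))) :: rat mat"
    have "X * Y = 1\<^sub>m 2 + of_nat m \<cdot>\<^sub>m ?Z"
      by (simp add: Xe Ye one_mat2 algebra_simps)
    moreover have "?Z \<in> M2Z" by simp
    moreover have "X * Y \<in> M2Z" by (simp add: Xe Ye)
    moreover have "det (X * Y) = 1"
      using X Y unfolding Gamma_mats_def by (auto simp: det_mult[of _ 2] M2Z_subset[THEN subsetD])
    ultimately show ?thesis unfolding Gamma_mats_def by blast
  qed
  have 3: "\<exists>Y\<in>Gamma_mats m. X * Y = 1\<^sub>m 2 \<and> Y * X = 1\<^sub>m 2" if X: "X \<in> Gamma_mats m" for X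
  proof -
    from X obtain a b c d where
      Xe: "X = mat2 (1 + of_nat m * of_int a) (of_nat m * of_int b) (of_nat m * of_int c) (1 + of_nat m * of_int d)"
      and d: "(1 + of_nat m * of_int a) * (1 + of_nat m * of_int d)
        - (of_nat m * of_int b) * (of_nat m * of_int c) = (1 :: rat)"
      by (rule Gamma_mats_cases)
    \<comment> \<open>The adjugate, which is the inverse as the determinant is 1.\<close>
    let ?Y = "mat2 (1 + of_nat m * of_int d) (of_nat m * of_int (- b)) (of_nat m * of_int (- c)) (1 + of_nat m * of_int a)"
    have "?Y \<in> Gamma_mats m"
      unfolding mat2_in_Gamma_mats using d by (simp add: algebra_simps)
    moreover have "X * ?Y = 1\<^sub>m 2 \<and> ?Y * X = 1\<^sub>m 2"
      using d by (simp add: Xe one_mat2 algebra_simps)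
    ultimately show ?thesis by blast
  qed
  have 4: "Gamma_mats m \<subseteq> carrier_mat 2 2"
    using M2Z_subset unfolding Gamma_mats_def by blast
  show ?thesis unfolding mat_group_def using 1 2 3 4 by blast
qed

lemma mat_group_V: "mat_group (V_mats m)"
proof -
  have 1: "1\<^sub>m 2 \<in> V_mats m"
  proof -
    have "mat2 0 0 0 0 \<in> parity_order" by (rule parity_orderI[of 0 0 0 0]) simp_all
    moreover have "1\<^sub>m 2 = 1\<^sub>m 2 + of_nat m \<cdot>\<^sub>m mat2 0 0 0 0" by (simp add: one_mat2)
    ultimately show ?thesis by (rule V_matsI) simp
  qed
  have 2: "X * Y \<in> V_mats m" if X: "X \<in> V_mats m" and Y: "Y \<in> V_mats m" for X Y
  proof -
    from X Y obtain A B where A: "A \<in> parity_order" "X = 1\<^sub>m 2 + of_nat m \<cdot>\<^sub>m A"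
      and B: "B \<in> parity_order" "Y = 1\<^sub>m 2 + of_nat m \<cdot>\<^sub>m B"
      and d: "det X = 1" "det Y = 1" "X \<in> carrier_mat 2 2" "Y \<in> carrier_mat 2 2"
      unfolding V_mats_eq by blast
    have "X * Y = 1\<^sub>m 2 + of_nat m \<cdot>\<^sub>m (A + B + of_int (int m) \<cdot>\<^sub>m (A * B))"
      using A B by (elim parity_order_cases) (simp add: one_mat2 algebra_simps)
    moreover have "A + B + of_int (int m) \<cdot>\<^sub>m (A * B) \<in> parity_order"
      using A B by (intro parity_order_add parity_order_smult parity_order_mult)
    moreover have "det (X * Y) = 1" using d by (simp add: det_mult[of _ 2])
    ultimately show ?thesis by (intro V_matsI)
  qed
  have 3: "\<exists>Y\<in>V_mats m. X * Y = 1\<^sub>m 2 \<and> Y * X = 1\<^sub>m 2" if X: "X \<in> V_mats m" for X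
  proof -
    from X obtain A where A: "A \<in> parity_order" "X = 1\<^sub>m 2 + of_nat m \<cdot>\<^sub>m A" "det X = 1"
      unfolding V_mats_eq by blast
    from A(1) obtain a b c d where
      Ae: "A = mat2 (of_int a) (of_int b) (of_int c) (of_int d)" "even (a - d)" "even (b - c)"
      by (rule parity_order_cases)
    \<comment> \<open>The adjugate of 1 + m A is 1 + m adj(A), and passing to the adjugate keeps
      both parity conditions.\<close>
    let ?B = "mat2 (of_int d) (of_int (- b)) (of_int (- c)) (of_int a) :: rat mat"
    let ?Y = "1\<^sub>m 2 + of_nat m \<cdot>\<^sub>m ?B"
    have "?B \<in> parity_order" using Ae(2,3) by (intro parity_orderI[OF _ _ refl]) auto
    moreover have "det ?Y = 1" using A(2,3) by (simp add: Ae one_mat2 algebra_simps)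
    ultimately have "?Y \<in> V_mats m" by (intro V_matsI[OF _ refl])
    moreover have "X * ?Y = 1\<^sub>m 2 \<and> ?Y * X = 1\<^sub>m 2"
      using A(2,3) by (simp add: Ae one_mat2 algebra_simps)
    ultimately show ?thesis by blast
  qed
  have 4: "V_mats m \<subseteq> carrier_mat 2 2" unfolding V_mats_eq by blast
  show ?thesis unfolding mat_group_def using 1 2 3 4 by blast
qed

text \<open>For even \<open>m\<close> the determinant forces the two diagonal entries of \<open>(X - 1)/m\<close> to have the same parity,
  so that membership in \<open>V_mats m\<close> only depends on the off-diagonal entries.\<close>

lemma Gamma_minus_V_coset:
  assumes "even m" "0 < m" "X \<in> Gamma_mats m" "X \<notin> V_mats m"
  shows "X * mat2 1 (- of_nat m) 0 1 \<in> V_mats m"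
proof -
  from assms(3) obtain a b c d where
    Xe: "X = mat2 (1 + of_nat m * of_int a) (of_nat m * of_int b) (of_nat m * of_int c) (1 + of_nat m * of_int d)"
    and det: "(1 + of_nat m * of_int a) * (1 + of_nat m * of_int d)
      - (of_nat m * of_int b) * (of_nat m * of_int c) = (1 :: rat)"
    by (rule Gamma_mats_cases)
  have "of_int ((1 + int m * a) * (1 + int m * d) - (int m * b) * (int m * c)) = (of_int 1 :: rat)"
    using det by simp
  then have "(1 + int m * a) * (1 + int m * d) - (int m * b) * (int m * c) = 1"
    by (simp only: of_int_eq_iff)
  then have "int m * (a + d + int m * (a * d - b * c)) = 0" by (simp add: algebra_simps)
  then have "a + d = - (int m * (a * d - b * c))" using assms(2) by simp
  then have ad: "even (a - d)" using assms(1)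
    by (metis even_add even_diff even_minus even_mult_iff even_of_nat)
  have bc: "odd (b - c)"
  proof
    assume "even (b - c)"
    with ad have "X \<in> V_mats m"
      using det by (intro V_matsI[of "mat2 (of_int a) (of_int b) (of_int c) (of_int d)"])
        (simp_all add: Xe one_mat2)
    with assms(4) show False ..
  qed
  \<comment> \<open>Right multiplication subtracts m times the first column from the second. As m is
    even, this flips the parity of b and keeps that of d.\<close>
  let ?A = "mat2 (of_int a) (of_int (b - 1 - int m * a)) (of_int c) (of_int (d - int m * c)) :: rat mat"
  have "?A \<in> parity_order" unfolding mat2_of_int_in_parity_order using ad bc assms(1) by simp
  moreover have "X * mat2 1 (- of_nat m) 0 1 = 1\<^sub>m 2 + of_nat m \<cdot>\<^sub>m ?A"
    by (simp add: Xe one_mat2 algebra_simps)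
  moreover have "det (X * mat2 1 (- of_nat m) 0 1) = 1"
    using det by (simp add: Xe algebra_simps)
  ultimately show ?thesis by (rule V_matsI)
qed

lemma elementary_in_Gamma: "mat2 1 (of_nat m) 0 1 \<in> Gamma_mats m"
  using mat2_in_Gamma_mats[of m 0 1 0 0] by simp

text \<open>The off-diagonal parameters are 1 and 0, of different parity; this matrix represents the
  nontrivial coset.\<close>

lemma elementary_notin_V: "0 < m \<Longrightarrow> mat2 1 (of_nat m) 0 1 \<notin> V_mats m"
  unfolding V_mats_eq by (auto simp: one_mat2 elim!: parity_order_cases)

text \<open>Conjugation fixes 1 and sends m C to m (A C B), which stays in m times the ring
  \<open>parity_order\<close>. This is the normality of V_m.\<close>

lemma V_mats_conj:
  assumes X: "X \<in> V_mats m" and A: "A \<in> parity_order" and B: "B \<in> parity_order" "A * B = 1\<^sub>m 2"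
  shows "A * X * B \<in> V_mats m"
proof -
  from X obtain C
    where C: "C \<in> parity_order" "X = 1\<^sub>m 2 + of_nat m \<cdot>\<^sub>m C" "det X = 1" "X \<in> carrier_mat 2 2"
    unfolding V_mats_eq by blast
  have cA: "A \<in> carrier_mat 2 2" and cB: "B \<in> carrier_mat 2 2" and cC: "C \<in> carrier_mat 2 2"
    using A B C parity_order_subset_carrier by auto
  have "A * X * B = A * B + of_nat m \<cdot>\<^sub>m (A * C * B)"
    using cA cB cC unfolding C(2) by (elim mat2_cases) (simp add: one_mat2 algebra_simps)
  then have "A * X * B = 1\<^sub>m 2 + of_nat m \<cdot>\<^sub>m (A * C * B)" by (simp add: B)
  moreover have "A * C * B \<in> parity_order" using A B C by (intro parity_order_mult)
  moreover have "det (A * X * B) = det (A * B)"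
    using cA cB C by (simp add: det_mult[of _ 2])
  ultimately show ?thesis using B by (intro V_matsI) auto
qed

lemma det_M2Z_unit:
  assumes "X \<in> M2Z" "Y \<in> M2Z" "X * Y = 1\<^sub>m 2"
  shows "det X = 1 \<or> det X = - 1"
proof -
  from assms(1,2) obtain x y where xy: "det X = of_int x" "det Y = of_int y"
    by (elim M2Z_cases) (metis det_mat2 of_int_diff of_int_mult)
  have "det X * det Y = 1"
    using assms M2Z_subset by (subst det_mult[symmetric, of _ 2]) auto
  then have "of_int (x * y) = (of_int 1 :: rat)" by (simp add: xy)
  then have "x * y = 1" by (simp only: of_int_eq_iff)
  then show ?thesis using xy by (auto simp: zmult_eq_1_iff)
qed

text \<open>A B^-1 = 1 + 2m C B^-1. The modulus is 2m because C is only integral, and it is 2C that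
  lies in \<open>parity_order\<close>. Finiteness of the index rests on this.\<close>

lemma V_mats_of_congruent_units:
  assumes A: "A \<in> parity_order" and B: "B \<in> parity_order" "B' \<in> parity_order" "B * B' = 1\<^sub>m 2"
    and det: "det A = det B"
    and C: "C \<in> M2Z" "A = B + of_nat (2 * m) \<cdot>\<^sub>m C"
  shows "A * B' \<in> V_mats m"
proof -
  have cA: "A \<in> carrier_mat 2 2" and cB: "B \<in> carrier_mat 2 2"
    "B' \<in> carrier_mat 2 2" and cC: "C \<in> carrier_mat 2 2"
    using A B C parity_order_subset_carrier M2Z_subset by auto
  have "A * B' = B * B' + of_nat m \<cdot>\<^sub>m ((of_int 2 \<cdot>\<^sub>m C) * B')"
    using cB cC unfolding C(2) by (elim mat2_cases) (simp add: one_mat2 algebra_simps)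
  then have "A * B' = 1\<^sub>m 2 + of_nat m \<cdot>\<^sub>m ((of_int 2 \<cdot>\<^sub>m C) * B')" using B by simp
  moreover have "(of_int 2 \<cdot>\<^sub>m C) * B' \<in> parity_order"
    using B C by (intro parity_order_mult two_smult_M2Z)
  moreover have "det (A * B') = 1"
  proof -
    have "det (A * B') = det (B * B')" using cA cB det by (simp add: det_mult[of _ 2])
    then show ?thesis using B by simp
  qed
  ultimately show ?thesis by (intro V_matsI)
qed

text \<open>The degree n is arbitrary, so \<open>\<phi>\<close> is not compared with the identity.
  Instead \<open>f\<close> is a multiplicative map into a commutative field, and it takes the value
  1 on the elementary matrices, which generate SL_2(Q).\<close>

lemma det_ring_hom_M2Q:
  fixes \<phi> :: "rat mat \<Rightarrow> 'a :: field mat"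
  assumes \<phi>: "\<phi> \<in> Ring.ring_hom M2Q (ring_mat TYPE('a) n ())"
    and x: "x \<in> carrier_mat 2 2" "det x = 1"
  shows "det (\<phi> x) = 1"
proof -
  define f where "f = (\<lambda>x. det (\<phi> x))"
  have c: "\<phi> A \<in> carrier_mat n n" if "A \<in> carrier_mat 2 2" for A
    using ring_hom_closed[OF \<phi>] that by (simp add: ring_mat_simps)
  have f_mult: "f (A * B) = f A * f B" if "A \<in> carrier_mat 2 2" "B \<in> carrier_mat 2 2" for A B
    using ring_hom_mult[OF \<phi>] that c by (simp add: ring_mat_simps f_def det_mult[of _ n])
  have f_one: "f (mat2 1 0 0 1) = 1"
    using ring_hom_one[OF \<phi>] by (simp add: ring_mat_simps f_def one_mat2)
  \<comment> \<open>Elementary matrices are commutators of a diagonal and an elementary matrix.\<close>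
  have upper: "f (mat2 1 s 0 1) = 1" for s
  proof -
    \<comment> \<open>Conjugation by diag(2, 1/2) multiplies the upper entry by 4; s/3 is chosen
      because 4s/3 = s + s/3.\<close>
    let ?D = "mat2 2 0 0 (1/2) :: rat mat" and ?D' = "mat2 (1/2) 0 0 2 :: rat mat" and ?U = "mat2 1 (s/3) 0 1"
    have "f (?D * ?U * ?D') = f (mat2 1 s 0 1 * ?U)" by (simp add: field_simps)
    moreover have "f (?D * ?U * ?D') = f ?D * f ?U * f ?D'"
      by (simp only: f_mult mat2_carrier mult_carrier_mat[of _ 2 2 _ 2])
    moreover have "f (mat2 1 s 0 1 * ?U) = f (mat2 1 s 0 1) * f ?U" by (rule f_mult) simp_all
    ultimately have 1: "f ?D * f ?U * f ?D' = f (mat2 1 s 0 1) * f ?U" by (simp only:)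
    have "f ?D * f ?D' = f (?D * ?D')" by (simp only: f_mult mat2_carrier)
    then have 2: "f ?D * f ?D' = 1" by (simp add: f_one)
    have "f ?U * f (mat2 1 (-s/3) 0 1) = f (?U * mat2 1 (-s/3) 0 1)"
      by (simp only: f_mult mat2_carrier)
    then have 3: "f ?U \<noteq> 0" by (auto simp: f_one)
    have "f ?D * f ?U * f ?D' = f ?U" using 2 by (metis mult.commute mult.left_commute mult_1)
    with 1 3 show ?thesis by simp
  qed
  have lower: "f (mat2 1 0 s 1) = 1" for s
  proof -
    \<comment> \<open>The Weyl element conjugates upper into lower elementary matrices.\<close>
    have "mat2 1 0 s 1 = mat2 0 1 (-1) 0 * mat2 1 (-s) 0 1 * mat2 0 (-1) 1 0" by simp
    then have 1: "f (mat2 1 0 s 1) = f (mat2 0 1 (-1) 0) * f (mat2 1 (-s) 0 1) * f (mat2 0 (-1) 1 0)"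
      by (simp only: f_mult mat2_carrier mult_carrier_mat[of _ 2 2 _ 2])
    have "f (mat2 0 1 (-1) 0) * f (mat2 0 (-1) 1 0) = f (mat2 0 1 (-1) 0 * mat2 0 (-1) 1 0)"
      by (simp only: f_mult mat2_carrier)
    with 1 show ?thesis by (simp add: upper f_one)
  qed
  have nz: "f (mat2 a b c d) = 1" if "c \<noteq> 0" "a * d - b * c = 1" for a b c d
  proof -
    \<comment> \<open>On the big cell c \<noteq> 0 every matrix of determinant 1 is upper times
      lower times upper elementary.\<close>
    have "mat2 a b c d = mat2 1 ((a - 1) / c) 0 1 * mat2 1 0 c 1 * mat2 1 ((d - 1) / c) 0 1"
      using that by (simp add: field_simps)
    then have "f (mat2 a b c d) = f (mat2 1 ((a - 1) / c) 0 1) * f (mat2 1 0 c 1) * f (mat2 1 ((d - 1) / c) 0 1)"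
      by (simp only: f_mult mat2_carrier mult_carrier_mat[of _ 2 2 _ 2])
    then show ?thesis by (simp add: upper lower)
  qed
  obtain a b c d where xe: "x = mat2 a b c d" using x by (cases rule: mat2_cases)
  have det: "a * d - b * c = 1" using x xe by simp
  show ?thesis
  proof (cases "c = 0")
    case False
    then show ?thesis using nz det xe by (simp add: f_def)
  next
    case True
    then have "a \<noteq> 0" using det by auto
    \<comment> \<open>Adding the first row to the second makes the lower left entry a, which is
      nonzero, so the big cell is reached.\<close>
    then have "f (mat2 1 0 1 1 * x) = 1" using det True by (simp add: xe nz algebra_simps)
    then have "f (mat2 1 0 1 1) * f x = 1" using f_mult x by simp
    then show ?thesis using lower[of 1] by (simp add: f_def)
  qed
qed

text \<open>From left to right one splitting suffices, namely \<open>\<psi>\<close> with its entries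
  read as complex numbers. From right to left every splitting has to be treated: composed with the
  inverse of \<open>\<psi>\<close> it is a homomorphism as in
  \<open>det_ring_hom_M2Q\<close>.\<close>

lemma has_reduced_norm_one_iff:
  assumes "ring A" and \<psi>: "\<psi> \<in> ring_iso A M2Q"
  shows "has_reduced_norm A x \<one>\<^bsub>A\<^esub> \<longleftrightarrow> x \<in> carrier A \<and> det (\<psi> x) = 1"
proof -
  interpret ring A by fact
  note iso = ring_iso_memE[OF \<psi>, unfolded ring_mat_simps]
  let ?inv = "inv_into (carrier A) \<psi>"
  have inv: "?inv \<in> ring_iso M2Q A" by (rule ring_iso_set_sym) fact+
  have \<psi>_inv: "\<psi> (?inv X) = X" "?inv X \<in> carrier A" if "X \<in> carrier_mat 2 2" for X
    using iso(5) that by (auto simp: bij_betw_def f_inv_into_f inv_into_into)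
  have inv_\<psi>: "?inv (\<psi> y) = y" if "y \<in> carrier A" for y
    using iso(5) that by (auto simp: bij_betw_def)
  have one_centre: "\<one>\<^bsub>A\<^esub> \<in> centre A" by (simp add: centre_def)
  show ?thesis
  proof (intro iffI conjI)
    assume h: "has_reduced_norm A x \<one>\<^bsub>A\<^esub>"
    show x: "x \<in> carrier A" using h by (simp add: has_reduced_norm_def)
    define \<phi> where "\<phi> = (\<lambda>a. map_mat (of_rat :: rat \<Rightarrow> complex) (\<psi> a))"
    have hom: "\<phi> \<in> Ring.ring_hom A (ring_mat TYPE(complex) 2 ())"
    proof (rule ring_hom_memI)
      fix a b assume ab: "a \<in> carrier A" "b \<in> carrier A"
      obtain a1 a2 a3 a4 where a: "\<psi> a = mat2 a1 a2 a3 a4" using iso(1)[OF ab(1)]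
        by (rule mat2_cases)
      obtain b1 b2 b3 b4 where b: "\<psi> b = mat2 b1 b2 b3 b4" using iso(1)[OF ab(2)]
        by (rule mat2_cases)
      show "\<phi> (a \<otimes>\<^bsub>A\<^esub> b) = \<phi> a \<otimes>\<^bsub>ring_mat TYPE(complex) 2 ()\<^esub> \<phi> b"
        using ab by (simp add: \<phi>_def iso ring_mat_simps a b of_rat_add of_rat_mult)
      show "\<phi> (a \<oplus>\<^bsub>A\<^esub> b) = \<phi> a \<oplus>\<^bsub>ring_mat TYPE(complex) 2 ()\<^esub> \<phi> b"
        using ab by (simp add: \<phi>_def iso ring_mat_simps a b of_rat_add)
    qed (use iso in \<open>auto simp: \<phi>_def ring_mat_simps one_mat2\<close>)
    have "complex_splitting A 2 \<phi>"
      unfolding complex_splitting_def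
    proof (intro conjI ballI)
      fix M :: "complex mat" assume M: "M \<in> carrier_mat 2 2"
      \<comment> \<open>Preimages of the matrix units. The sum in \<open>complex_splitting\<close>
        runs over a set of algebra elements, so \<open>E\<close> must be injective before the
        entries of M can serve as coefficients.\<close>
      define E where "E = (\<lambda>p. ?inv (mat 2 2 (\<lambda>q. if q = p then 1 else 0)))"
      define I where "I = {..<2::nat} \<times> {..<2::nat}"
      have \<psi>E: "\<psi> (E p) = mat 2 2 (\<lambda>q. if q = p then 1 else 0)" for p
        unfolding E_def by (rule \<psi>_inv) simp
      have inj: "inj_on E I"
      proof (rule inj_onI)
        fix p q assume pq: "p \<in> I" "q \<in> I" "E p = E q"
        then have "\<psi> (E p) $$ p = \<psi> (E q) $$ p" by simp
        then show "p = q" using pq(1,2) unfolding \<psi>E I_def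
          by (auto split: if_splits)
      qed
      define z where "z = (\<lambda>a. M $$ (the_inv_into I E a))"
      have "M $$ (i, j) = (\<Sum>a\<in>E ` I. z a * \<phi> a $$ (i, j))" if ij: "i < 2" "j < 2" for i j
      proof -
        have "(\<Sum>a\<in>E ` I. z a * \<phi> a $$ (i, j)) = (\<Sum>p\<in>I. z (E p) * \<phi> (E p) $$ (i, j))"
          by (simp add: sum.reindex[OF inj])
        also have "\<dots> = (\<Sum>p\<in>I. if p = (i, j) then M $$ p else 0)"
        proof (rule sum.cong[OF refl])
          fix p assume p: "p \<in> I"
          have "z (E p) = M $$ p" unfolding z_def by (simp add: the_inv_into_f_f[OF inj p])
          then show "z (E p) * \<phi> (E p) $$ (i, j) = (if p = (i, j) then M $$ p else 0)"
            using ij by (auto simp: \<phi>_def \<psi>E)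
        qed
        also have "\<dots> = M $$ (i, j)" using ij by (simp add: I_def)
        finally show ?thesis ..
      qed
      then show "\<exists>S z. finite S \<and> S \<subseteq> carrier A \<and> (\<forall>i<2. \<forall>j<2. M $$ (i, j) = (\<Sum>a\<in>S. z a * \<phi> a $$ (i, j)))"
        by (intro exI[of _ "E ` I"] exI[of _ z]) (auto simp: I_def E_def \<psi>_inv)
    qed (use hom in auto)
    then have "\<phi> \<one>\<^bsub>A\<^esub> = det (\<phi> x) \<cdot>\<^sub>m 1\<^sub>m 2"
      using h unfolding has_reduced_norm_def by blast
    moreover obtain x1 x2 x3 x4 where xe: "\<psi> x = mat2 x1 x2 x3 x4" using iso(1)[OF x]
      by (rule mat2_cases)
    ultimately have "of_rat (x1 * x4 - x2 * x3) = (of_rat 1 :: complex)"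
      by (simp add: \<phi>_def iso one_mat2 of_rat_mult of_rat_diff)
    then show "det (\<psi> x) = 1" by (simp only: of_rat_eq_iff xe det_mat2)
  next
    assume x: "x \<in> carrier A \<and> det (\<psi> x) = 1"
    have "\<phi> \<one>\<^bsub>A\<^esub> = det (\<phi> x) \<cdot>\<^sub>m 1\<^sub>m n" if "complex_splitting A n \<phi>" for n \<phi>
    proof -
      have hom: "\<phi> \<in> Ring.ring_hom A (ring_mat TYPE(complex) n ())"
        using that unfolding complex_splitting_def by blast
      have "\<phi> \<circ> ?inv \<in> Ring.ring_hom M2Q (ring_mat TYPE(complex) n ())"
        using inv hom unfolding ring_iso_def by (blast intro: ring_hom_trans)
      from det_ring_hom_M2Q[OF this, of "\<psi> x"] have "det (\<phi> x) = 1"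
        using x iso(1) by (simp add: inv_\<psi>)
      moreover have "\<phi> \<one>\<^bsub>A\<^esub> = 1\<^sub>m n" using ring_hom_one[OF hom] by (simp add: ring_mat_simps)
      ultimately show ?thesis by (auto intro!: eq_matI)
    qed
    then show "has_reduced_norm A x \<one>\<^bsub>A\<^esub>"
      using x one_centre unfolding has_reduced_norm_def by blast
  qed
qed


section \<open>Orders in the matrix algebra\<close>

text \<open>\<open>ring_iso\<close> says nothing about rational scalars; applied to each matrix
  entry, this makes every ring isomorphism with M_2(Q) linear (\<open>iso_smult\<close>).\<close>

lemma rat_additive_linear:
  fixes f :: "rat \<Rightarrow> rat"
  assumes add: "\<And>p q. f (p + q) = f p + f q"
  shows "f q = q * f 1"
proof -
  have zero: "f 0 = 0" using add[of 0 0] by simp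
  have nat: "f (of_nat n * p) = of_nat n * f p" for n p
    by (induction n) (simp_all add: zero add algebra_simps)
  have neg: "f (- p) = - f p" for p using add[of p "- p"] zero by simp
  have int: "f (of_int k * p) = of_int k * f p" for k p
    by (cases k rule: int_cases2) (simp_all add: nat neg)
  obtain a b where "quotient_of q = (a, b)" by (cases "quotient_of q")
  then have ab: "q = of_int a / of_int b" "b > 0"
    by (auto intro: quotient_of_div quotient_of_denom_pos)
  have "of_int b * f q = f (of_int b * q)" by (simp add: int)
  also have "of_int b * q = of_int a * 1" using ab by simp
  also have "f (of_int a * 1) = of_int a * f 1" by (rule int)
  finally have "of_int b * f q = of_int b * (q * f 1)" using ab(1) \<open>b > 0\<close>
    by (metis \<open>of_int b * q = of_int a * 1\<close> mult.assoc mult.right_neutral)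
  then show ?thesis using ab(2) by simp
qed

lemma common_denominator:
  fixes T :: "rat set"
  assumes "finite T"
  shows "\<exists>N>0. \<forall>q\<in>T. of_int N * q \<in> \<int>"
  using assms
proof (induction rule: finite_induct)
  case empty
  show ?case by (rule exI[of _ 1]) simp
next
  case (insert q T)
  then obtain N where N: "N > 0" "\<forall>q\<in>T. of_int N * q \<in> \<int>" by blast
  obtain a b where "quotient_of q = (a, b)" by (cases "quotient_of q")
  then have ab: "q = of_int a / of_int b" "b > 0"
    by (auto intro: quotient_of_div quotient_of_denom_pos)
  have "of_int (b * N) * r \<in> \<int>" if "r \<in> T" for r
    using N(2) that by (simp add: mult.assoc)
  moreover have "of_int (b * N) * q = of_int (N * a)" using ab by simp
  then have "of_int (b * N) * q \<in> \<int>" by (metis Ints_of_int)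
  ultimately show ?case using N(1) ab(2) by (intro exI[of _ "b * N"]) simp
qed

text \<open>For c = a/b in lowest terms, b^k divides N for every k, which forces b = 1. In this form
  integrality follows from the bounded denominators of an order.\<close>

lemma powers_bounded_denominator:
  fixes c :: rat
  assumes "N > 0" "\<And>k. of_int N * c ^ k \<in> \<int>"
  shows "c \<in> \<int>"
proof -
  obtain a b where q: "quotient_of c = (a, b)" by (cases "quotient_of c")
  then have ab: "c = of_int a / of_int b" "b > 0" "coprime a b"
    by (auto intro: quotient_of_div quotient_of_denom_pos quotient_of_coprime)
  have "b ^ k dvd N" for k
  proof -
    obtain l where "of_int N * c ^ k = of_int l" using assms(2) by (blast elim: Ints_cases)
    then have "(of_int (N * a ^ k) :: rat) = of_int (l * b ^ k)"
      using ab by (simp add: field_simps power_divide)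
    then have "N * a ^ k = l * b ^ k" by (simp only: of_int_eq_iff)
    then have "b ^ k dvd N * a ^ k" by simp
    moreover have "coprime (b ^ k) (a ^ k)" using ab(3) by (simp add: coprime_commute)
    ultimately show ?thesis by (simp add: coprime_dvd_mult_left_iff)
  qed
  then have le: "b ^ k \<le> N" for k using assms(1) by (simp add: zdvd_imp_le)
  have "b = 1"
  proof (rule ccontr)
    assume "b \<noteq> 1"
    then have "2 \<le> b" using ab by simp
    \<comment> \<open>The exponent N already contradicts b^k \<le> N.\<close>
    then have "2 ^ nat N \<le> b ^ nat N" by (intro power_mono) auto
    also have "\<dots> \<le> N" by (rule le)
    finally have "int (2 ^ nat N) \<le> int (nat N)" using assms(1) by simp
    then show False using less_exp[of "nat N"] by linarith
  qed
  then show ?thesis using ab by simp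
qed

text \<open>The least positive element divides the others, by division with remainder. It supplies
  the diagonal of the Hermite basis in \<open>order_conj_integral\<close>.\<close>

lemma int_subgroup_cyclic:
  fixes S :: "int set"
  assumes diff: "\<And>s t. s \<in> S \<Longrightarrow> t \<in> S \<Longrightarrow> s - t \<in> S" and nz: "s0 \<in> S" "s0 \<noteq> 0"
  obtains d where "d > 0" "d \<in> S" "\<And>s. s \<in> S \<Longrightarrow> d dvd s"
proof -
  have zero: "0 \<in> S" using diff[OF nz(1) nz(1)] by simp
  have neg: "- s \<in> S" if "s \<in> S" for s using diff[OF zero that] by simp
  have add: "s + t \<in> S" if "s \<in> S" "t \<in> S" for s t using diff[OF that(1) neg[OF that(2)]] by simp
  have nat: "int n * s \<in> S" if "s \<in> S" for n s
    using that by (induction n) (simp_all add: zero add algebra_simps)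
  have mult: "k * s \<in> S" if "s \<in> S" for k s
    by (cases k rule: int_cases2) (use nat[OF that] neg in auto)
  define P where "P = (\<lambda>n. 0 < n \<and> int n \<in> S)"
  have "int (nat \<bar>s0\<bar>) \<in> S" using nz(1) neg by (simp add: abs_if)
  then have "P (nat \<bar>s0\<bar>)" using nz(2) by (simp add: P_def)
  then have P: "P (LEAST n. P n)" by (rule LeastI)
  define d where "d = int (LEAST n. P n)"
  have d: "d > 0" "d \<in> S" using P by (auto simp: d_def P_def)
  moreover have "d dvd s" if "s \<in> S" for s
  proof (rule ccontr)
    assume "\<not> d dvd s"
    then have "s mod d \<noteq> 0" by (simp add: dvd_eq_mod_eq_0)
    then have r: "0 < s mod d" "s mod d < d" using d(1) pos_mod_bound[of d s] pos_mod_sign[of d s]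
      by linarith+
    have "s mod d = s - (s div d) * d" by (simp add: minus_div_mult_eq_mod)
    then have "s mod d \<in> S" using diff[OF that mult[OF d(2)]] by simp
    then have "P (nat (s mod d))" using r by (simp add: P_def)
    then have "(LEAST n. P n) \<le> nat (s mod d)" by (rule Least_le)
    then show False using r by (simp add: d_def)
  qed
  ultimately show ?thesis by (rule that)
qed

text \<open>As x a^-1 lies in V for every x outside V, all such x share the coset of a.\<close>

lemma group_card_rcosets_two:
  assumes "group L" "subgroup V L" "a \<in> carrier L" "a \<notin> V"
    and rep: "\<And>x. x \<in> carrier L \<Longrightarrow> x \<notin> V \<Longrightarrow> x \<otimes>\<^bsub>L\<^esub> inv\<^bsub>L\<^esub> a \<in> V"
  shows "card (rcosets\<^bsub>L\<^esub> V) = 2"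
proof -
  interpret group L by fact
  have one: "V #>\<^bsub>L\<^esub> x = V" if "x \<in> V" for x
    using that assms(2) by (meson coset_join2 subgroup.mem_carrier)
  have two: "V #>\<^bsub>L\<^esub> x = V #>\<^bsub>L\<^esub> a" if "x \<in> carrier L" "x \<notin> V" for x
  proof -
    have "x = (x \<otimes>\<^bsub>L\<^esub> inv\<^bsub>L\<^esub> a) \<otimes>\<^bsub>L\<^esub> a" using that assms(3) by (simp add: m_assoc)
    then have "x \<in> V #>\<^bsub>L\<^esub> a" using rep[OF that] unfolding r_coset_def by blast
    then show ?thesis using repr_independence assms(2,3) by blast
  qed
  have "rcosets\<^bsub>L\<^esub> V = {V, V #>\<^bsub>L\<^esub> a}"
  proof (intro equalityI subsetI)
    fix C assume "C \<in> rcosets\<^bsub>L\<^esub> V"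
    then obtain x where "x \<in> carrier L" "C = V #>\<^bsub>L\<^esub> x" unfolding RCOSETS_def by blast
    then show "C \<in> {V, V #>\<^bsub>L\<^esub> a}" using one two by (cases "x \<in> V") auto
  next
    fix C assume "C \<in> {V, V #>\<^bsub>L\<^esub> a}"
    moreover have "V = V #>\<^bsub>L\<^esub> \<one>\<^bsub>L\<^esub>" using one[of "\<one>\<^bsub>L\<^esub>"] subgroup.one_closed[OF assms(2)] by simp
    ultimately show "C \<in> rcosets\<^bsub>L\<^esub> V" using assms(3) unfolding RCOSETS_def by blast
  qed
  moreover have "V \<noteq> V #>\<^bsub>L\<^esub> a" using rcos_self[OF assms(3,2)] assms(4) by blast
  ultimately show ?thesis by simp
qed

section \<open>Algebras identified with M_2(Q) and their integral elements\<close>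

locale rational_algebra = ring A for A :: "(rat, 'b) module" (structure) +
  assumes smult_closed: "x \<in> carrier A \<Longrightarrow> q \<odot> x \<in> carrier A"
    and smult_l_distr: "x \<in> carrier A \<Longrightarrow> (p + q) \<odot> x = p \<odot> x \<oplus> q \<odot> x"
    and smult_assoc: "x \<in> carrier A \<Longrightarrow> (p * q) \<odot> x = p \<odot> (q \<odot> x)"
    and smult_1: "x \<in> carrier A \<Longrightarrow> 1 \<odot> x = x"

text \<open>The identification is a parameter because several occur: the one given by the
  representation, its conjugates that carry a maximal order to \<open>M2Z\<close>, and the arbitrary
  ones over which the theorem quantifies.\<close>

locale matrix_algebra = rational_algebra +
  fixes \<psi> :: "'a \<Rightarrow> rat mat"
  assumes iso: "\<psi> \<in> ring_iso A M2Q"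
begin

lemmas iso_closed = ring_iso_memE(1)[OF iso, unfolded ring_mat_simps]
  and iso_mult = ring_iso_memE(2)[OF iso, unfolded ring_mat_simps]
  and iso_add = ring_iso_memE(3)[OF iso, unfolded ring_mat_simps]
  and iso_one = ring_iso_memE(4)[OF iso, unfolded ring_mat_simps]
  and iso_bij = ring_iso_memE(5)[OF iso, unfolded ring_mat_simps]

lemma iso_inj: "x \<in> carrier A \<Longrightarrow> y \<in> carrier A \<Longrightarrow> \<psi> x = \<psi> y \<Longrightarrow> x = y"
  using iso_bij by (auto simp: bij_betw_def inj_on_def)

lemma iso_surj:
  assumes "X \<in> carrier_mat 2 2"
  obtains x where "x \<in> carrier A" "\<psi> x = X"
  using assms iso_bij by (metis bij_betw_imp_surj_on imageE)

lemma iso_smult: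
  assumes "x \<in> carrier A"
  shows "\<psi> (q \<odot> x) = q \<cdot>\<^sub>m \<psi> x"
proof -
  have c: "\<psi> (q \<odot> x) \<in> carrier_mat 2 2" for q using assms by (simp add: iso_closed smult_closed)
  have add: "\<psi> ((p + q) \<odot> x) = \<psi> (p \<odot> x) + \<psi> (q \<odot> x)" for p q
    using assms by (simp add: smult_l_distr iso_add smult_closed)
  have lin: "\<psi> (q \<odot> x) $$ (i, j) = q * \<psi> x $$ (i, j)" if "i < 2" "j < 2" for i j
  proof -
    have "\<psi> (q \<odot> x) $$ (i, j) = q * \<psi> (1 \<odot> x) $$ (i, j)"
      by (rule rat_additive_linear) (use that c[THEN carrier_matD(1)] c[THEN carrier_matD(2)] in \<open>simp add: add\<close>)
    then show ?thesis using assms by (simp add: smult_1)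
  qed
  show ?thesis
    by (rule eq_matI) (use c[of q] iso_closed[OF assms] lin in auto)
qed

lemma iso_zero: "\<psi> \<zero> = 0\<^sub>m 2 2"
proof -
  obtain a b c d where e: "\<psi> \<zero> = mat2 a b c d" using iso_closed[OF zero_closed] by (rule mat2_cases)
  have "\<psi> (\<zero> \<oplus> \<zero>) = \<psi> \<zero> + \<psi> \<zero>" by (rule iso_add) simp_all
  then show ?thesis by (simp add: e zero_mat2)
qed

lemma iso_a_inv:
  assumes "x \<in> carrier A"
  shows "\<psi> (\<ominus> x) = - \<psi> x"
proof -
  have cx: "\<ominus> x \<in> carrier A" using assms by simp
  obtain a b c d where e: "\<psi> x = mat2 a b c d" using iso_closed[OF assms] by (rule mat2_cases)
  obtain a' b' c' d' where e': "\<psi> (\<ominus> x) = mat2 a' b' c' d'" using iso_closed[OF cx]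
    by (rule mat2_cases)
  have "\<psi> (x \<oplus> \<ominus> x) = \<psi> x + \<psi> (\<ominus> x)" using assms by (simp add: iso_add)
  then have "a + a' = 0" "b + b' = 0" "c + c' = 0" "d + d' = 0"
    using assms by (simp_all add: r_neg iso_zero e e' zero_mat2)
  then show ?thesis by (simp add: e e' eq_neg_iff_add_eq_0 add.commute)
qed

definition integral_elements :: "'a set" where
  "integral_elements = {x \<in> carrier A. \<psi> x \<in> M2Z}"

text \<open>A common denominator survives sums, so a bound for the generators of an order is a bound
  for the whole order. The case N = 1 gives the additive group of
  \<open>integral_elements\<close>.\<close>

lemma add_subgroup_bounded:
  "subgroup {x \<in> carrier A. of_int N \<cdot>\<^sub>m \<psi> x \<in> M2Z} (add_monoid A)" (is "subgroup ?B _")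
proof -
  show ?thesis
  proof (rule group.subgroupI[OF a_group])
    have "of_int N \<cdot>\<^sub>m \<psi> \<zero> \<in> M2Z" by (simp add: iso_zero zero_mat2)
    then show "?B \<noteq> {}" by blast
  next
    fix x assume x: "x \<in> ?B"
    then have "x \<in> carrier A" by simp
    then obtain a b c d where "\<psi> x = mat2 a b c d" using iso_closed mat2_cases by metis
    then have "of_int N \<cdot>\<^sub>m \<psi> (\<ominus> x) \<in> M2Z" using x by (simp add: iso_a_inv)
    then show "inv\<^bsub>add_monoid A\<^esub> x \<in> ?B"
      using x by (simp flip: a_inv_def)
  next
    fix x y assume xy: "x \<in> ?B"
      "y \<in> ?B"
    then have xyc: "x \<in> carrier A" "y \<in> carrier A" by auto
    obtain a b c d where "\<psi> x = mat2 a b c d" using xyc iso_closed mat2_cases by metis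
    moreover obtain a' b' c' d' where "\<psi> y = mat2 a' b' c' d'" using xyc iso_closed mat2_cases
      by metis
    ultimately have "of_int N \<cdot>\<^sub>m \<psi> (x \<oplus> y) \<in> M2Z" using xy by (simp add: iso_add distrib_left)
    then show "x \<otimes>\<^bsub>add_monoid A\<^esub> y \<in> ?B"
      using xy by simp
  qed auto
qed

lemma finite_bounded:
  assumes "finite S" "S \<subseteq> carrier A"
  shows "\<exists>N>0. \<forall>x\<in>S. of_int N \<cdot>\<^sub>m \<psi> x \<in> M2Z"
proof -
  define T where "T = (\<lambda>(x, p). \<psi> x $$ p) ` (S \<times> ({..<2} \<times> {..<2}))"
  have "finite T" unfolding T_def using assms by simp
  then obtain N where N: "N > 0" "\<forall>q\<in>T. of_int N * q \<in> \<int>" using common_denominator by blast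
  have "of_int N \<cdot>\<^sub>m \<psi> x \<in> M2Z" if "x \<in> S" for x
  proof -
    have "x \<in> carrier A" using assms that by blast
    then obtain a b c d where e: "\<psi> x = mat2 a b c d" using iso_closed mat2_cases by metis
    have "\<psi> x $$ (i, j) \<in> T" if "i < 2" "j < 2" for i j
      unfolding T_def using that \<open>x \<in> S\<close> by (intro image_eqI[of _ _ "(x, (i, j))"]) auto
    from this[of 0 0] this[of 0 1] this[of 1 0] this[of 1 1]
    have "a \<in> T" "b \<in> T" "c \<in> T" "d \<in> T" by (simp_all add: e)
    then show ?thesis using N(2) by (simp add: e)
  qed
  then show ?thesis using N(1) by blast
qed

lemma order_bounded:
  assumes "is_order A R"
  shows "\<exists>N>0. \<forall>x\<in>R. of_int N \<cdot>\<^sub>m \<psi> x \<in> M2Z"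
proof -
  from assms obtain S where S: "finite S" "S \<subseteq> R" "R = generate (add_monoid A) S"
    and "subring R A" unfolding is_order_def by blast
  then have "S \<subseteq> carrier A" using subringE(1) by blast
  then obtain N where N: "N > 0" "\<forall>x\<in>S. of_int N \<cdot>\<^sub>m \<psi> x \<in> M2Z" using finite_bounded S by blast
  have "generate (add_monoid A) S \<subseteq> {x \<in> carrier A. of_int N \<cdot>\<^sub>m \<psi> x \<in> M2Z}"
    by (rule group.generate_subgroup_incl[OF a_group _ add_subgroup_bounded]) (use N \<open>S \<subseteq> carrier A\<close> in blast)
  then show ?thesis using N(1) S(3) by blast
qed

lemma add_subgroup_int_smult:
  assumes B: "subgroup B (add_monoid A)" and y: "y \<in> B"
  shows "of_int k \<odot> y \<in> B"
proof -
  have c: "y \<in> carrier A" using subgroup.subset[OF B] y by auto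
  have add: "u \<oplus> v \<in> B" if "u \<in> B" "v \<in> B" for u v using subgroup.m_closed[OF B that] by simp
  have zero: "\<zero> \<in> B" using subgroup.one_closed[OF B] by simp
  have neg: "\<ominus> u \<in> B" if "u \<in> B" for u using subgroup.m_inv_closed[OF B that]
    by (simp add: a_inv_def)
  have z: "0 \<odot> y = \<zero>"
    by (rule iso_inj) (use c in \<open>auto simp: smult_closed iso_smult iso_zero intro!: eq_matI dest: iso_closed\<close>)
  have nat: "of_nat n \<odot> y \<in> B" for n
    by (induction n) (use c y in \<open>simp_all add: z zero smult_l_distr smult_1 add\<close>)
  have "(- of_nat n) \<odot> y = \<ominus> (of_nat n \<odot> y)" for n
    by (rule iso_inj) (use c in \<open>auto simp: smult_closed iso_smult iso_a_inv intro!: eq_matI dest: iso_closed\<close>)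
  then have "(- of_nat n) \<odot> y \<in> B" for n using neg nat by simp
  then show ?thesis using nat by (cases k rule: int_cases2) simp_all
qed

lemma subring_integral: "subring integral_elements A"
proof (rule subringI)
  have "subgroup integral_elements (add_monoid A)"
  proof -
    have "1 \<cdot>\<^sub>m \<psi> x = \<psi> x" for x by (rule eq_matI) auto
    then show ?thesis using add_subgroup_bounded[of 1] by (simp add: integral_elements_def)
  qed
  then show "\<ominus> x \<in> integral_elements" if "x \<in> integral_elements" for x
    using subgroup.m_inv_closed that by (fastforce simp: a_inv_def)
  show "x \<oplus> y \<in> integral_elements" if "x \<in> integral_elements" "y \<in> integral_elements" for x y
    using subgroup.m_closed[OF \<open>subgroup integral_elements (add_monoid A)\<close>] that by simp
  show "x \<otimes> y \<in> integral_elements" if "x \<in> integral_elements" "y \<in> integral_elements" for x y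
    using that unfolding integral_elements_def by (auto simp: iso_mult elim!: M2Z_cases)
  show "\<one> \<in> integral_elements" by (simp add: integral_elements_def iso_one one_mat2)
qed (auto simp: integral_elements_def)

lemma is_order_integral: "is_order A integral_elements"
  unfolding is_order_def
proof (intro conjI)
  show "subring integral_elements A" by (rule subring_integral)
  obtain e1 where e1: "e1 \<in> carrier A" "\<psi> e1 = mat2 1 0 0 0"
    by (rule iso_surj[of "mat2 1 0 0 0"]) simp_all
  obtain e2 where e2: "e2 \<in> carrier A" "\<psi> e2 = mat2 0 1 0 0"
    by (rule iso_surj[of "mat2 0 1 0 0"]) simp_all
  obtain e3 where e3: "e3 \<in> carrier A" "\<psi> e3 = mat2 0 0 1 0"
    by (rule iso_surj[of "mat2 0 0 1 0"]) simp_all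
  obtain e4 where e4: "e4 \<in> carrier A" "\<psi> e4 = mat2 0 0 0 1"
    by (rule iso_surj[of "mat2 0 0 0 1"]) simp_all
  let ?S = "{e1, e2, e3, e4}"
  have S: "?S \<subseteq> integral_elements" by (simp add: integral_elements_def e1 e2 e3 e4)
  have sub: "subgroup integral_elements (add_monoid A)"
    using subring_integral by (simp add: subring.axioms(1))
  have "integral_elements = generate (add_monoid A) ?S"
  proof (intro equalityI subsetI)
    fix x assume "x \<in> integral_elements"
    then have x: "x \<in> carrier A" "\<psi> x \<in> M2Z" by (auto simp: integral_elements_def)
    then obtain a b c d where xe: "\<psi> x = mat2 (of_int a) (of_int b) (of_int c) (of_int d)"
      by (blast elim: M2Z_cases)
    let ?B = "generate (add_monoid A) ?S"
    have B: "subgroup ?B (add_monoid A)"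
      by (rule group.generate_is_subgroup[OF a_group]) (simp add: e1 e2 e3 e4)
    have in_B: "y \<in> ?B" if "y \<in> ?S" for y using that by (rule generate.incl)
    let ?y = "of_int a \<odot> e1 \<oplus> of_int b \<odot> e2 \<oplus> of_int c \<odot> e3 \<oplus> of_int d \<odot> e4"
    have "?y \<in> ?B"
      using subgroup.m_closed[OF B] by (simp add: add_subgroup_int_smult[OF B] in_B)
    moreover have "x = ?y"
      by (rule iso_inj) (simp_all add: x e1 e2 e3 e4 smult_closed iso_add iso_smult xe)
    ultimately show "x \<in> ?B" by simp
  next
    fix x assume "x \<in> generate (add_monoid A) ?S"
    then show "x \<in> integral_elements" using group.generate_subgroup_incl[OF a_group S sub] by blast
  qed
  then show "\<exists>S. finite S \<and> S \<subseteq> integral_elements \<and> integral_elements = generate (add_monoid A) S"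
    using S by (intro exI[of _ ?S]) auto
  show "carrier A = {q \<odot> x |q x. x \<in> integral_elements}"
  proof (intro equalityI subsetI)
    fix x assume x: "x \<in> carrier A"
    then obtain N where N: "N > 0" "of_int N \<cdot>\<^sub>m \<psi> x \<in> M2Z" using finite_bounded[of "{x}"] by auto
    have "of_int N \<odot> x \<in> integral_elements"
      using x N by (simp add: integral_elements_def smult_closed iso_smult)
    moreover have "x = (1 / of_int N) \<odot> (of_int N \<odot> x)"
      using x N by (simp add: smult_1 flip: smult_assoc)
    ultimately show "x \<in> {q \<odot> x |q x. x \<in> integral_elements}" by blast
  qed (auto simp: integral_elements_def smult_closed)
qed

lemma subring_image_mult:
  assumes "subring R A" "X \<in> \<psi> ` R" "Y \<in> \<psi> ` R"
  shows "X * Y \<in> \<psi> ` R"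
proof -
  obtain x y where xy: "x \<in> R" "y \<in> R" "X = \<psi> x" "Y = \<psi> y" using assms by blast
  then have "x \<otimes> y \<in> R" "x \<in> carrier A" "y \<in> carrier A" using subringE[OF assms(1)] by auto
  then show ?thesis using xy by (metis image_eqI iso_mult)
qed

text \<open>A larger order contains the matrix units, so any entry c of an element can be moved to
  the upper left corner with zeros elsewhere. All powers of the resulting matrix stay in the order,
  whose denominators are bounded; hence c is an integer.\<close>

lemma is_maximal_order_integral: "is_maximal_order A integral_elements"
  unfolding is_maximal_order_def
proof (intro conjI allI impI)
  show "is_order A integral_elements" by (rule is_order_integral)
  fix R assume R: "is_order A R \<and> integral_elements \<subseteq> R"
  then obtain N where N: "N > 0" "\<forall>x\<in>R. of_int N \<cdot>\<^sub>m \<psi> x \<in> M2Z" using order_bounded by blast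
  have sR: "subring R A" using R unfolding is_order_def by blast
  define I where "I = \<psi> ` R"
  note I_mult = subring_image_mult[OF sR, folded I_def]
  have M2Z_I: "X \<in> I" if X: "X \<in> M2Z" for X
  proof -
    obtain x where "x \<in> carrier A" "\<psi> x = X" using X M2Z_subset iso_surj by blast
    then have "x \<in> R" using R X unfolding integral_elements_def by blast
    then show ?thesis unfolding I_def using \<open>\<psi> x = X\<close> by blast
  qed
  have entry: "c \<in> \<int>" if c: "mat2 c 0 0 0 \<in> I" for c
  proof (rule powers_bounded_denominator[OF N(1)])
    fix k
    have "mat2 (c ^ k) 0 0 0 \<in> I"
    proof (induction k)
      case 0
      show ?case by (rule M2Z_I) simp
    next
      case (Suc k)
      show ?case using I_mult[OF c Suc] by simp
    qed
    then obtain y where "y \<in> R" "\<psi> y = mat2 (c ^ k) 0 0 0" unfolding I_def by auto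
    then show "of_int N * c ^ k \<in> \<int>" using N(2) by fastforce
  qed
  have "R \<subseteq> integral_elements"
  proof
    fix x assume x: "x \<in> R"
    then have xc: "x \<in> carrier A" using subringE(1)[OF sR] by blast
    obtain a b c d where xe: "\<psi> x = mat2 a b c d" using iso_closed[OF xc] by (rule mat2_cases)
    have I: "mat2 a b c d \<in> I" using x unfolding I_def xe[symmetric] by blast
    have "mat2 1 0 0 0 * mat2 a b c d * mat2 1 0 0 0 \<in> I"
      "mat2 1 0 0 0 * mat2 a b c d * mat2 0 0 1 0 \<in> I"
      "mat2 0 1 0 0 * mat2 a b c d * mat2 1 0 0 0 \<in> I"
        "mat2 0 1 0 0 * mat2 a b c d * mat2 0 0 1 0 \<in> I"
      by (intro I_mult I M2Z_I; simp)+
    then have "a \<in> \<int>" "b \<in> \<int>" "c \<in> \<int>" "d \<in> \<int>" by (simp_all add: entry)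
    then show "x \<in> integral_elements" using xc by (simp add: integral_elements_def xe)
  qed
  then show "R = integral_elements" using R by blast
qed

end

lemma ring_iso_conj:
  assumes P: "P \<in> carrier_mat 2 2" "P' \<in> carrier_mat 2 2" "P * P' = 1\<^sub>m 2" "P' * P = 1\<^sub>m 2"
  shows "(\<lambda>X. P' * X * P) \<in> ring_iso M2Q M2Q"
proof -
  have inverse_left: "P * (P' * X * P) * P' = X" if "X \<in> carrier_mat 2 2" for X
  proof -
    have "P * (P' * X * P) * P' = (P * P') * X * (P * P')"
      using P(1,2) that by (simp add: assoc_mult_mat[of _ 2 2 _ 2 _ 2])
    then show ?thesis using that P by simp
  qed
  have inverse_right: "P' * (P * X * P') * P = X" if "X \<in> carrier_mat 2 2" for X
  proof -
    have "P' * (P * X * P') * P = (P' * P) * X * (P' * P)"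
      using P(1,2) that by (simp add: assoc_mult_mat[of _ 2 2 _ 2 _ 2])
    then show ?thesis using that P by simp
  qed
  show ?thesis
  proof (rule ring_iso_memI, unfold ring_mat_simps)
    fix X Y :: "rat mat" assume XY: "X \<in> carrier_mat 2 2" "Y \<in> carrier_mat 2 2"
    show "P' * X * P \<in> carrier_mat 2 2" using P XY by simp
    have "P' * X * P * (P' * Y * P) = P' * X * (P * P') * Y * P"
      using P(1,2) XY by (simp add: assoc_mult_mat[of _ 2 2 _ 2 _ 2])
    also have "\<dots> = P' * (X * Y) * P" using P XY by (simp add: assoc_mult_mat[of _ 2 2 _ 2 _ 2])
    finally show "P' * (X * Y) * P = P' * X * P * (P' * Y * P)" ..
    show "P' * (X + Y) * P = P' * X * P + P' * Y * P"
      using P(1,2) XY by (simp add: mult_add_distrib_mat[of _ 2 2] add_mult_distrib_mat[of _ 2 2])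
  next
    show "P' * 1\<^sub>m 2 * P = 1\<^sub>m 2" using P by simp
    show "bij_betw (\<lambda>X. P' * X * P) (carrier_mat 2 2) (carrier_mat 2 2)"
      by (rule bij_betw_byWitness[of _ "\<lambda>X. P * X * P'"]) (use P inverse_left inverse_right in auto)
  qed
qed

text \<open>Agrees literally with the block of the theorem on congruence subgroups, so that it can
  be proved for any identification and merely unfolded at the end.\<close>

definition congruence_relations :: "(rat, 'b) module \<Rightarrow> 'b set \<Rightarrow> ('b \<Rightarrow> rat mat) \<Rightarrow> nat \<Rightarrow> bool" where
  "congruence_relations B R \<psi> m \<longleftrightarrow>
    (let U = units_of B;
         V = {x \<in> carrier B. \<psi> x \<in> V_mats m};
         \<Gamma> = principal_congruence B R
     in subgroup (\<Gamma> m) U \<and>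
        subgroup V (U\<lparr>carrier := \<Gamma> m\<rparr>) \<and>
        subgroup (\<Gamma> (2 * m)) (U\<lparr>carrier := V\<rparr>) \<and>
        card (rcosets\<^bsub>U\<lparr>carrier := \<Gamma> m\<rparr>\<^esub> V) = 2)"

section \<open>Maximal orders and their congruence subgroups\<close>

context matrix_algebra
begin

text \<open>An order stabilises the lattice \<open>L\<close> of all vectors it maps into \<open>\<int>\<^sup>2\<close>; conjugation by a basis
  of \<open>L\<close> in Hermite normal form moves the order into \<open>M2Z\<close>.\<close>

lemma order_conj_integral:
  assumes O: "is_order A R"
  obtains P P' where "P \<in> carrier_mat 2 2" "P' \<in> carrier_mat 2 2" "P * P' = 1\<^sub>m 2" "P' * P = 1\<^sub>m 2"
    "\<And>x. x \<in> R \<Longrightarrow> P' * \<psi> x * P \<in> M2Z"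
proof -
  obtain N where N: "N > 0" "\<forall>x\<in>R. of_int N \<cdot>\<^sub>m \<psi> x \<in> M2Z" using order_bounded[OF O] by blast
  have sR: "subring R A" using O unfolding is_order_def by blast
  define I where "I = \<psi> ` R"
  note I_mult = subring_image_mult[OF sR, folded I_def]
  have I_one: "mat2 1 0 0 1 \<in> I" using subringE(3)[OF sR] iso_one unfolding I_def one_mat2
    by (metis image_eqI)
  have I_carrier: "I \<subseteq> carrier_mat 2 2" using subringE(1)[OF sR] iso_closed unfolding I_def by blast
  \<comment> \<open>L has full rank because the common denominator N puts (N, 0) and (0, N) into it;
    it is stable under \<open>I\<close> because \<open>I\<close> is closed under products.\<close>
  define L where "L = {(x :: int, y :: int). \<forall>a b c d. mat2 a b c d \<in> I \<longrightarrow>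
    a * of_int x + b * of_int y \<in> \<int> \<and> c * of_int x + d * of_int y \<in> \<int>}"
  have LI: "a * of_int x + b * of_int y \<in> \<int> \<and> c * of_int x + d * of_int y \<in> \<int>"
    if "(x, y) \<in> L" "mat2 a b c d \<in> I" for x y a b c d
    using that unfolding L_def by blast
  have L_diff: "(x - x', y - y') \<in> L" if "(x, y) \<in> L" "(x', y') \<in> L" for x y x' y'
  proof -
    have "a * of_int (x - x') + b * of_int (y - y') \<in> \<int> \<and> c * of_int (x - x') + d * of_int (y - y') \<in> \<int>"
      if abcd: "mat2 a b c d \<in> I" for a b c d
    proof -
      have "a * of_int (x - x') + b * of_int (y - y') = (a * of_int x + b * of_int y) - (a * of_int x' + b * of_int y')"
        "c * of_int (x - x') + d * of_int (y - y') = (c * of_int x + d * of_int y) - (c * of_int x' + d * of_int y')"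
        by (simp_all add: algebra_simps)
      then show ?thesis using LI[OF \<open>(x, y) \<in> L\<close> abcd] LI[OF \<open>(x', y') \<in> L\<close> abcd] by simp
    qed
    then show ?thesis unfolding L_def by blast
  qed
  have L_N: "(N, 0) \<in> L" "(0, N) \<in> L"
  proof -
    have "of_int N * a \<in> \<int> \<and> of_int N * b \<in> \<int> \<and> of_int N * c \<in> \<int> \<and> of_int N * d \<in> \<int>"
      if abcd: "mat2 a b c d \<in> I" for a b c d
    proof -
      obtain x where "x \<in> R" "\<psi> x = mat2 a b c d"
        using abcd unfolding I_def by (elim imageE) simp
      then show ?thesis using N(2) by fastforce
    qed
    then show "(N, 0) \<in> L" "(0, N) \<in> L" unfolding L_def by (auto simp: mult.commute)
  qed
  have L_stable: "\<exists>u v. of_int u = a * of_int x + b * of_int y \<and> of_int v = c * of_int x + d * of_int y \<and> (u, v) \<in> L"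
    if xy: "(x, y) \<in> L" and abcd: "mat2 a b c d \<in> I" for a b c d x y
  proof -
    obtain u v
      where uv: "a * of_int x + b * of_int y = of_int u" "c * of_int x + d * of_int y = of_int v"
      using LI[OF xy abcd] by (auto elim!: Ints_cases)
    have "a' * of_int u + b' * of_int v \<in> \<int> \<and> c' * of_int u + d' * of_int v \<in> \<int>"
      if "mat2 a' b' c' d' \<in> I" for a' b' c' d'
    proof -
      have "mat2 (a' * a + b' * c) (a' * b + b' * d) (c' * a + d' * c) (c' * b + d' * d) \<in> I"
        using I_mult[OF that abcd] by simp
      from LI[OF xy this] show ?thesis unfolding uv[symmetric] by (simp add: algebra_simps)
    qed
    then have "(u, v) \<in> L" unfolding L_def by blast
    then show ?thesis using uv by metis
  qed
  have "s - t \<in> snd ` L" if st: "s \<in> snd ` L" "t \<in> snd ` L" for s t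
  proof -
    obtain x x' where "(x, s) \<in> L" "(x', t) \<in> L" using st by auto
    from L_diff[OF this] show ?thesis by (rule image_eqI[rotated]) simp
  qed
  moreover have "N \<in> snd ` L" using L_N(2) by (rule image_eqI[rotated]) simp
  \<comment> \<open>y0 generates the second coordinates of L, and x1 below generates its part on the
    first axis. With any lift (x0, y0), the vectors (x1, 0) and (x0, y0) form a basis.\<close>
  ultimately obtain y0 where y0: "y0 > 0" "y0 \<in> snd ` L" "\<And>y. y \<in> snd ` L \<Longrightarrow> y0 dvd y"
    using N(1) by (elim int_subgroup_cyclic[of "snd ` L" N]) auto
  obtain x1 where x1: "x1 > 0" "x1 \<in> {x. (x, 0) \<in> L}" "\<And>x. x \<in> {x. (x, 0) \<in> L} \<Longrightarrow> x1 dvd x"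
    by (rule int_subgroup_cyclic[of "{x. (x, 0) \<in> L}" N]) (use L_diff[of _ 0 _ 0] L_N N in auto)
  obtain x0 where x0: "(x0, y0) \<in> L" using y0(2) by auto
  have L_zero: "(0, 0) \<in> L" using L_diff[OF x0 x0] by simp
  have L_neg: "(- x, - y) \<in> L" if "(x, y) \<in> L" for x y using L_diff[OF L_zero that] by simp
  have L_nat: "(int n * x, int n * y) \<in> L" if "(x, y) \<in> L" for n x y
  proof (induction n)
    case 0
    show ?case using L_zero by simp
  next
    case (Suc n)
    from L_diff[OF this L_neg[OF that]] show ?case by (simp add: algebra_simps)
  qed
  have L_mult: "(k * x, k * y) \<in> L" if "(x, y) \<in> L" for k x y
    by (cases k rule: int_cases2) (use L_nat[OF that] L_neg in force)+
  have L_basis: "\<exists>k l. x = k * x1 + l * x0 \<and> y = l * y0" if xy: "(x, y) \<in> L" for x y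
  proof -
    obtain l where l: "y = l * y0" using y0(3)[of y] xy by (force simp: mult.commute)
    have "(x - l * x0, y - l * y0) \<in> L" by (rule L_diff[OF xy L_mult[OF x0]])
    then have "x1 dvd x - l * x0" using x1(3) l by simp
    then obtain k where "x - l * x0 = x1 * k" by blast
    then show ?thesis using l by (intro exI[of _ k] exI[of _ l]) (simp add: algebra_simps)
  qed
  define P where "P = mat2 (of_int x1) (of_int x0) 0 (of_int y0 :: rat)"
  define P'
    where "P' = mat2 (1 / of_int x1) (- of_int x0 / (of_int x1 * of_int y0)) 0 (1 / of_int y0 :: rat)"
  have PP': "P * P' = 1\<^sub>m 2" "P' * P = 1\<^sub>m 2"
    using x1(1) y0(1) by (simp_all add: P_def P'_def one_mat2)
  show ?thesis
  proof (rule that[of P P'])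
    fix x assume x: "x \<in> R"
    then have xI: "\<psi> x \<in> I" unfolding I_def by blast
    then obtain a b c d where xe: "\<psi> x = mat2 a b c d" using I_carrier mat2_cases by blast
    have I: "mat2 a b c d \<in> I" using xI by (simp add: xe)
    obtain u v
      where uv: "of_int u = a * of_int x1 + b * of_int 0" "of_int v = c * of_int x1 + d * of_int 0"
      "(u, v) \<in> L"
      using L_stable[OF _ I, of x1 0] x1(2) by blast
    obtain u' v'
      where uv': "of_int u' = a * of_int x0 + b * of_int y0"
      "of_int v' = c * of_int x0 + d * of_int y0" "(u', v') \<in> L"
      using L_stable[OF x0 I] by blast
    obtain k l where kl: "u = k * x1 + l * x0" "v = l * y0" using L_basis[OF uv(3)] by blast
    obtain k' l' where kl': "u' = k' * x1 + l' * x0" "v' = l' * y0" using L_basis[OF uv'(3)]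
      by blast
    \<comment> \<open>Its columns are the coordinates, in the basis of L, of the images of the two
      basis vectors under \<open>\<psi> x\<close>.\<close>
    let ?K = "mat2 (of_int k) (of_int k') (of_int l) (of_int l') :: rat mat"
    have "\<psi> x * P = P * ?K"
      using uv uv' by (simp add: xe P_def kl kl' algebra_simps)
    then have "P' * (\<psi> x * P) = P' * (P * ?K)" by simp
    then have "P' * \<psi> x * P = (P' * P) * ?K"
      by (simp add: P_def P'_def xe assoc_mult_mat[of _ 2 2 _ 2 _ 2] del: mat2_mult)
    then have "P' * \<psi> x * P = ?K" by (simp add: PP' del: mat2_mult)
    then show "P' * \<psi> x * P \<in> M2Z" by simp
  qed (use PP' in \<open>simp_all add: P_def P'_def\<close>)
qed

text \<open>After conjugation R lies in the integral elements of the new identification. These form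
  an order, so maximality of R turns the inclusion into an equality.\<close>

lemma maximal_order_iso:
  assumes "is_maximal_order A R"
  shows "\<exists>\<psi>'\<in>ring_iso A M2Q. \<psi>' ` R = M2Z"
proof -
  have O: "is_order A R" using assms unfolding is_maximal_order_def by blast
  obtain P P'
    where P: "P \<in> carrier_mat 2 2" "P' \<in> carrier_mat 2 2" "P * P' = 1\<^sub>m 2" "P' * P = 1\<^sub>m 2"
    "\<And>x. x \<in> R \<Longrightarrow> P' * \<psi> x * P \<in> M2Z"
    using order_conj_integral[OF O] by metis
  define \<psi>' where "\<psi>' = (\<lambda>X. P' * X * P) \<circ> \<psi>"
  have iso': "\<psi>' \<in> ring_iso A M2Q"
    unfolding \<psi>'_def by (rule ring_iso_set_trans[OF iso ring_iso_conj]) fact+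
  interpret conj: matrix_algebra A \<psi>' by unfold_locales (rule iso')
  have "R \<subseteq> carrier A" using O subringE(1) unfolding is_order_def by blast
  then have "R \<subseteq> conj.integral_elements"
    using P(5) by (auto simp: conj.integral_elements_def) (simp add: \<psi>'_def)
  then have "R = conj.integral_elements"
    using assms conj.is_order_integral unfolding is_maximal_order_def by blast
  moreover have "\<psi>' ` conj.integral_elements = M2Z"
  proof (intro equalityI subsetI)
    fix X assume "X \<in> M2Z"
    then obtain x where "x \<in> carrier A" "\<psi>' x = X" using conj.iso_surj M2Z_subset by blast
    then show "X \<in> \<psi>' ` conj.integral_elements"
      using \<open>X \<in> M2Z\<close> by (auto simp: conj.integral_elements_def)
  qed (auto simp: conj.integral_elements_def)
  ultimately show ?thesis using iso' by blast
qed

text \<open>Reduced norm one becomes determinant one by \<open>has_reduced_norm_one_iff\<close>;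
  what remains is the definition of \<open>Gamma_mats\<close>, transported along
  \<open>\<psi>\<close>.\<close>

lemma principal_congruence_eq:
  assumes "R \<subseteq> carrier A" "\<psi> ` R = M2Z"
  shows "principal_congruence A R m = {x \<in> carrier A. \<psi> x \<in> Gamma_mats m}"
proof (intro equalityI subsetI)
  fix x assume "x \<in> principal_congruence A R m"
  then obtain y
    where x: "x \<in> R" "det (\<psi> x) = 1" "x \<in> carrier A" and y: "y \<in> R" "x = \<one> \<oplus> of_nat m \<odot> y"
    unfolding principal_congruence_def SL1_order_def
    by (auto simp: has_reduced_norm_one_iff[OF ring_axioms iso])
  have "\<psi> x = 1\<^sub>m 2 + of_nat m \<cdot>\<^sub>m \<psi> y"
    using y assms(1) by (simp add: subset_iff iso_add smult_closed iso_one iso_smult)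
  then show "x \<in> {x \<in> carrier A. \<psi> x \<in> Gamma_mats m}"
    using x y(1) assms(2) unfolding Gamma_mats_def by blast
next
  fix x assume "x \<in> {x \<in> carrier A. \<psi> x \<in> Gamma_mats m}"
  then obtain Y where x: "x \<in> carrier A" "\<psi> x \<in> M2Z" "det (\<psi> x) = 1"
    and Y: "Y \<in> M2Z" "\<psi> x = 1\<^sub>m 2 + of_nat m \<cdot>\<^sub>m Y"
    unfolding Gamma_mats_def by blast
  have "x \<in> R"
  proof -
    obtain x' where "x' \<in> R" "\<psi> x' = \<psi> x"
      using x(2) unfolding assms(2)[symmetric] by (elim imageE) simp
    then have "x' = x" using x(1) assms(1) by (intro iso_inj) auto
    then show ?thesis using \<open>x' \<in> R\<close> by simp
  qed
  obtain y where y: "y \<in> R" "\<psi> y = Y"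
    using Y(1) unfolding assms(2)[symmetric] by (elim imageE) simp
  have "x = \<one> \<oplus> of_nat m \<odot> y"
  proof (rule iso_inj)
    have yc: "y \<in> carrier A" using y(1) assms(1) by blast
    then show "\<one> \<oplus> of_nat m \<odot> y \<in> carrier A" by (simp add: smult_closed)
    show "\<psi> x = \<psi> (\<one> \<oplus> of_nat m \<odot> y)"
      using yc by (simp add: Y(2) iso_add smult_closed iso_one iso_smult y(2))
  qed (rule x)
  then show "x \<in> principal_congruence A R m"
    using x \<open>x \<in> R\<close> y(1) unfolding principal_congruence_def SL1_order_def
    by (auto simp: has_reduced_norm_one_iff[OF ring_axioms iso])
qed


lemma mat_group_units:
  assumes S: "mat_group S" and x: "x \<in> carrier A" "\<psi> x \<in> S"
  shows "x \<in> Units A" "\<psi> (inv x) \<in> S"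
proof -
  obtain Y where Y: "Y \<in> S" "\<psi> x * Y = 1\<^sub>m 2" "Y * \<psi> x = 1\<^sub>m 2" using S x(2) unfolding mat_group_def
    by blast
  then have "Y \<in> carrier_mat 2 2" using S unfolding mat_group_def by blast
  then obtain y where y: "y \<in> carrier A" "\<psi> y = Y" by (rule iso_surj)
  have xy: "x \<otimes> y = \<one>" "y \<otimes> x = \<one>"
    by (rule iso_inj; use x y Y in \<open>simp add: iso_mult iso_one\<close>)+
  then show "x \<in> Units A" using x(1) y(1) unfolding Units_def by blast
  have "inv x = y" using xy x(1) y(1) by (intro inv_char) auto
  then show "\<psi> (inv x) \<in> S" using y Y by simp
qed

lemma mat_group_subgroup:
  assumes S: "mat_group S"
  shows "subgroup {x \<in> carrier A. \<psi> x \<in> S} (units_of A)"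
proof (rule group.subgroupI[OF units_group])
  show "{x \<in> carrier A. \<psi> x \<in> S} \<subseteq> carrier (units_of A)"
    using mat_group_units[OF S] by (auto simp: units_of_def)
  have "\<one> \<in> {x \<in> carrier A. \<psi> x \<in> S}" using S by (simp add: iso_one mat_group_def)
  then show "{x \<in> carrier A. \<psi> x \<in> S} \<noteq> {}" by blast
next
  fix x assume x: "x \<in> {x \<in> carrier A. \<psi> x \<in> S}"
  then have "x \<in> Units A" "\<psi> (inv x) \<in> S" using mat_group_units[OF S] by auto
  then show "inv\<^bsub>units_of A\<^esub> x \<in> {x \<in> carrier A. \<psi> x \<in> S}"
    by (simp add: units_of_inv)
next
  fix x y assume "x \<in> {x \<in> carrier A. \<psi> x \<in> S}" "y \<in> {x \<in> carrier A. \<psi> x \<in> S}"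
  then show "x \<otimes>\<^bsub>units_of A\<^esub> y \<in> {x \<in> carrier A. \<psi> x \<in> S}"
    using S by (simp add: units_of_def iso_mult mat_group_def)
qed

text \<open>The index is 2 because the inverse of one fixed elementary matrix moves every element of
  \<open>\<Gamma> m\<close> outside V into V (\<open>Gamma_minus_V_coset\<close>); this is where
  evenness of m enters.\<close>

lemma congruence_subgroups:
  assumes R: "R \<subseteq> carrier A" "\<psi> ` R = M2Z" and m: "even m" "0 < m"
  shows "congruence_relations A R \<psi> m"
proof -
  define U where "U = units_of A"
  define V where "V = {x \<in> carrier A. \<psi> x \<in> V_mats m}"
  define \<Gamma> where "\<Gamma> = (\<lambda>m. {x \<in> carrier A. \<psi> x \<in> Gamma_mats m})"
  interpret U: group U unfolding U_def by (rule units_group)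
  have sG: "subgroup (\<Gamma> k) U" for k unfolding \<Gamma>_def U_def
    by (rule mat_group_subgroup[OF mat_group_Gamma])
  have sV: "subgroup V U" unfolding V_def U_def by (rule mat_group_subgroup[OF mat_group_V])
  have V_G: "V \<subseteq> \<Gamma> m" unfolding V_def \<Gamma>_def using V_mats_subset_Gamma by blast
  have G_V: "\<Gamma> (2 * m) \<subseteq> V" unfolding V_def \<Gamma>_def using Gamma_double_subset_V by blast
  have sVG: "subgroup V (U\<lparr>carrier := \<Gamma> m\<rparr>)" by (rule U.subgroup_incl[OF sV sG V_G])
  obtain a where a: "a \<in> carrier A" "\<psi> a = mat2 1 (of_nat m) 0 1"
    by (rule iso_surj[of "mat2 1 (of_nat m) 0 1"]) simp_all
  obtain b where b: "b \<in> carrier A" "\<psi> b = mat2 1 (- of_nat m) 0 1"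
    by (rule iso_surj[of "mat2 1 (- of_nat m) 0 1"]) simp_all
  have "card (rcosets\<^bsub>U\<lparr>carrier := \<Gamma> m\<rparr>\<^esub> V) = 2"
  proof (rule group_card_rcosets_two[where a = a])
    show "group (U\<lparr>carrier := \<Gamma> m\<rparr>)" by (rule U.subgroup_imp_group[OF sG])
    show "subgroup V (U\<lparr>carrier := \<Gamma> m\<rparr>)" by fact
    have aG: "a \<in> \<Gamma> m" using a elementary_in_Gamma by (simp add: \<Gamma>_def)
    show "a \<in> carrier (U\<lparr>carrier := \<Gamma> m\<rparr>)" using aG by simp
    show "a \<notin> V" using a elementary_notin_V[OF m(2)] by (simp add: V_def)
    have ab: "a \<otimes> b = \<one>" "b \<otimes> a = \<one>"
      by (rule iso_inj; use a b in \<open>simp add: iso_mult iso_one one_mat2\<close>)+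
    have inva: "inv\<^bsub>U\<lparr>carrier := \<Gamma> m\<rparr>\<^esub> a = b"
    proof -
      have "inv\<^bsub>U\<lparr>carrier := \<Gamma> m\<rparr>\<^esub> a = inv\<^bsub>U\<^esub> a" by (rule U.m_inv_consistent[OF sG aG])
      also have "\<dots> = inv a" using aG subgroup.subset[OF sG, of m] unfolding U_def
        by (intro units_of_inv) (auto simp: units_of_def)
      also have "\<dots> = b" by (rule inv_char) (use a b ab in auto)
      finally show ?thesis .
    qed
    fix x assume x: "x \<in> carrier (U\<lparr>carrier := \<Gamma> m\<rparr>)" "x \<notin> V"
    then have "x \<in> carrier A" "\<psi> x \<in> Gamma_mats m" "\<psi> x \<notin> V_mats m" by (auto simp: \<Gamma>_def V_def)
    then have "x \<otimes> b \<in> V" using Gamma_minus_V_coset[OF m] b by (simp add: V_def iso_mult)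
    then show "x \<otimes>\<^bsub>U\<lparr>carrier := \<Gamma> m\<rparr>\<^esub> inv\<^bsub>U\<lparr>carrier := \<Gamma> m\<rparr>\<^esub> a \<in> V"
      unfolding inva by (simp add: U_def units_of_def)
  qed
  then have "subgroup (\<Gamma> m) U \<and> subgroup V (U\<lparr>carrier := \<Gamma> m\<rparr>) \<and>
       subgroup (\<Gamma> (2 * m)) (U\<lparr>carrier := V\<rparr>) \<and> card (rcosets\<^bsub>U\<lparr>carrier := \<Gamma> m\<rparr>\<^esub> V) = 2"
    using sG sVG U.subgroup_incl[OF sG sV G_V] by blast
  then show ?thesis
    unfolding congruence_relations_def Let_def U_def V_def \<Gamma>_def principal_congruence_eq[OF R] .
qed

end


section \<open>The representation of the quotient group\<close>

definition frob :: "rat mat \<Rightarrow> rat mat \<Rightarrow> rat" where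
  "frob X M = X $$ (0, 0) * M $$ (0, 0) + X $$ (0, Suc 0) * M $$ (0, Suc 0)
    + X $$ (Suc 0, 0) * M $$ (Suc 0, 0) + X $$ (Suc 0, Suc 0) * M $$ (Suc 0, Suc 0)"

lemma frob_mat2 [simp]: "frob (mat2 a b c d) (mat2 a' b' c' d') = a * a' + b * b' + c * c' + d * d'"
  by (simp add: frob_def)

text \<open>Kept apart from \<open>dihedral_type\<close>: these facts hold in the quotient for every
  triple, and they are used to treat the case that z is a power of a before that case can be
  excluded.\<close>

locale central_commutator = group K for K (structure) +
  fixes a b
  assumes finite_carrier: "finite (carrier K)"
    and a_closed [simp]: "a \<in> carrier K" and b_closed [simp]: "b \<in> carrier K"
    and generated: "carrier K \<subseteq> generate K {a, b}"
    and b_square: "b \<otimes> b = \<one>"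
    and commutator_central: "gp_commutator K a b \<in> centre K"
begin

definition z where "z = gp_commutator K a b"

lemma z_closed [simp]: "z \<in> carrier K"
  by (simp add: z_def gp_commutator_def)

lemma z_commute: "x \<in> carrier K \<Longrightarrow> z \<otimes> x = x \<otimes> z"
  using commutator_central by (simp add: z_def centre_def)

lemma ab: "a \<otimes> b = b \<otimes> a \<otimes> z"
proof -
  have "b \<otimes> a \<otimes> z = b \<otimes> (a \<otimes> (inv a \<otimes> (inv b \<otimes> (a \<otimes> b))))"
    by (simp add: z_def gp_commutator_def m_assoc)
  also have "\<dots> = a \<otimes> b" by (simp add: inv_solve_left' m_assoc[symmetric])
  finally show ?thesis ..
qed

text \<open>Moving a past b \<otimes> b, which is trivial, produces the factor z twice.\<close>

lemma z_square: "z \<otimes> z = \<one>"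
proof -
  have "a \<otimes> (b \<otimes> b) = b \<otimes> a \<otimes> z \<otimes> b" by (simp add: ab m_assoc[symmetric])
  also have "\<dots> = b \<otimes> (a \<otimes> b) \<otimes> z" by (simp add: z_commute m_assoc)
  also have "\<dots> = (b \<otimes> b) \<otimes> a \<otimes> (z \<otimes> z)" by (simp add: ab m_assoc)
  finally have "a = a \<otimes> (z \<otimes> z)" by (simp add: b_square)
  then show ?thesis by simp
qed

lemma z_pow: "z [^] (l :: nat) = (if even l then \<one> else z)"
  by (induction l) (auto simp: z_square nat_pow_Suc)

lemma b_pow: "b [^] (j :: nat) = (if even j then \<one> else b)"
  by (induction j) (auto simp: b_square nat_pow_Suc)

lemma z_pow_commute: "x \<in> carrier K \<Longrightarrow> z [^] (l :: nat) \<otimes> x = x \<otimes> z [^] l"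
  by (simp add: z_pow z_commute)

lemma a_pow_b: "a [^] (i :: nat) \<otimes> b = b \<otimes> a [^] i \<otimes> z [^] i"
proof (induction i)
  case (Suc i)
  have "a [^] Suc i \<otimes> b = a [^] i \<otimes> (a \<otimes> b)" by (simp add: nat_pow_Suc m_assoc)
  also have "\<dots> = (a [^] i \<otimes> b) \<otimes> a \<otimes> z" by (simp add: ab m_assoc)
  also have "\<dots> = b \<otimes> a [^] i \<otimes> (z [^] i \<otimes> a) \<otimes> z" by (simp add: Suc m_assoc)
  also have "\<dots> = b \<otimes> a [^] Suc i \<otimes> z [^] Suc i" by (simp add: z_pow_commute nat_pow_Suc m_assoc)
  finally show ?case .
qed simp

end

locale dihedral_type = central_commutator +
  assumes commutator_not_power: "\<And>i :: nat. gp_commutator K a b \<noteq> a [^] i"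
begin

text \<open>The exponents are not reduced, so that multiplication in \<open>nf_mult\<close> needs no
  case distinction; the ambiguity is measured by \<open>nf_eqD\<close>.\<close>

definition nf :: "nat \<Rightarrow> nat \<Rightarrow> nat \<Rightarrow> 'a" where
  "nf j i l = b [^] j \<otimes> a [^] i \<otimes> z [^] l"

lemma nf_closed [simp]: "nf j i l \<in> carrier K"
  by (simp add: nf_def)

lemma a_pow_b_pow: "a [^] i \<otimes> b [^] j = b [^] j \<otimes> a [^] i \<otimes> z [^] (i * j)" for i j :: nat
proof (cases "even j")
  case True
  then show ?thesis by (simp add: b_pow z_pow)
next
  case False
  then have "z [^] (i * j) = z [^] i" by (simp add: z_pow)
  then show ?thesis using False a_pow_b[of i] by (simp add: b_pow)
qed

text \<open>Each of the i factors a yields one z for each of the j' factors b that it passes, whence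
  the bilinear term.\<close>

lemma nf_mult: "nf j i l \<otimes> nf j' i' l' = nf (j + j') (i + i') (l + l' + i * j')"
proof -
  have "nf j i l \<otimes> nf j' i' l' = b [^] j \<otimes> a [^] i \<otimes> (z [^] l \<otimes> (b [^] j' \<otimes> a [^] i' \<otimes> z [^] l'))"
    by (simp add: nf_def m_assoc)
  also have "\<dots> = b [^] j \<otimes> (a [^] i \<otimes> b [^] j') \<otimes> a [^] i' \<otimes> z [^] l' \<otimes> z [^] l"
    by (subst z_pow_commute) (simp_all add: m_assoc)
  also have "\<dots> = b [^] j \<otimes> b [^] j' \<otimes> a [^] i \<otimes> (z [^] (i * j') \<otimes> a [^] i') \<otimes> z [^] l' \<otimes> z [^] l"
    by (simp add: a_pow_b_pow m_assoc)
  also have "\<dots> = (b [^] j \<otimes> b [^] j') \<otimes> (a [^] i \<otimes> a [^] i') \<otimes> (z [^] (i * j') \<otimes> (z [^] l' \<otimes> z [^] l))"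
    by (simp add: z_pow_commute[of "a [^] i'" "i * j'"] m_assoc)
  also have "\<dots> = b [^] (j + j') \<otimes> a [^] (i + i') \<otimes> z [^] (l + l' + i * j')"
    by (simp add: nat_pow_mult ac_simps)
  finally show ?thesis by (simp add: nf_def)
qed

lemma nf_exhaust:
  assumes "x \<in> carrier K"
  obtains j i l where "x = nf j i l"
proof -
  have "x \<in> generate K {a, b}" using assms generated by blast
  then have "\<exists>j i l. x = nf j i l"
  proof (induction rule: generate.induct)
    case one
    show ?case by (intro exI[of _ 0]) (simp add: nf_def)
  next
    case (incl x)
    have "a = nf 0 1 0" "b = nf 1 0 0" by (simp_all add: nf_def)
    with incl show ?case by blast
  next
    case (inv x)
    \<comment> \<open>Exponents are natural numbers, so the inverse is written as a positive power,
      using finite order.\<close>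
    have "inv a = nf 0 (ord a - 1) 0"
    proof -
      have "ord a \<ge> 1" using ord_ge_1[OF finite_carrier a_closed] .
      then have "a [^] (ord a - 1) \<otimes> a = \<one>"
        by (metis Suc_diff_1 less_eq_Suc_le One_nat_def a_closed nat_pow_Suc pow_ord_eq_1)
      then have "inv a = a [^] (ord a - 1)" by (intro inv_equality) auto
      then show ?thesis by (simp add: nf_def)
    qed
    moreover have "inv b = nf 1 0 0" using inv_equality[OF b_square] by (simp add: nf_def)
    ultimately show ?case using inv by blast
  next
    case (eng x y)
    then show ?case using nf_mult by metis
  qed
  then show ?thesis using that by blast
qed

lemma z_neq_one: "z \<noteq> \<one>"
  using commutator_not_power[of 0] by (simp add: z_def)

text \<open>The trivial element a^(ord a) commutes with b, so z^(ord a) = 1 although z \<noteq> 1.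
  Evenness of m comes from here.\<close>

lemma ord_even: "even (ord a)"
proof (rule ccontr)
  assume odd: "odd (ord a)"
  have "b \<otimes> a [^] ord a \<otimes> z [^] ord a = a [^] ord a \<otimes> b" by (rule a_pow_b[symmetric])
  then have "b \<otimes> z = b" using odd by (simp add: z_pow)
  then show False using z_neq_one by simp
qed

lemma a_pow_eqD:
  fixes i i' :: nat
  assumes "a [^] i = a [^] i'"
  shows "[i = i'] (mod ord a)"
proof -
  have "a [^] int i = a [^] int i'" using assms by (simp add: int_pow_int)
  then show ?thesis by (simp add: int_pow_eq cong_iff_dvd_diff dvd_diff_commute flip: cong_int_iff)
qed

text \<open>An element b w, with w a product of powers of a and z, does not commute with a, so the
  parity of j is determined; and z is not a quotient of powers of a, so that of l is.\<close>

lemma nf_eqD: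
  assumes eq: "nf j i l = nf j' i' l'"
  shows "even j \<longleftrightarrow> even j'" "[i = i'] (mod ord a)" "even l \<longleftrightarrow> even l'"
proof -
  have no_b: "b \<otimes> (a [^] p \<otimes> z [^] q) \<noteq> a [^] p' \<otimes> z [^] q'" for p q p' q' :: nat
  proof
    let ?w = "a [^] p \<otimes> z [^] q"
    assume h: "b \<otimes> ?w = a [^] p' \<otimes> z [^] q'"
    have comm: "a \<otimes> (a [^] r \<otimes> z [^] s) = (a [^] r \<otimes> z [^] s) \<otimes> a" for r s :: nat
      by (simp add: m_assoc z_pow_commute) (simp add: m_assoc[symmetric] nat_pow_Suc2[symmetric])
    have "a \<otimes> (b \<otimes> ?w) = (b \<otimes> ?w) \<otimes> a" unfolding h by (rule comm)
    also have "\<dots> = b \<otimes> (a \<otimes> ?w)"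
      by (simp only: comm[symmetric] m_assoc b_closed a_closed m_closed nat_pow_closed z_closed)
    finally have "(a \<otimes> b) \<otimes> ?w = (b \<otimes> a) \<otimes> ?w" by (simp add: m_assoc)
    then have "a \<otimes> b = b \<otimes> a" by (simp add: right_cancel)
    then have "b \<otimes> a \<otimes> z = b \<otimes> a" by (simp add: ab)
    then show False using z_neq_one by simp
  qed
  have no_z: "a [^] p \<otimes> z \<noteq> a [^] p'" for p p' :: nat
  proof
    assume h: "a [^] p \<otimes> z = a [^] p'"
    have "ord a \<ge> 1" using ord_ge_1[OF finite_carrier a_closed] .
    \<comment> \<open>The exponent (ord a - 1) p inverts a^p without negative powers, so that z
      itself becomes a power of a with natural exponent.\<close>
    then have s: "(ord a - 1) * p + p = p * ord a" by (cases "ord a") (simp_all add: algebra_simps)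
    have "a [^] ((ord a - 1) * p + p') = a [^] ((ord a - 1) * p) \<otimes> (a [^] p \<otimes> z)"
      by (simp add: h nat_pow_mult)
    also have "\<dots> = a [^] (p * ord a) \<otimes> z"      
      by (simp only: m_assoc[symmetric] nat_pow_mult s a_closed nat_pow_closed z_closed)
    also have "a [^] (p * ord a) = \<one>" by (simp add: pow_eq_id)
    finally show False
      using commutator_not_power[of "(ord a - 1) * p + p'"] unfolding z_def[symmetric] by simp
  qed
  show j: "even j \<longleftrightarrow> even j'"
    using eq no_b[of i l i' l'] no_b[of i' l' i l]
    by (auto simp: nf_def b_pow m_assoc split: if_splits)
  then have "b [^] j = b [^] j'" by (simp add: b_pow)
  then have az: "a [^] i \<otimes> z [^] l = a [^] i' \<otimes> z [^] l'"
    using eq by (simp add: nf_def m_assoc)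
  then show l: "even l \<longleftrightarrow> even l'"
    using no_z[of i i'] no_z[of i' i] by (auto simp: z_pow split: if_splits)
  then have "z [^] l = z [^] l'" by (simp add: z_pow)
  with az have "a [^] i = a [^] i'" by simp
  then show "[i = i'] (mod ord a)" by (rule a_pow_eqD)
qed

section \<open>The two-dimensional representation and its orthogonality relations\<close>

definition rep_nf :: "nat \<Rightarrow> nat \<Rightarrow> nat \<Rightarrow> rat mat" where
  "rep_nf j i l = (-1) ^ l \<cdot>\<^sub>m (if even j then mat2 1 0 0 ((-1) ^ i) else mat2 0 ((-1) ^ i) 1 0)"

definition rep :: "'a \<Rightarrow> rat mat" where
  "rep x = (SOME M. \<exists>j i l. x = nf j i l \<and> M = rep_nf j i l)"

text \<open>The choice in \<open>rep\<close> is harmless: \<open>rep_nf\<close> depends only on the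
  parities of its arguments, and as \<open>ord a\<close> is even, i modulo \<open>ord a\<close>
  determines the parity of i.\<close>

lemma rep_eq: "rep (nf j i l) = rep_nf j i l"
proof -
  have "M = rep_nf j i l" if "nf j i l = nf j' i' l'" "M = rep_nf j' i' l'" for M j' i' l'
  proof -
    note d = nf_eqD[OF that(1)]
    have "even i \<longleftrightarrow> even i'"
      using cong_dvd_modulus_nat[OF d(2) ord_even] by (simp add: cong_def even_iff_mod_2_eq_zero)
    then show ?thesis using d that(2) by (simp add: rep_nf_def minus_one_power_iff)
  qed
  then show ?thesis unfolding rep_def by (intro some_equality) blast+
qed

lemma rep_nf_mult: "rep_nf j i l * rep_nf j' i' l' = rep_nf (j + j') (i + i') (l + l' + i * j')"
  by (auto simp: rep_nf_def minus_one_power_iff)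

lemma rep_mult: "x \<in> carrier K \<Longrightarrow> y \<in> carrier K \<Longrightarrow> rep (x \<otimes> y) = rep x * rep y"
  by (elim nf_exhaust) (simp add: nf_mult rep_eq rep_nf_mult)

lemma rep_nf_parity: "rep_nf j i l \<in> parity_order"
  by (rule parity_orderI[of "if even j then (-1) ^ l else 0" "if even j then (-1) ^ (l + i) else 0"
      "if even j then 0 else (-1) ^ (l + i)" "if even j then 0 else (-1) ^ l"])
    (auto simp: rep_nf_def power_add)

lemma rep_parity: "x \<in> carrier K \<Longrightarrow> rep x \<in> parity_order"
  by (elim nf_exhaust) (simp add: rep_eq rep_nf_parity)

lemma rep_one: "rep \<one> = 1\<^sub>m 2"
  using rep_eq[of 0 0 0] by (simp add: nf_def rep_nf_def one_mat2)

lemma rep_a: "rep a = mat2 1 0 0 (-1)"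
  using rep_eq[of 0 1 0] by (simp add: nf_def rep_nf_def)

lemma rep_b: "rep b = mat2 0 1 1 0"
  using rep_eq[of 1 0 0] by (simp add: nf_def rep_nf_def)

text \<open>The matrices of \<open>rep\<close> are signed permutation matrices, hence orthogonal; so
  for the Frobenius form, multiplication by \<open>rep (inv y)\<close> is adjoint to multiplication
  by \<open>rep y\<close>.\<close>

lemma frob_rep:
  assumes "y \<in> carrier K" "X \<in> carrier_mat 2 2" "M \<in> carrier_mat 2 2"
  shows "frob (rep (inv y) * X) M = frob X (rep y * M)"
    and "frob (X * rep (inv y)) M = frob X (M * rep y)"
proof -
  obtain j i l where y: "y = nf j i l" using assms(1) by (rule nf_exhaust)
  \<comment> \<open>The transpose of \<open>rep_nf j i l\<close>.\<close>
  let ?R = "(-1) ^ l \<cdot>\<^sub>m (if even j then mat2 1 0 0 ((-1) ^ i) else mat2 0 1 ((-1) ^ i) 0) :: rat mat"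
  have "rep (inv y) * rep y = 1\<^sub>m 2" using assms(1) by (simp add: rep_one flip: rep_mult)
  moreover have "rep y * ?R = 1\<^sub>m 2"
    by (auto simp: y rep_eq rep_nf_def one_mat2 minus_one_power_iff)
  moreover have c: "rep (inv y) \<in> carrier_mat 2 2" "rep y \<in> carrier_mat 2 2" "?R \<in> carrier_mat 2 2"
    using assms(1) rep_parity parity_order_subset_carrier by (auto simp: subset_iff)
  ultimately have "rep (inv y) = ?R"
  proof -
    assume h: "rep (inv y) * rep y = 1\<^sub>m 2" "rep y * ?R = 1\<^sub>m 2"
      and c: "rep (inv y) \<in> carrier_mat 2 2" "rep y \<in> carrier_mat 2 2" "?R \<in> carrier_mat 2 2"
    have "rep (inv y) = rep (inv y) * (rep y * ?R)" unfolding h using c(1) by simp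
    also have "\<dots> = rep (inv y) * rep y * ?R" by (rule assoc_mult_mat[symmetric, OF c])
    also have "\<dots> = ?R" unfolding h using c(3) by (rule left_mult_one_mat)
    finally show ?thesis .
  qed
  moreover have "rep y = rep_nf j i l" by (simp add: y rep_eq)
  moreover obtain x1 x2 x3 x4 where "X = mat2 x1 x2 x3 x4" using assms(2) by (rule mat2_cases)
  moreover obtain m1 m2 m3 m4 where "M = mat2 m1 m2 m3 m4" using assms(3) by (rule mat2_cases)
  ultimately show "frob (rep (inv y) * X) M = frob X (rep y * M)"
    and "frob (X * rep (inv y)) M = frob X (M * rep y)"
    by (simp_all add: rep_nf_def algebra_simps)
qed

lemma nf_bij:
  "bij_betw (\<lambda>(j, i, l). nf j i l) ({..<2} \<times> {..<ord a} \<times> {..<2}) (carrier K)"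
proof (rule bij_betw_imageI)
  show "inj_on (\<lambda>(j, i, l). nf j i l) ({..<2} \<times> {..<ord a} \<times> {..<2})"
  proof (rule inj_onI, clarsimp)
    fix j i l j' i' l' :: nat
    assume b: "j < 2" "i < ord a" "l < 2" "j' < 2" "i' < ord a"
      "l' < 2" and eq: "nf j i l = nf j' i' l'"
    note d = nf_eqD[OF eq]
    have "j = j'" "l = l'" using b d(1,3) by (auto simp: less_2_cases_iff)
    moreover have "i = i'" using d(2) b by (simp add: cong_def)
    ultimately show "j = j' \<and> i = i' \<and> l = l'" by simp
  qed
  have pos: "ord a > 0" using ord_ge_1[OF finite_carrier a_closed] by simp
  have nf_mod: "nf j i l = nf (j mod 2) (i mod ord a) (l mod 2)" for j i l
  proof -
    have "a [^] (i mod ord a) = a [^] i"     proof -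
      have "a [^] (ord a * (i div ord a) + i mod ord a) = (a [^] ord a) [^] (i div ord a) \<otimes> a [^] (i mod ord a)"
        by (simp only: nat_pow_pow nat_pow_mult a_closed)
      then show ?thesis by simp
    qed
    then show ?thesis by (simp add: nf_def b_pow z_pow)
  qed
  then show "(\<lambda>(j, i, l). nf j i l) ` ({..<2} \<times> {..<ord a} \<times> {..<2}) = carrier K"
  proof (intro equalityI subsetI)
    fix x assume "x \<in> carrier K"
    then obtain j i l where "x = nf j i l" by (rule nf_exhaust)
    then have "x = nf (j mod 2) (i mod ord a) (l mod 2)" using nf_mod[of j i l] by simp
    then show "x \<in> (\<lambda>(j, i, l). nf j i l) ` ({..<2} \<times> {..<ord a} \<times> {..<2})"
      using pos by (intro image_eqI[of _ _ "(j mod 2, i mod ord a, l mod 2)"]) auto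
  qed auto
qed

lemma alternating_sum_zero: "even n \<Longrightarrow> (\<Sum>i<n. (-1) ^ i) = (0 :: rat)"
  by (elim evenE, simp only:) (induct_tac b, auto)

text \<open>The four elements with a given exponent i contribute twice the wanted entry of M plus a
  term with sign (-1)^i, which cancels over the even range of i. The factor 2 \<open>ord a\<close>
  is the group order 4 \<open>ord a\<close> divided by the degree 2.\<close>

lemma rep_orthogonality:
  assumes M: "M \<in> carrier_mat 2 2" and pq: "p < 2" "q < 2"
  shows "(\<Sum>x\<in>carrier K. frob (rep x) M * rep x $$ (p, q)) = 2 * of_nat (ord a) * M $$ (p, q)"
proof -
  obtain m1 m2 m3 m4 where Me: "M = mat2 m1 m2 m3 m4" using M by (rule mat2_cases)
  define f where "f = (\<lambda>j i l. frob (rep_nf j i l) M * rep_nf j i l $$ (p, q))"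
  have "(\<Sum>x\<in>carrier K. frob (rep x) M * rep x $$ (p, q)) =
      (\<Sum>(j, i, l)\<in>{..<2} \<times> {..<ord a} \<times> {..<2}. f j i l)"
    by (subst sum.reindex_bij_betw[OF nf_bij, symmetric])
      (auto intro!: sum.cong simp: rep_eq f_def)
  also have "\<dots> = (\<Sum>j<2. \<Sum>i<ord a. \<Sum>l<2. f j i l)"
    by (simp add: sum.cartesian_product)
  also have "\<dots> = (\<Sum>i<ord a. f 0 i 0 + f 0 i 1 + f 1 i 0 + f 1 i 1)"
    by (simp add: numeral_2_eq_2 sum.distrib)
  also have "\<dots> = (\<Sum>i<ord a. 2 * M $$ (p, q) +
      (-1) ^ i * 2 * mat2 m4 m3 m2 m1 $$ (p, q))"
  proof (rule sum.cong[OF refl])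
    fix i
    have "p = 0 \<and> q = 0 \<or> p = 0 \<and> q = 1 \<or> p = 1 \<and> q = 0 \<or> p = 1 \<and> q = 1" using pq by auto
    then show "f 0 i 0 + f 0 i 1 + f 1 i 0 + f 1 i 1 = 2 * M $$ (p, q) +
      (-1) ^ i * 2 * mat2 m4 m3 m2 m1 $$ (p, q)"
      by (elim disjE) (simp_all add: f_def rep_nf_def Me minus_one_power_iff)
  qed
  also have "\<dots> = 2 * of_nat (ord a) * M $$ (p, q)"
    using alternating_sum_zero[OF ord_even]
    by (simp add: sum.distrib flip: sum_distrib_right)
  finally show ?thesis .
qed

end


section \<open>The group algebra and its simple component\<close>

text \<open>As simp rules these make sums and scalar multiples pointwise while products stay folded;
  arguments at the level of ring axioms therefore delete them.\<close>

lemma grp_alg_simps [simp]: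
  "carrier (grp_alg K) = {a. \<forall>x. x \<notin> carrier K \<longrightarrow> a x = 0}"
  "one (grp_alg K) = ga_basis \<one>\<^bsub>K\<^esub>"
  "zero (grp_alg K) = (\<lambda>x. 0)"
  "add (grp_alg K) = (\<lambda>a b x. a x + b x)"
  "module.smult (grp_alg K) = (\<lambda>c a x. c * a x)"
  by (simp_all add: grp_alg_def)

section \<open>Convolution in the group algebra\<close>

locale finite_group = group K for K (structure) +
  assumes finite_carrier: "finite (carrier K)"
begin

abbreviation "A \<equiv> grp_alg K"

lemma sum_translate:
  assumes "y \<in> carrier K"
  shows "(\<Sum>w\<in>carrier K. f (y \<otimes> w)) = (\<Sum>w\<in>carrier K. f w)"
  by (rule sum.reindex_bij_witness[of _ "\<lambda>w. inv y \<otimes> w" "\<lambda>w. y \<otimes> w"])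
    (use assms in \<open>simp_all add: m_assoc[symmetric]\<close>)

lemma ga_mult:
  assumes "x \<in> carrier K"
  shows "(u \<otimes>\<^bsub>A\<^esub> v) x = (\<Sum>y\<in>carrier K. u y * v (inv y \<otimes> x))"
proof -
  have "(\<Sum>(y, z)\<in>{(y, z). y \<in> carrier K \<and> z \<in> carrier K \<and> y \<otimes> z = x}. u y * v z) =
      (\<Sum>y\<in>carrier K. u y * v (inv y \<otimes> x))"
    by (rule sum.reindex_bij_witness[of _ "\<lambda>y. (y, inv y \<otimes> x)" fst])
      (use assms in \<open>auto simp: m_assoc[symmetric]\<close>)
  then show ?thesis by (simp add: grp_alg_def)
qed

lemma ga_mult_right:
  assumes "x \<in> carrier K"
  shows "(u \<otimes>\<^bsub>A\<^esub> v) x = (\<Sum>y\<in>carrier K. u (x \<otimes> inv y) * v y)"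
proof -
  have 1: "x \<otimes> (inv x \<otimes> y) = y" if "y \<in> carrier K" for y
    using assms that by (simp add: m_assoc[symmetric])
  have 2: "y \<otimes> inv x \<otimes> x = y" if "y \<in> carrier K" for y
    using assms that by (simp add: m_assoc)
  show ?thesis
    unfolding ga_mult[OF assms]
    by (rule sum.reindex_bij_witness[of _ "\<lambda>y. x \<otimes> inv y" "\<lambda>y. inv y \<otimes> x"])
      (use assms in \<open>auto simp: inv_mult_group 1 2\<close>)
qed

lemma ga_mult_outside: "x \<notin> carrier K \<Longrightarrow> (u \<otimes>\<^bsub>A\<^esub> v) x = 0"
  by (auto simp: grp_alg_def intro!: sum.neutral)

lemma ga_basis_closed: "x \<in> carrier K \<Longrightarrow> ga_basis x \<in> carrier A"
  by (auto simp: ga_basis_def)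

text \<open>Holds for arbitrary functions, since the product ignores values outside the carrier and
  vanishes there; like the distributive laws below, it rewrites without side conditions.\<close>

lemma ga_assoc: "(u \<otimes>\<^bsub>A\<^esub> v) \<otimes>\<^bsub>A\<^esub> w = u \<otimes>\<^bsub>A\<^esub> (v \<otimes>\<^bsub>A\<^esub> w)"
proof
  fix x
  show "((u \<otimes>\<^bsub>A\<^esub> v) \<otimes>\<^bsub>A\<^esub> w) x = (u \<otimes>\<^bsub>A\<^esub> (v \<otimes>\<^bsub>A\<^esub> w)) x"
  proof (cases "x \<in> carrier K")
    case True
    have "((u \<otimes>\<^bsub>A\<^esub> v) \<otimes>\<^bsub>A\<^esub> w) x =
        (\<Sum>t\<in>carrier K. \<Sum>y\<in>carrier K. u y * v (inv y \<otimes> t) * w (inv t \<otimes> x))"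
      using True by (simp add: ga_mult sum_distrib_right)
    also have "\<dots> = (\<Sum>y\<in>carrier K. \<Sum>t\<in>carrier K. u y * v (inv y \<otimes> t) * w (inv t \<otimes> x))"
      by (rule sum.swap)
    also have "\<dots> = (\<Sum>y\<in>carrier K. \<Sum>t\<in>carrier K. u y * v t * w (inv t \<otimes> (inv y \<otimes> x)))"
    proof (rule sum.cong[OF refl])
      fix y assume y: "y \<in> carrier K"
      show "(\<Sum>t\<in>carrier K. u y * v (inv y \<otimes> t) * w (inv t \<otimes> x)) =
        (\<Sum>t\<in>carrier K. u y * v t * w (inv t \<otimes> (inv y \<otimes> x)))"
        by (subst sum_translate[OF y, symmetric])
          (use True y in \<open>auto intro!: sum.cong simp: m_assoc[symmetric] inv_mult_group\<close>)
    qed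
    also have "\<dots> = (u \<otimes>\<^bsub>A\<^esub> (v \<otimes>\<^bsub>A\<^esub> w)) x"
      using True by (simp add: ga_mult sum_distrib_left mult.assoc)
    finally show ?thesis .
  qed (simp add: ga_mult_outside)
qed

lemma ga_l_distr: "(\<lambda>x. u x + v x) \<otimes>\<^bsub>A\<^esub> w = (\<lambda>x. (u \<otimes>\<^bsub>A\<^esub> w) x + (v \<otimes>\<^bsub>A\<^esub> w) x)"
proof
  fix x
  show "((\<lambda>x. u x + v x) \<otimes>\<^bsub>A\<^esub> w) x = (u \<otimes>\<^bsub>A\<^esub> w) x + (v \<otimes>\<^bsub>A\<^esub> w) x"
    by (cases "x \<in> carrier K") (simp_all add: ga_mult ga_mult_outside distrib_right sum.distrib)
qed

lemma ga_r_distr: "w \<otimes>\<^bsub>A\<^esub> (\<lambda>x. u x + v x) = (\<lambda>x. (w \<otimes>\<^bsub>A\<^esub> u) x + (w \<otimes>\<^bsub>A\<^esub> v) x)"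
proof
  fix x
  show "(w \<otimes>\<^bsub>A\<^esub> (\<lambda>x. u x + v x)) x = (w \<otimes>\<^bsub>A\<^esub> u) x + (w \<otimes>\<^bsub>A\<^esub> v) x"
    by (cases "x \<in> carrier K") (simp_all add: ga_mult ga_mult_outside distrib_left sum.distrib)
qed

lemma ga_smult_l: "(\<lambda>x. c * u x) \<otimes>\<^bsub>A\<^esub> w = (\<lambda>x. c * (u \<otimes>\<^bsub>A\<^esub> w) x)"
proof
  fix x
  show "((\<lambda>x. c * u x) \<otimes>\<^bsub>A\<^esub> w) x = c * (u \<otimes>\<^bsub>A\<^esub> w) x"
    by (cases "x \<in> carrier K") (simp_all add: ga_mult ga_mult_outside sum_distrib_left mult.assoc)
qed

lemma ga_smult_r: "w \<otimes>\<^bsub>A\<^esub> (\<lambda>x. c * u x) = (\<lambda>x. c * (w \<otimes>\<^bsub>A\<^esub> u) x)"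
proof
  fix x
  show "(w \<otimes>\<^bsub>A\<^esub> (\<lambda>x. c * u x)) x = c * (w \<otimes>\<^bsub>A\<^esub> u) x"
    by (cases "x \<in> carrier K") (simp_all add: ga_mult ga_mult_outside sum_distrib_left mult_ac)
qed

lemma ga_zero_l: "(\<lambda>x. 0) \<otimes>\<^bsub>A\<^esub> w = (\<lambda>x. 0)"
  using ga_smult_l[of 0 w w] by simp

lemma grp_alg_ring: "ring A"
proof (rule ringI)
  show "abelian_group A"
  proof (rule abelian_groupI)
    fix u assume "u \<in> carrier A"
    then show "\<exists>v\<in>carrier A. v \<oplus>\<^bsub>A\<^esub> u = \<zero>\<^bsub>A\<^esub>"
      by (intro bexI[of _ "\<lambda>x. - u x"]) auto
  qed auto
  show "Group.monoid A"
  proof (rule monoidI)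
    fix u assume u: "u \<in> carrier A"
    show "\<one>\<^bsub>A\<^esub> \<otimes>\<^bsub>A\<^esub> u = u"
    proof
      fix x
      show "(\<one>\<^bsub>A\<^esub> \<otimes>\<^bsub>A\<^esub> u) x = u x"
        using u finite_carrier
        by (cases "x \<in> carrier K")
          (auto simp: ga_mult ga_mult_outside ga_basis_def if_distrib[of "\<lambda>c. c * _"] cong: if_cong)
    qed
    show "u \<otimes>\<^bsub>A\<^esub> \<one>\<^bsub>A\<^esub> = u"
    proof
      fix x
      show "(u \<otimes>\<^bsub>A\<^esub> \<one>\<^bsub>A\<^esub>) x = u x"
        using u finite_carrier
        by (cases "x \<in> carrier K")
          (auto simp: ga_mult_right ga_mult_outside ga_basis_def if_distrib[of "\<lambda>c. _ * c"] cong: if_cong)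
    qed
  qed (auto simp: ga_assoc ga_mult_outside ga_basis_def)
qed (simp_all add: ga_l_distr ga_r_distr)

sublocale A: ring A by (rule grp_alg_ring)

lemma ga_uminus: "u \<in> carrier A \<Longrightarrow> \<ominus>\<^bsub>A\<^esub> u = (\<lambda>x. - u x)"
  by (rule A.minus_equality) auto

lemma ga_minus: "v \<in> carrier A \<Longrightarrow> u \<ominus>\<^bsub>A\<^esub> v = (\<lambda>x. u x - v x)"
  by (simp add: a_minus_def ga_uminus)

lemma one_minus_orthogonal:
  assumes u: "u \<in> carrier A" and v: "v \<in> carrier A" and uv: "u \<otimes>\<^bsub>A\<^esub> v = \<zero>\<^bsub>A\<^esub>"
  shows "(\<one>\<^bsub>A\<^esub> \<ominus>\<^bsub>A\<^esub> u) \<otimes>\<^bsub>A\<^esub> v = v"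
  unfolding a_minus_def A.l_distr[OF A.one_closed A.a_inv_closed[OF u] v] A.l_minus[OF u v]
    uv A.l_one[OF v] A.minus_zero
  by (rule A.r_zero[OF v])

section \<open>Central idempotents and their components\<close>

lemma central_idempotentD:
  assumes "central_idempotent A f"
  shows "f \<in> carrier A" "f \<otimes>\<^bsub>A\<^esub> f = f" "x \<in> carrier A \<Longrightarrow> f \<otimes>\<^bsub>A\<^esub> x = x \<otimes>\<^bsub>A\<^esub> f"
  using assms by (simp_all add: central_idempotent_def centre_def del: grp_alg_simps)

text \<open>Once the component is rewritten as the set of all x with x f = x, closure under the
  operations is immediate.\<close>

lemma central_idempotent_component_ring:
  assumes "central_idempotent A f"
  shows "rational_algebra (component A f)"
proof -
  note f = central_idempotentD(1,2)[OF assms] and comm = central_idempotentD(3)[OF assms]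
  have car: "carrier (component A f) = {x \<in> carrier A. x \<otimes>\<^bsub>A\<^esub> f = x}"
  proof -
    have "x \<otimes>\<^bsub>A\<^esub> f \<otimes>\<^bsub>A\<^esub> f = x \<otimes>\<^bsub>A\<^esub> f" for x by (simp only: ga_assoc f(2))
    then show ?thesis unfolding component_def using A.m_closed[OF _ f(1)]
      by (force simp del: grp_alg_simps)
  qed
  have ops: "monoid.mult (component A f) = monoid.mult A" "one (component A f) = f"
    "zero (component A f) = zero A"
    "add (component A f) = add A" "module.smult (component A f) = module.smult A"
    by (simp_all add: component_def del: grp_alg_simps)

  have ring: "ring (component A f)"
  proof (rule ringI)
    show "abelian_group (component A f)"
    proof (rule abelian_groupI, unfold car ops)
      fix x assume x: "x \<in> {x \<in> carrier A. x \<otimes>\<^bsub>A\<^esub> f = x}"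
      then show "\<exists>y\<in>{x \<in> carrier A. x \<otimes>\<^bsub>A\<^esub> f = x}. y \<oplus>\<^bsub>A\<^esub> x = \<zero>\<^bsub>A\<^esub>"
        using ga_smult_l[of "- 1" x f] by (intro bexI[of _ "\<lambda>k. - x k"]) simp_all
    qed (auto simp: ga_l_distr ga_zero_l add_ac)
    show "Group.monoid (component A f)"
    proof (rule monoidI, unfold car ops)
      fix x y assume x: "x \<in> {x \<in> carrier A. x \<otimes>\<^bsub>A\<^esub> f = x}" and y: "y \<in> {x \<in> carrier A. x \<otimes>\<^bsub>A\<^esub> f = x}"
      have "x \<otimes>\<^bsub>A\<^esub> y \<in> carrier A" using x y by (intro A.m_closed) blast+
      moreover have "x \<otimes>\<^bsub>A\<^esub> y \<otimes>\<^bsub>A\<^esub> f = x \<otimes>\<^bsub>A\<^esub> y" using y by (simp only: ga_assoc mem_Collect_eq)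
      ultimately show "x \<otimes>\<^bsub>A\<^esub> y \<in> {x \<in> carrier A. x \<otimes>\<^bsub>A\<^esub> f = x}" by blast
    next
      fix x assume x: "x \<in> {x \<in> carrier A. x \<otimes>\<^bsub>A\<^esub> f = x}"
      then show "x \<otimes>\<^bsub>A\<^esub> f = x" by blast
      then show "f \<otimes>\<^bsub>A\<^esub> x = x" using x comm by simp
    qed (use f in \<open>simp_all only: ga_assoc mem_Collect_eq simp_thms\<close>)
  qed (unfold car ops, simp_all add: ga_l_distr ga_r_distr)
  show ?thesis
  proof (intro rational_algebra.intro rational_algebra_axioms.intro ring, unfold car ops)
    fix x c assume "x \<in> {x \<in> carrier A. x \<otimes>\<^bsub>A\<^esub> f = x}"
    then show "c \<odot>\<^bsub>A\<^esub> x \<in> {x \<in> carrier A. x \<otimes>\<^bsub>A\<^esub> f = x}"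
      by (simp add: ga_smult_l)
  qed (simp_all add: fun_eq_iff algebra_simps)
qed

text \<open>e = ef + (e - ef) is a sum of orthogonal central idempotents, so a nonzero ef equals e;
  by symmetry it also equals f.\<close>

lemma primitive_orthogonal:
  assumes e: "primitive_central_idempotent A e" and f: "primitive_central_idempotent A f" and "e \<noteq> f"
  shows "e \<otimes>\<^bsub>A\<^esub> f = \<zero>\<^bsub>A\<^esub>"
proof (rule ccontr)
  assume nz: "e \<otimes>\<^bsub>A\<^esub> f \<noteq> \<zero>\<^bsub>A\<^esub>"
  have eq: "e \<otimes>\<^bsub>A\<^esub> f = e"
    if "primitive_central_idempotent A e" "primitive_central_idempotent A f" "e \<otimes>\<^bsub>A\<^esub> f \<noteq> \<zero>\<^bsub>A\<^esub>"
      for e f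
  proof -
    have "central_idempotent A e" "central_idempotent A f"
      using that unfolding primitive_central_idempotent_def by blast+
    note ec = this(1)[THEN central_idempotentD(1)] this(1)[THEN central_idempotentD(2)] this(1)[THEN central_idempotentD(3)]
      and fc = this(2)[THEN central_idempotentD(1)] this(2)[THEN central_idempotentD(2)] this(2)[THEN central_idempotentD(3)]
    let ?p = "e \<otimes>\<^bsub>A\<^esub> f" and ?q = "e \<ominus>\<^bsub>A\<^esub> e \<otimes>\<^bsub>A\<^esub> f"
    have pc: "?p \<in> carrier A" "?q \<in> carrier A"
      using A.m_closed[OF ec(1) fc(1)] A.minus_closed[OF ec(1)] by blast+
    have ep: "e \<otimes>\<^bsub>A\<^esub> ?p = ?p" by (simp only: ga_assoc[symmetric] ec(2))
    have pe: "?p \<otimes>\<^bsub>A\<^esub> e = ?p" using ec(3)[OF pc(1)] ep by simp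
    have pp: "?p \<otimes>\<^bsub>A\<^esub> ?p = ?p"
      by (metis ga_assoc pe fc(2))
    have pcomm: "?p \<otimes>\<^bsub>A\<^esub> x = x \<otimes>\<^bsub>A\<^esub> ?p" if "x \<in> carrier A" for x
      by (metis ga_assoc ec(3) fc(3) that)
    have pq: "?p \<otimes>\<^bsub>A\<^esub> ?q = \<zero>\<^bsub>A\<^esub>"
    proof -
      have "?p \<otimes>\<^bsub>A\<^esub> ?q = ?p \<otimes>\<^bsub>A\<^esub> e \<oplus>\<^bsub>A\<^esub> ?p \<otimes>\<^bsub>A\<^esub> (\<ominus>\<^bsub>A\<^esub> ?p)"
        unfolding a_minus_def by (rule A.r_distr[OF ec(1) A.a_inv_closed[OF pc(1)] pc(1)])
      also have "\<dots> = ?p \<oplus>\<^bsub>A\<^esub> \<ominus>\<^bsub>A\<^esub> ?p" unfolding A.r_minus[OF pc(1) pc(1)] pe pp ..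
      also have "\<dots> = \<zero>\<^bsub>A\<^esub>" by (rule A.r_neg[OF pc(1)])
      finally show ?thesis .
    qed
    have qq: "?q \<otimes>\<^bsub>A\<^esub> ?q = ?q"
    proof -
      have "?q \<otimes>\<^bsub>A\<^esub> ?q = e \<otimes>\<^bsub>A\<^esub> ?q \<ominus>\<^bsub>A\<^esub> ?p \<otimes>\<^bsub>A\<^esub> ?q"
        using ec(1) pc A.m_closed by (simp add: a_minus_def A.l_distr A.l_minus del: grp_alg_simps)
      also have "\<dots> = e \<otimes>\<^bsub>A\<^esub> ?q \<ominus>\<^bsub>A\<^esub> \<zero>\<^bsub>A\<^esub>" unfolding pq ..
      also have "\<dots> = e \<otimes>\<^bsub>A\<^esub> ?q"
        using A.m_closed[OF ec(1) pc(2)] by (simp only: a_minus_def A.minus_zero A.r_zero)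
      also have "\<dots> = ?q" using ec(1) pc
        by (simp add: a_minus_def A.r_distr A.r_minus ep ec(2) del: grp_alg_simps)
      finally show ?thesis .
    qed
    have qcomm: "?q \<otimes>\<^bsub>A\<^esub> x = x \<otimes>\<^bsub>A\<^esub> ?q" if "x \<in> carrier A" for x
      using ec(1) pc that pcomm[OF that] ec(3)[OF that]
      by (simp add: a_minus_def A.l_distr A.l_minus A.r_distr A.r_minus del: grp_alg_simps)
    have "central_idempotent A ?p" "central_idempotent A ?q"
      unfolding central_idempotent_def centre_def using pc pp qq pcomm qcomm by blast+
    moreover have "e = ?p \<oplus>\<^bsub>A\<^esub> ?q"
      using ec(1) pc(1) by (simp add: a_minus_def A.a_lcomm[of ?p e] A.r_neg del: grp_alg_simps)
    ultimately have "?p = \<zero>\<^bsub>A\<^esub> \<or> ?q = \<zero>\<^bsub>A\<^esub>"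
      using that(1) pq unfolding primitive_central_idempotent_def by blast
    then have "?q = \<zero>\<^bsub>A\<^esub>" using that(3) by blast
    then show ?thesis using \<open>e = ?p \<oplus>\<^bsub>A\<^esub> ?q\<close> pc(1) by (metis A.r_zero)
  qed
  have "e \<otimes>\<^bsub>A\<^esub> f = f \<otimes>\<^bsub>A\<^esub> e"
    using e f central_idempotentD(1,3) unfolding primitive_central_idempotent_def by blast
  then have "e = f" using eq[OF e f nz] eq[OF f e] nz by simp
  then show False using \<open>e \<noteq> f\<close> by contradiction
qed

end

text \<open>\<open>\<rho>\<close> is an absolutely irreducible representation with orthogonal matrices, and \<open>4 m\<close> is the
  order of \<open>K\<close>. The map \<open>\<theta>\<close> is its extension to the group algebra, and by the Schur relations
  \<open>\<tau>\<close> is a section of \<open>\<theta>\<close> onto the corresponding simple component.\<close>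

locale planar_rep = finite_group +
  fixes \<rho> :: "'a \<Rightarrow> rat mat" and m :: nat and a b :: 'a
  assumes m_pos: "0 < m" and m_even: "even m"
    and rho_mult: "\<And>x y. x \<in> carrier K \<Longrightarrow> y \<in> carrier K \<Longrightarrow> \<rho> (x \<otimes> y) = \<rho> x * \<rho> y"
    and rho_one: "\<rho> \<one> = 1\<^sub>m 2"
    and rho_parity: "\<And>x. x \<in> carrier K \<Longrightarrow> \<rho> x \<in> parity_order"
    and rho_frob_left: "\<And>y X M. y \<in> carrier K \<Longrightarrow> X \<in> carrier_mat 2 2 \<Longrightarrow> M \<in> carrier_mat 2 2 \<Longrightarrow>
      frob (\<rho> (inv y) * X) M = frob X (\<rho> y * M)"
    and rho_frob_right: "\<And>y X M. y \<in> carrier K \<Longrightarrow> X \<in> carrier_mat 2 2 \<Longrightarrow> M \<in> carrier_mat 2 2 \<Longrightarrow>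
      frob (X * \<rho> (inv y)) M = frob X (M * \<rho> y)"
    and rho_orthogonality: "\<And>M p q. M \<in> carrier_mat 2 2 \<Longrightarrow> p < 2 \<Longrightarrow> q < 2 \<Longrightarrow>
      (\<Sum>x\<in>carrier K. frob (\<rho> x) M * \<rho> x $$ (p, q)) = 2 * of_nat m * M $$ (p, q)"
    and ab_closed: "a \<in> carrier K" "b \<in> carrier K"
    and rho_a: "\<rho> a = mat2 1 0 0 (-1)" and rho_b: "\<rho> b = mat2 0 1 1 0"
begin

lemma rho_closed: "x \<in> carrier K \<Longrightarrow> \<rho> x \<in> carrier_mat 2 2"
  using rho_parity parity_order_subset_carrier by blast

definition \<theta> :: "('a \<Rightarrow> rat) \<Rightarrow> rat mat" where
  "\<theta> u = mat 2 2 (\<lambda>p. \<Sum>k\<in>carrier K. u k * \<rho> k $$ p)"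

text \<open>Fourier inversion: the coefficient at k is degree over group order, 2/(4m), times the
  trace of \<open>\<rho> (inv k) * M\<close>, written with \<open>frob\<close> because the matrices
  \<open>\<rho> k\<close> are orthogonal.\<close>

definition \<tau> :: "rat mat \<Rightarrow> 'a \<Rightarrow> rat" where
  "\<tau> M = (\<lambda>k. if k \<in> carrier K then frob (\<rho> k) M / (2 * of_nat m) else 0)"

lemma theta_closed [simp]: "\<theta> u \<in> carrier_mat 2 2"
  by (simp add: \<theta>_def)

lemma theta_mat2: "\<theta> u = mat2 (\<Sum>k\<in>carrier K. u k * \<rho> k $$ (0, 0)) (\<Sum>k\<in>carrier K. u k * \<rho> k $$ (0, Suc 0))
    (\<Sum>k\<in>carrier K. u k * \<rho> k $$ (Suc 0, 0)) (\<Sum>k\<in>carrier K. u k * \<rho> k $$ (Suc 0, Suc 0))"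
  by (rule mat2_eqI) (auto simp: \<theta>_def)

lemma theta_add: "\<theta> (u \<oplus>\<^bsub>A\<^esub> v) = \<theta> u + \<theta> v"
  by (simp add: theta_mat2 distrib_right sum.distrib)

lemma theta_basis:
  assumes "k \<in> carrier K"
  shows "\<theta> (ga_basis k) = \<rho> k"
proof -
  have "(\<Sum>l\<in>carrier K. ga_basis k l * \<rho> l $$ p) = \<rho> k $$ p" for p
    using finite_carrier assms by (simp add: ga_basis_def if_distrib[of "\<lambda>c. c * _"] cong: if_cong)
  then show ?thesis using mat2_collapse[OF rho_closed[OF assms]] by (simp add: theta_mat2)
qed

lemma tau_closed [simp]: "\<tau> M \<in> carrier A"
  by (simp add: \<tau>_def)

lemma theta_tau:
  assumes "M \<in> carrier_mat 2 2"
  shows "\<theta> (\<tau> M) = M"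
proof -
  have "(\<Sum>k\<in>carrier K. \<tau> M k * \<rho> k $$ (p, q)) = M $$ (p, q)" if "p < 2" "q < 2" for p q
  proof -
    have "(\<Sum>k\<in>carrier K. \<tau> M k * \<rho> k $$ (p, q)) =
        (\<Sum>k\<in>carrier K. frob (\<rho> k) M * \<rho> k $$ (p, q)) / (2 * of_nat m)"
      unfolding sum_divide_distrib by (rule sum.cong) (simp_all add: \<tau>_def)
    then show ?thesis using m_pos by (simp add: rho_orthogonality[OF assms that])
  qed
  from this[of 0 0] this[of 0 1] this[of 1 0] this[of 1 1] show ?thesis
    using mat2_collapse[OF assms] by (simp add: theta_mat2)
qed

lemma tau_inj: "M \<in> carrier_mat 2 2 \<Longrightarrow> N \<in> carrier_mat 2 2 \<Longrightarrow> \<tau> M = \<tau> N \<Longrightarrow> M = N"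
  by (metis theta_tau)

lemma tau_add:
  "M \<in> carrier_mat 2 2 \<Longrightarrow> N \<in> carrier_mat 2 2 \<Longrightarrow> \<tau> (M + N) = \<tau> M \<oplus>\<^bsub>A\<^esub> \<tau> N"
  by (auto simp: \<tau>_def frob_def fun_eq_iff distrib_left add_divide_distrib)

lemma tau_zero: "\<tau> (mat2 0 0 0 0) = \<zero>\<^bsub>A\<^esub>"
  by (auto simp: \<tau>_def frob_def fun_eq_iff)

lemma frob_theta:
  assumes "X \<in> carrier_mat 2 2" "M \<in> carrier_mat 2 2"
  shows "frob X (\<theta> u * M) = (\<Sum>k\<in>carrier K. u k * frob X (\<rho> k * M))"
    and "frob X (M * \<theta> u) = (\<Sum>k\<in>carrier K. u k * frob X (M * \<rho> k))"
proof -
  obtain x1 x2 x3 x4 where X: "X = mat2 x1 x2 x3 x4" using assms(1) by (rule mat2_cases)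
  obtain m1 m2 m3 m4 where M: "M = mat2 m1 m2 m3 m4" using assms(2) by (rule mat2_cases)
  let ?r = "\<lambda>k. mat2 (\<rho> k $$ (0, 0)) (\<rho> k $$ (0, Suc 0)) (\<rho> k $$ (Suc 0, 0)) (\<rho> k $$ (Suc 0, Suc 0))"
  have "(\<Sum>k\<in>carrier K. u k * frob X (\<rho> k * M)) = (\<Sum>k\<in>carrier K. u k * frob X (?r k * M))"
    "(\<Sum>k\<in>carrier K. u k * frob X (M * \<rho> k)) = (\<Sum>k\<in>carrier K. u k * frob X (M * ?r k))"
    by (rule sum.cong, simp_all add: mat2_collapse[OF rho_closed])+
  then show "frob X (\<theta> u * M) = (\<Sum>k\<in>carrier K. u k * frob X (\<rho> k * M))"
    "frob X (M * \<theta> u) = (\<Sum>k\<in>carrier K. u k * frob X (M * \<rho> k))"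
    by (simp_all add: theta_mat2 X M algebra_simps sum.distrib sum_distrib_left)
qed

text \<open>Invariance of the Frobenius form moves the translation from the group argument to M.
  With \<open>tau_mult\<close>, the image of \<open>\<tau>\<close> is a two-sided ideal on which the
  algebra acts through \<open>\<theta>\<close>.\<close>

lemma mult_tau:
  assumes M: "M \<in> carrier_mat 2 2"
  shows "u \<otimes>\<^bsub>A\<^esub> \<tau> M = \<tau> (\<theta> u * M)"
proof
  fix k
  show "(u \<otimes>\<^bsub>A\<^esub> \<tau> M) k = \<tau> (\<theta> u * M) k"
  proof (cases "k \<in> carrier K")
    case True
    have "(u \<otimes>\<^bsub>A\<^esub> \<tau> M) k = (\<Sum>y\<in>carrier K. u y * frob (\<rho> k) (\<rho> y * M)) / (2 * of_nat m)"
      unfolding ga_mult[OF True] sum_divide_distrib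
    proof (rule sum.cong[OF refl])
      fix y assume y: "y \<in> carrier K"
      have "frob (\<rho> (inv y \<otimes> k)) M = frob (\<rho> k) (\<rho> y * M)"
        using y True M by (simp add: rho_mult rho_frob_left rho_closed)
      then show "u y * \<tau> M (inv y \<otimes> k) = u y * frob (\<rho> k) (\<rho> y * M) / (2 * of_nat m)"
        using y True by (simp add: \<tau>_def)
    qed
    then show ?thesis using True by (simp add: \<tau>_def frob_theta(1)[OF rho_closed[OF True] M])
  qed (simp add: ga_mult_outside \<tau>_def)
qed

lemma tau_mult:
  assumes M: "M \<in> carrier_mat 2 2"
  shows "\<tau> M \<otimes>\<^bsub>A\<^esub> u = \<tau> (M * \<theta> u)"
proof
  fix k
  show "(\<tau> M \<otimes>\<^bsub>A\<^esub> u) k = \<tau> (M * \<theta> u) k"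
  proof (cases "k \<in> carrier K")
    case True
    have "(\<tau> M \<otimes>\<^bsub>A\<^esub> u) k = (\<Sum>y\<in>carrier K. u y * frob (\<rho> k) (M * \<rho> y)) / (2 * of_nat m)"
      unfolding ga_mult_right[OF True] sum_divide_distrib
    proof (rule sum.cong[OF refl])
      fix y assume y: "y \<in> carrier K"
      have "frob (\<rho> (k \<otimes> inv y)) M = frob (\<rho> k) (M * \<rho> y)"
        using y True M by (simp add: rho_mult rho_frob_right rho_closed)
      then show "\<tau> M (k \<otimes> inv y) * u y = u y * frob (\<rho> k) (M * \<rho> y) / (2 * of_nat m)"
        using y True by (simp add: \<tau>_def)
    qed
    then show ?thesis using True by (simp add: \<tau>_def frob_theta(2)[OF rho_closed[OF True] M])
  qed (simp add: ga_mult_outside \<tau>_def)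
qed

lemma tau_tau: "M \<in> carrier_mat 2 2 \<Longrightarrow> N \<in> carrier_mat 2 2 \<Longrightarrow> \<tau> M \<otimes>\<^bsub>A\<^esub> \<tau> N = \<tau> (M * N)"
  by (simp only: mult_tau theta_tau)

text \<open>The character formula for a central idempotent: the coefficient at k is the trace of
  \<open>\<rho> k\<close> divided by 2m.\<close>

definition e :: "'a \<Rightarrow> rat" where "e = \<tau> (1\<^sub>m 2)"

lemma e_closed [simp]: "e \<in> carrier A"
  unfolding e_def by (rule tau_closed)

lemma mult_e: "u \<otimes>\<^bsub>A\<^esub> e = \<tau> (\<theta> u)"
  unfolding e_def by (subst mult_tau) (simp_all add: right_mult_one_mat[OF theta_closed])

lemma e_mult: "e \<otimes>\<^bsub>A\<^esub> u = \<tau> (\<theta> u)"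
  unfolding e_def by (subst tau_mult) (simp_all add: left_mult_one_mat[OF theta_closed])

lemma tau_e: "M \<in> carrier_mat 2 2 \<Longrightarrow> \<tau> M \<otimes>\<^bsub>A\<^esub> e = \<tau> M" "M \<in> carrier_mat 2 2 \<Longrightarrow> e \<otimes>\<^bsub>A\<^esub> \<tau> M = \<tau> M"
  by (simp_all only: mult_e e_mult theta_tau)

lemma e_central_idempotent: "central_idempotent A e"
  unfolding central_idempotent_def centre_def
  using e_closed by (simp add: mult_e e_mult del: grp_alg_simps) (simp add: e_def theta_tau)

lemma theta_e: "\<theta> e = 1\<^sub>m 2"
  by (simp add: e_def theta_tau)

text \<open>Associativity of u v e gives the claim under the injective \<open>\<tau>\<close>, so no
  double sum has to be rearranged.\<close>

lemma theta_mult: "\<theta> (u \<otimes>\<^bsub>A\<^esub> v) = \<theta> u * \<theta> v"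
proof (rule tau_inj)
  have "\<tau> (\<theta> (u \<otimes>\<^bsub>A\<^esub> v)) = u \<otimes>\<^bsub>A\<^esub> (v \<otimes>\<^bsub>A\<^esub> e)" by (simp only: mult_e[symmetric] ga_assoc)
  also have "\<dots> = \<tau> (\<theta> u * \<theta> v)" by (simp only: mult_e mult_tau theta_closed)
  finally show "\<tau> (\<theta> (u \<otimes>\<^bsub>A\<^esub> v)) = \<tau> (\<theta> u * \<theta> v)" .
qed (simp_all add: mult_carrier_mat[OF theta_closed theta_closed])

lemma component_carrier: "carrier (component A e) = \<tau> ` carrier_mat 2 2"
proof -
  have "\<tau> M = \<tau> M \<otimes>\<^bsub>A\<^esub> e" if "M \<in> carrier_mat 2 2" for M using that by (simp only: tau_e)
  then have "\<tau> ` carrier_mat 2 2 \<subseteq> (\<lambda>u. u \<otimes>\<^bsub>A\<^esub> e) ` carrier A"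
    using tau_closed by blast
  moreover have "(\<lambda>u. u \<otimes>\<^bsub>A\<^esub> e) ` carrier A \<subseteq> \<tau> ` carrier_mat 2 2"
    using theta_closed by (auto simp only: mult_e)
  ultimately show ?thesis by (simp add: component_def del: grp_alg_simps)
qed

lemma component_ops [simp]:
  "monoid.mult (component A e) = monoid.mult A" "one (component A e) = e"
    "add (component A e) = add A"
  by (simp_all add: component_def del: grp_alg_simps)

lemma theta_iso: "\<theta> \<in> ring_iso (component A e) M2Q"
proof (rule ring_iso_memI)
  show "bij_betw \<theta> (carrier (component A e)) (carrier M2Q)"
    unfolding component_carrier ring_mat_simps
    by (rule bij_betw_byWitness[of _ \<tau>]) (auto simp: theta_tau)
qed (simp_all only: component_ops ring_mat_simps theta_closed theta_mult theta_add theta_e)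

lemma matrix_algebra_theta: "matrix_algebra (component A e) \<theta>"
  by (intro matrix_algebra.intro matrix_algebra_axioms.intro theta_iso
      central_idempotent_component_ring e_central_idempotent)

text \<open>A summand e1 of e satisfies e1 e = e1, so it is determined by its matrix. That matrix
  commutes with everything, hence is scalar, and being idempotent it is 0 or 1.\<close>

lemma e_primitive: "primitive_central_idempotent A e"
  unfolding primitive_central_idempotent_def
proof (intro conjI allI impI)
  show "central_idempotent A e" by (rule e_central_idempotent)
  show "e \<noteq> \<zero>\<^bsub>A\<^esub>"
    using tau_inj[of "1\<^sub>m 2" "mat2 0 0 0 0"]
    by (auto simp: e_def tau_zero[symmetric] one_mat2 simp del: grp_alg_simps)
  fix e1 e2
  assume h: "central_idempotent A e1 \<and> central_idempotent A e2 \<and> e1 \<otimes>\<^bsub>A\<^esub> e2 = \<zero>\<^bsub>A\<^esub> \<and> e = e1 \<oplus>\<^bsub>A\<^esub> e2"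
  then have c: "e1 \<in> carrier A" "e2 \<in> carrier A" "e1 \<otimes>\<^bsub>A\<^esub> e1 = e1" "e2 \<otimes>\<^bsub>A\<^esub> e2 = e2"
    "\<And>x. x \<in> carrier A \<Longrightarrow> e1 \<otimes>\<^bsub>A\<^esub> x = x \<otimes>\<^bsub>A\<^esub> e1" "e1 \<otimes>\<^bsub>A\<^esub> e2 = \<zero>\<^bsub>A\<^esub>" "e = e1 \<oplus>\<^bsub>A\<^esub> e2"
    unfolding central_idempotent_def centre_def by auto
  have "e1 \<otimes>\<^bsub>A\<^esub> e = e1" unfolding c(7) using c(1,2,3,6) by (simp add: A.r_distr del: grp_alg_simps)
  then have e1: "e1 = \<tau> (\<theta> e1)" by (simp add: mult_e)
  have "e2 \<otimes>\<^bsub>A\<^esub> e = e2" unfolding c(7) using c(1,2,4,6) c(5)[OF c(2)]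
    by (simp add: A.r_distr del: grp_alg_simps)
  have e2: "e2 \<otimes>\<^bsub>A\<^esub> e1 = \<zero>\<^bsub>A\<^esub>" using c(5)[OF c(2)] c(6) by simp
  obtain p q r s where th: "\<theta> e1 = mat2 p q r s" using theta_closed by (rule mat2_cases)
  have comm: "\<theta> e1 * M = M * \<theta> e1" if "M \<in> carrier_mat 2 2" for M
    using c(5)[OF tau_closed, of M] that by (metis theta_mult theta_tau)
  have "q = 0" "r = 0" "p = s"
    using comm[of "mat2 0 1 0 0"] comm[of "mat2 0 0 1 0"] by (simp_all add: th)
  moreover have "\<theta> e1 * \<theta> e1 = \<theta> e1" by (simp only: c(3) theta_mult[symmetric])
  then have "p * p = p" using \<open>q = 0\<close> by (simp add: th)
  then have "p = 0 \<or> p = 1" by simp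
  ultimately have "\<theta> e1 = mat2 0 0 0 0 \<or> \<theta> e1 = 1\<^sub>m 2" by (auto simp: th one_mat2)
  then show "e1 = \<zero>\<^bsub>A\<^esub> \<or> e2 = \<zero>\<^bsub>A\<^esub>"
  proof
    assume "\<theta> e1 = mat2 0 0 0 0"
    then show ?thesis using e1 tau_zero by simp
  next
    assume "\<theta> e1 = 1\<^sub>m 2"
    then have "e1 = e" using e1 by (simp add: e_def)
    then show ?thesis using e2 \<open>e2 \<otimes>\<^bsub>A\<^esub> e = e2\<close> by simp
  qed
qed

text \<open>For necessity the coefficients at 1, a, b and ba suffice: they give the sums and
  differences of the two diagonal and of the two off-diagonal entries. Conversely, the Frobenius
  product of two matrices of \<open>parity_order\<close> is even, which absorbs the 2 in 2m.\<close>

lemma tau_integral_iff: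
  assumes M: "M \<in> carrier_mat 2 2"
  shows "range (\<tau> M) \<subseteq> \<int> \<longleftrightarrow> (\<exists>X\<in>parity_order. M = of_nat m \<cdot>\<^sub>m X)"
proof
  assume int: "range (\<tau> M) \<subseteq> \<int>"
  obtain m1 m2 m3 m4 where Me: "M = mat2 m1 m2 m3 m4" using M by (rule mat2_cases)
  have k: "\<exists>i. frob (\<rho> k) M = 2 * of_nat m * of_int i" if "k \<in> carrier K" for k
  proof -
    have "\<tau> M k \<in> \<int>" using int by blast
    then obtain i where "\<tau> M k = of_int i" by (auto elim: Ints_cases)
    then show ?thesis using that m_pos by (auto simp: \<tau>_def field_simps)
  qed
  obtain p where p: "m1 + m4 = 2 * of_nat m * of_int p"
    using k[OF one_closed] by (auto simp: rho_one one_mat2 Me)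
  obtain q where q: "m1 - m4 = 2 * of_nat m * of_int q"
    using k[OF ab_closed(1)] by (auto simp: rho_a Me)
  obtain r where r: "m2 + m3 = 2 * of_nat m * of_int r"
    using k[OF ab_closed(2)] by (auto simp: rho_b Me)
  obtain s where s: "m3 - m2 = 2 * of_nat m * of_int s"
    using k[OF m_closed[OF ab_closed(2,1)]] ab_closed by (auto simp: rho_mult rho_a rho_b Me)
  have "M = of_nat m \<cdot>\<^sub>m mat2 (of_int (p + q)) (of_int (r - s)) (of_int (r + s)) (of_int (p - q))"
    using p q r s by (simp add: Me algebra_simps)
  moreover have "mat2 (of_int (p + q)) (of_int (r - s)) (of_int (r + s)) (of_int (p - q)) \<in> parity_order"
    by (rule parity_orderI[OF _ _ refl]) auto
  ultimately show "\<exists>X\<in>parity_order. M = of_nat m \<cdot>\<^sub>m X" by blast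
next
  assume "\<exists>X\<in>parity_order. M = of_nat m \<cdot>\<^sub>m X"
  then obtain X where X: "X \<in> parity_order" "M = of_nat m \<cdot>\<^sub>m X" by blast
  obtain p q r s
    where Xe: "X = mat2 (of_int p) (of_int q) (of_int r) (of_int s)" "even (p - s)" "even (q - r)"
    using X(1) by (rule parity_order_cases)
  have "\<tau> M k \<in> \<int>" for k
  proof (cases "k \<in> carrier K")
    case True
    obtain p' q' r' s'
      where ke: "\<rho> k = mat2 (of_int p') (of_int q') (of_int r') (of_int s')" "even (p' - s')"
      "even (q' - r')"
      using rho_parity[OF True] by (rule parity_order_cases)
    have "even (p' * p + q' * q + r' * r + s' * s)" using Xe(2,3) ke(2,3) by auto
    then obtain t where t: "p' * p + q' * q + r' * r + s' * s = 2 * t" by blast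
    have "frob (\<rho> k) M = of_nat m * of_int (p' * p + q' * q + r' * r + s' * s)"
      by (simp add: ke(1) X(2) Xe(1) algebra_simps)
    then have "\<tau> M k = of_int t" using True m_pos by (simp add: \<tau>_def t)
    then show ?thesis by simp
  qed (simp add: \<tau>_def)
  then show "range (\<tau> M) \<subseteq> \<int>" by blast
qed

end


section \<open>Units of the integral group ring\<close>

text \<open>F factors through the key. Applied with cosets as values and residues modulo 2m as keys,
  it gives finite index.\<close>

lemma finite_image_of_key:
  assumes "finite (key ` S)" "\<And>x y. x \<in> S \<Longrightarrow> y \<in> S \<Longrightarrow> key x = key y \<Longrightarrow> F x = F y"
  shows "finite (F ` S)"
proof -
  have "F x = F (inv_into S key (key x))" if "x \<in> S" for x
    using that by (intro assms(2)) (auto simp: inv_into_into f_inv_into_f)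
  then have "F ` S \<subseteq> (\<lambda>k. F (inv_into S key k)) ` key ` S" by auto
  then show ?thesis using assms(1) finite_subset by blast
qed

definition parity_units :: "rat mat set" where
  "parity_units = {X \<in> parity_order. \<exists>Y\<in>parity_order. X * Y = 1\<^sub>m 2 \<and> Y * X = 1\<^sub>m 2}"

lemma mat_group_parity_units: "mat_group parity_units"
  unfolding mat_group_def
proof (intro conjI ballI)
  show "parity_units \<subseteq> carrier_mat 2 2" using parity_order_subset_carrier unfolding parity_units_def
    by blast
  show "1\<^sub>m 2 \<in> parity_units" using one_in_parity_order unfolding parity_units_def by force
  fix X assume X: "X \<in> parity_units"
  then obtain X' where X': "X \<in> parity_order" "X' \<in> parity_order" "X * X' = 1\<^sub>m 2" "X' * X = 1\<^sub>m 2"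
    unfolding parity_units_def by blast
  then have "X' \<in> parity_units" unfolding parity_units_def by blast
  then show "\<exists>Y\<in>parity_units. X * Y = 1\<^sub>m 2 \<and> Y * X = 1\<^sub>m 2" using X' by blast
  fix Y assume Y: "Y \<in> parity_units"
  then obtain Y' where Y': "Y \<in> parity_order" "Y' \<in> parity_order" "Y * Y' = 1\<^sub>m 2" "Y' * Y = 1\<^sub>m 2"
    unfolding parity_units_def by blast
  have c: "X \<in> carrier_mat 2 2" "X' \<in> carrier_mat 2 2" "Y \<in> carrier_mat 2 2" "Y' \<in> carrier_mat 2 2"
    using X' Y' parity_order_subset_carrier by auto
  have "X * Y * (Y' * X') = X * (Y * Y') * X'"
    using c by (simp add: assoc_mult_mat[of _ 2 2 _ 2 _ 2])
  then have 1: "X * Y * (Y' * X') = 1\<^sub>m 2" using X' Y' c by simp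
  have "Y' * X' * (X * Y) = Y' * (X' * X) * Y"
    using c by (simp add: assoc_mult_mat[of _ 2 2 _ 2 _ 2])
  then have 2: "Y' * X' * (X * Y) = 1\<^sub>m 2" using X' Y' c by simp
  show "X * Y \<in> parity_units"
    using 1 2 parity_order_mult[OF X'(1) Y'(1)] parity_order_mult[OF Y'(2) X'(2)]
    unfolding parity_units_def by blast
qed

lemma V_mats_subset_parity_units: "V_mats m \<subseteq> parity_units"
proof -
  have sub: "V_mats m \<subseteq> parity_order"
  proof
    fix X assume "X \<in> V_mats m"
    then obtain C where "C \<in> parity_order" "X = 1\<^sub>m 2 + of_int (int m) \<cdot>\<^sub>m C" unfolding V_mats_eq
      by auto
    then show "X \<in> parity_order"
      by (simp only: parity_order_add[OF one_in_parity_order parity_order_smult])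
  qed
  moreover have "\<forall>X\<in>V_mats m. \<exists>Y\<in>V_mats m. X * Y = 1\<^sub>m 2 \<and> Y * X = 1\<^sub>m 2"
    using mat_group_V unfolding mat_group_def by blast
  ultimately show ?thesis unfolding parity_units_def by blast
qed

text \<open>On \<open>M2Z\<close> the floors only convert rational entries to integers. The
  determinant is recorded because \<open>V_mats_of_congruent_units\<close> asks for equal
  determinants.\<close>

definition residue_key :: "nat \<Rightarrow> rat mat \<Rightarrow> (int \<times> int) \<times> (int \<times> int) \<times> rat" where
  "residue_key k X = ((\<lfloor>X $$ (0, 0)\<rfloor> mod int k, \<lfloor>X $$ (0, Suc 0)\<rfloor> mod int k),
     (\<lfloor>X $$ (Suc 0, 0)\<rfloor> mod int k, \<lfloor>X $$ (Suc 0, Suc 0)\<rfloor> mod int k), det X)"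

lemma residue_key_congruent:
  assumes "X \<in> M2Z" "Y \<in> M2Z" "residue_key k X = residue_key k Y"
  shows "det X = det Y" "\<exists>C\<in>M2Z. X = Y + of_nat k \<cdot>\<^sub>m C"
proof -
  show "det X = det Y" using assms(3) by (simp add: residue_key_def)
  obtain p q r s where X: "X = mat2 (of_int p) (of_int q) (of_int r) (of_int s)" using assms(1)
    by (rule M2Z_cases)
  obtain p' q' r' s' where Y: "Y = mat2 (of_int p') (of_int q') (of_int r') (of_int s')"
    using assms(2) by (rule M2Z_cases)
  have "int k dvd p - p'" "int k dvd q - q'" "int k dvd r - r'" "int k dvd s - s'"
    using assms(3) by (auto simp: residue_key_def X Y mod_eq_dvd_iff)
  then obtain c1 c2 c3 c4
    where c: "p - p' = int k * c1" "q - q' = int k * c2" "r - r' = int k * c3" "s - s' = int k * c4"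
    by (elim dvdE)
  then have "p = p' + int k * c1" "q = q' + int k * c2" "r = r' + int k * c3" "s = s' + int k * c4"
    by linarith+
  then have "X = Y + of_nat k \<cdot>\<^sub>m mat2 (of_int c1) (of_int c2) (of_int c3) (of_int c4)"
    by (simp add: X Y)
  then show "\<exists>C\<in>M2Z. X = Y + of_nat k \<cdot>\<^sub>m C" by (rule bexI) simp
qed

lemma finite_residue_keys:
  assumes "0 < k"
  shows "finite (residue_key k ` parity_units)"
proof (rule finite_subset)
  let ?I = "{0..<int k}"
  show "residue_key k ` parity_units \<subseteq> (?I \<times> ?I) \<times> (?I \<times> ?I) \<times> {1, -1}"
  proof (rule image_subsetI)
    fix X assume "X \<in> parity_units"
    then have "det X = 1 \<or> det X = - 1"
      using det_M2Z_unit parity_order_subset unfolding parity_units_def by blast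
    then show "residue_key k X \<in> (?I \<times> ?I) \<times> (?I \<times> ?I) \<times> {1, -1}"
      using assms by (auto simp: residue_key_def)
  qed
qed auto

lemma int_grp_ring_simps [simp]:
  "carrier (int_grp_ring K) = {u \<in> carrier (grp_alg K). range u \<subseteq> \<int>}"
  "monoid.mult (int_grp_ring K) = monoid.mult (grp_alg K)"
  "one (int_grp_ring K) = one (grp_alg K)"
  by (simp_all add: int_grp_ring_def del: grp_alg_simps)

section \<open>Elements of the form 1 - e + M\<close>

context planar_rep
begin

text \<open>Acts as M on the component of e and as the identity on the complement; multiplicative,
  but not additive.\<close>

definition \<Phi> :: "rat mat \<Rightarrow> 'a \<Rightarrow> rat" where
  "\<Phi> M = \<one>\<^bsub>A\<^esub> \<ominus>\<^bsub>A\<^esub> e \<oplus>\<^bsub>A\<^esub> \<tau> M"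

lemma one_minus_plus_tau: "one_minus_plus A e (\<tau> ` S) = \<Phi> ` S"
  by (simp add: one_minus_plus_def \<Phi>_def image_image del: grp_alg_simps)

lemma Phi_closed [simp]: "\<Phi> M \<in> carrier A"
  unfolding \<Phi>_def by (intro A.a_closed A.minus_closed A.one_closed e_closed tau_closed)

text \<open>\<open>\<tau>\<close> of the identity matrix is e and cancels the -e. Both the elements
  \<open>v_elt\<close> and the integrality criterion come in this shape.\<close>

lemma Phi_add_one:
  assumes "N \<in> carrier_mat 2 2"
  shows "\<Phi> (1\<^sub>m 2 + N) = \<one>\<^bsub>A\<^esub> \<oplus>\<^bsub>A\<^esub> \<tau> N"
  unfolding \<Phi>_def by (simp add: tau_add assms ga_minus[OF e_closed]) (simp add: e_def)

lemma Phi_one: "\<Phi> (1\<^sub>m 2) = \<one>\<^bsub>A\<^esub>"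
  unfolding \<Phi>_def by (simp add: ga_minus[OF e_closed]) (simp add: e_def)

lemma theta_one: "\<theta> \<one>\<^bsub>A\<^esub> = 1\<^sub>m 2"
  by (simp add: theta_basis rho_one)

lemma theta_one_minus_e: "\<theta> (\<one>\<^bsub>A\<^esub> \<ominus>\<^bsub>A\<^esub> e) = mat2 0 0 0 0"
proof -
  have "(\<one>\<^bsub>A\<^esub> \<ominus>\<^bsub>A\<^esub> e) \<oplus>\<^bsub>A\<^esub> e = \<one>\<^bsub>A\<^esub>" by (simp add: ga_minus[OF e_closed])
  then have "\<theta> (\<one>\<^bsub>A\<^esub> \<ominus>\<^bsub>A\<^esub> e) + 1\<^sub>m 2 = 1\<^sub>m 2" by (metis theta_add theta_e theta_one)
  moreover obtain p q r s where "\<theta> (\<one>\<^bsub>A\<^esub> \<ominus>\<^bsub>A\<^esub> e) = mat2 p q r s" using theta_closed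
    by (rule mat2_cases)
  ultimately show ?thesis by (simp add: one_mat2)
qed

lemma theta_Phi: "M \<in> carrier_mat 2 2 \<Longrightarrow> \<theta> (\<Phi> M) = M"
  unfolding \<Phi>_def by (simp only: theta_add theta_one_minus_e theta_tau) (elim mat2_cases, simp)


text \<open>1 - e is idempotent and annihilates the image of \<open>\<tau>\<close> from both sides,
  so the mixed terms vanish.\<close>

lemma Phi_mult:
  assumes M: "M \<in> carrier_mat 2 2" and N: "N \<in> carrier_mat 2 2"
  shows "\<Phi> M \<otimes>\<^bsub>A\<^esub> \<Phi> N = \<Phi> (M * N)"
proof -
  let ?f = "\<one>\<^bsub>A\<^esub> \<ominus>\<^bsub>A\<^esub> e"
  have f: "?f \<in> carrier A" by (intro A.minus_closed A.one_closed e_closed)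
  have 0: "mat2 0 0 0 0 * X = mat2 0 0 0 0 \<and> X * mat2 0 0 0 0 = mat2 0 0 0 0"
    if "X \<in> carrier_mat 2 2" for X :: "rat mat"
    using that by (elim mat2_cases) simp
  have fN: "?f \<otimes>\<^bsub>A\<^esub> \<tau> N = \<zero>\<^bsub>A\<^esub>" unfolding mult_tau[OF N] theta_one_minus_e using 0[OF N] tau_zero
    by simp
  have Mf: "\<tau> M \<otimes>\<^bsub>A\<^esub> ?f = \<zero>\<^bsub>A\<^esub>" unfolding tau_mult[OF M] theta_one_minus_e using 0[OF M] tau_zero
    by simp
  have fe: "?f \<otimes>\<^bsub>A\<^esub> e = \<zero>\<^bsub>A\<^esub>" unfolding mult_e theta_one_minus_e by (rule tau_zero)
  have "?f = ?f \<otimes>\<^bsub>A\<^esub> (?f \<oplus>\<^bsub>A\<^esub> e)"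
  proof -
    have "?f \<oplus>\<^bsub>A\<^esub> e = \<one>\<^bsub>A\<^esub>" by (simp add: ga_minus[OF e_closed])
    then show ?thesis using A.r_one[OF f] by simp
  qed
  also have "\<dots> = ?f \<otimes>\<^bsub>A\<^esub> ?f" unfolding A.r_distr[OF f e_closed f] fe
    by (rule A.r_zero[OF A.m_closed[OF f f]])
  finally have ff: "?f \<otimes>\<^bsub>A\<^esub> ?f = ?f" ..
  have "\<Phi> M \<otimes>\<^bsub>A\<^esub> \<Phi> N = (?f \<otimes>\<^bsub>A\<^esub> ?f \<oplus>\<^bsub>A\<^esub> \<tau> M \<otimes>\<^bsub>A\<^esub> ?f) \<oplus>\<^bsub>A\<^esub> (?f \<otimes>\<^bsub>A\<^esub> \<tau> N \<oplus>\<^bsub>A\<^esub> \<tau> M \<otimes>\<^bsub>A\<^esub> \<tau> N)"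
    unfolding \<Phi>_def by (simp add: ga_l_distr ga_r_distr add_ac)
  also have "\<dots> = \<Phi> (M * N)"
    unfolding ff fN Mf tau_tau[OF M N] \<Phi>_def by simp
  finally show ?thesis .
qed

lemma Phi_integral_iff:
  assumes M: "M \<in> carrier_mat 2 2"
  shows "\<Phi> M \<in> carrier (int_grp_ring K) \<longleftrightarrow> (\<exists>X\<in>parity_order. M = 1\<^sub>m 2 + of_nat m \<cdot>\<^sub>m X)"
proof -
  obtain p q r s where Me: "M = mat2 p q r s" using M by (rule mat2_cases)
  define N where "N = mat2 (p - 1) q r (s - 1)"
  have MN: "M = 1\<^sub>m 2 + N" by (simp add: Me N_def one_mat2)
  have N: "N \<in> carrier_mat 2 2" by (simp add: N_def)
  have "ga_basis \<one> k \<in> \<int>" for k by (simp add: ga_basis_def)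
  then have "ga_basis \<one> k + \<tau> N k \<in> \<int> \<longleftrightarrow> \<tau> N k \<in> \<int>" for k
    by (metis Ints_add Ints_diff add_diff_cancel_left')
  then have "range (\<Phi> M) \<subseteq> \<int> \<longleftrightarrow> range (\<tau> N) \<subseteq> \<int>"
    unfolding MN Phi_add_one[OF N] by (auto simp: subset_iff)
  also have "\<dots> \<longleftrightarrow> (\<exists>X\<in>parity_order. N = of_nat m \<cdot>\<^sub>m X)" by (rule tau_integral_iff[OF N])
  also have "\<dots> \<longleftrightarrow> (\<exists>X\<in>parity_order. M = 1\<^sub>m 2 + of_nat m \<cdot>\<^sub>m X)"
  proof (rule bex_cong[OF refl])
    fix X assume "X \<in> parity_order"
    then have "X \<in> carrier_mat 2 2" using parity_order_subset_carrier by blast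
    then show "N = of_nat m \<cdot>\<^sub>m X \<longleftrightarrow> M = 1\<^sub>m 2 + of_nat m \<cdot>\<^sub>m X"
      by (elim mat2_cases) (auto simp: N_def Me one_mat2)
  qed
  finally show ?thesis using Phi_closed[of M] by (simp del: grp_alg_simps)
qed

lemma Phi_V_units:
  assumes "M \<in> V_mats m"
  shows "\<Phi> M \<in> Units (int_grp_ring K)"
proof -
  obtain M' where M': "M' \<in> V_mats m" "M * M' = 1\<^sub>m 2" "M' * M = 1\<^sub>m 2"
    using assms mat_group_V unfolding mat_group_def by blast
  have int: "\<Phi> X \<in> carrier (int_grp_ring K)" if "X \<in> V_mats m" for X
    using that Phi_integral_iff unfolding V_mats_eq by blast
  have c: "M \<in> carrier_mat 2 2" "M' \<in> carrier_mat 2 2" using assms M'(1) unfolding V_mats_eq by auto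
  have "\<Phi> M \<otimes>\<^bsub>A\<^esub> \<Phi> M' = \<one>\<^bsub>A\<^esub>" "\<Phi> M' \<otimes>\<^bsub>A\<^esub> \<Phi> M = \<one>\<^bsub>A\<^esub>"
    unfolding Phi_mult[OF c] Phi_mult[OF c(2,1)] M' by (rule Phi_one)+
  then show ?thesis
    unfolding Units_def int_grp_ring_simps(2,3) using int[OF assms] int[OF M'(1)] by blast
qed

lemma Phi_mult_e: "M \<in> carrier_mat 2 2 \<Longrightarrow> \<Phi> M \<otimes>\<^bsub>A\<^esub> e = \<tau> M"
  by (simp only: mult_e theta_Phi)

lemma Phi_mult_orthogonal:
  assumes M: "M \<in> carrier_mat 2 2" and f: "f \<in> carrier A" "e \<otimes>\<^bsub>A\<^esub> f = \<zero>\<^bsub>A\<^esub>"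
  shows "\<Phi> M \<otimes>\<^bsub>A\<^esub> f = f"
proof -
  have "\<tau> M \<otimes>\<^bsub>A\<^esub> f = \<tau> M \<otimes>\<^bsub>A\<^esub> e \<otimes>\<^bsub>A\<^esub> f" unfolding tau_e(1)[OF M] ..
  also have "\<dots> = \<zero>\<^bsub>A\<^esub>" unfolding ga_assoc f(2) by (rule A.r_null[OF tau_closed])
  finally have "\<tau> M \<otimes>\<^bsub>A\<^esub> f = \<zero>\<^bsub>A\<^esub>" .
  moreover have "(\<one>\<^bsub>A\<^esub> \<ominus>\<^bsub>A\<^esub> e) \<otimes>\<^bsub>A\<^esub> f = f"
    by (rule one_minus_orthogonal[OF e_closed f])
  ultimately show ?thesis
    unfolding \<Phi>_def
    using A.l_distr[OF A.minus_closed[OF A.one_closed e_closed] tau_closed f(1), of M]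
    by (simp only: A.r_zero[OF f(1)])
qed

text \<open>In the component of e the reduced norm is the determinant. In every other component the
  element acts as the identity, whose image under any splitting is the identity matrix.\<close>

lemma SL1_component: "SL1_int_grp_ring K \<inter> one_minus_plus A e (carrier (component A e)) = \<Phi> ` V_mats m"
proof (intro equalityI subsetI)
  interpret me: matrix_algebra "component A e" \<theta> by (rule matrix_algebra_theta)
  note norm = has_reduced_norm_one_iff[OF me.ring_axioms theta_iso, unfolded component_ops(2)]
  fix u
  {
    assume u: "u \<in> SL1_int_grp_ring K \<inter> one_minus_plus A e (carrier (component A e))"
    then obtain M where M: "M \<in> carrier_mat 2 2" "u = \<Phi> M"
      unfolding component_carrier one_minus_plus_tau by blast
    have "u \<in> carrier (int_grp_ring K)" using u unfolding SL1_int_grp_ring_def Units_def by blast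
    then obtain X where X: "X \<in> parity_order" "M = 1\<^sub>m 2 + of_nat m \<cdot>\<^sub>m X"
      using M Phi_integral_iff by blast
    have "has_reduced_norm (component A e) (u \<otimes>\<^bsub>A\<^esub> e) e"
      using u e_primitive unfolding SL1_int_grp_ring_def by blast
    then have "det M = 1" unfolding norm by (simp only: M(2) Phi_mult_e[OF M(1)] theta_tau[OF M(1)])
    then show "u \<in> \<Phi> ` V_mats m" using X V_matsI unfolding M(2) by blast
  next
    assume "u \<in> \<Phi> ` V_mats m"
    then obtain M where M: "M \<in> V_mats m" "u = \<Phi> M" by blast
    then have Mc: "M \<in> carrier_mat 2 2" "det M = 1" unfolding V_mats_eq by auto
    have "has_reduced_norm (component A f) (u \<otimes>\<^bsub>A\<^esub> f) f" if f: "primitive_central_idempotent A f"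
      for f
    proof (cases "f = e")
      case True
      have "\<tau> M \<in> carrier (component A e)" using Mc unfolding component_carrier by blast
      then show ?thesis
        unfolding True norm M(2) Phi_mult_e[OF Mc(1)] theta_tau[OF Mc(1)] using Mc by blast
    next
      case False
      have fc: "central_idempotent A f" using f unfolding primitive_central_idempotent_def by blast
      note fD = central_idempotentD[OF fc]
      interpret cf: rational_algebra "component A f"
        by (rule central_idempotent_component_ring[OF fc])
      have "e \<otimes>\<^bsub>A\<^esub> f = \<zero>\<^bsub>A\<^esub>" using primitive_orthogonal[OF e_primitive f] False by blast
      then have uf: "u \<otimes>\<^bsub>A\<^esub> f = f" unfolding M(2) using Mc(1) fD(1) by (intro Phi_mult_orthogonal)
      have one: "\<one>\<^bsub>component A f\<^esub> = f" by (simp add: component_def del: grp_alg_simps)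
      have "f \<in> centre (component A f)"
        using cf.one_closed unfolding one centre_def
        by (auto simp: cf.l_one[unfolded one] cf.r_one[unfolded one] simp del: grp_alg_simps)
      moreover have "\<phi> f = det (\<phi> f) \<cdot>\<^sub>m 1\<^sub>m k" if s: "complex_splitting (component A f) k \<phi>"
        for k \<phi>
      proof -
        have "\<phi> \<in> Ring.ring_hom (component A f) (ring_mat TYPE(complex) k ())"
          using s unfolding complex_splitting_def by blast
        from ring_hom_one[OF this] have "\<phi> f = 1\<^sub>m k" unfolding one ring_mat_simps .
        then show ?thesis by (auto intro!: eq_matI)
      qed
      ultimately show ?thesis
        using cf.one_closed unfolding uf has_reduced_norm_def one by blast
    qed
    then show "u \<in> SL1_int_grp_ring K \<inter> one_minus_plus A e (carrier (component A e))"
      unfolding SL1_int_grp_ring_def component_carrier one_minus_plus_tau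
      using M Phi_V_units[OF M(1)] Mc(1) by blast
  }
qed

text \<open>For f \<noteq> e, every element of 1 - f + Af becomes e when multiplied by e, whereas
  \<open>\<Phi> M\<close> becomes \<open>\<tau> M\<close>. So M = 1 for all M in V_m, against
  nontriviality.\<close>

lemma e_unique:
  assumes f: "primitive_central_idempotent A f"
    and sub: "\<Phi> ` V_mats m \<subseteq> one_minus_plus A f (carrier (component A f))"
    and nontriv: "\<Phi> ` V_mats m \<noteq> {\<one>\<^bsub>A\<^esub>}"
  shows "f = e"
proof (rule ccontr)
  assume "f \<noteq> e"
  then have fe: "f \<otimes>\<^bsub>A\<^esub> e = \<zero>\<^bsub>A\<^esub>" using primitive_orthogonal[OF f e_primitive] by blast
  have fc: "f \<in> carrier A" using f central_idempotentD(1) unfolding primitive_central_idempotent_def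
    by blast
  have "M = 1\<^sub>m 2" if M: "M \<in> V_mats m" for M
  proof -
    have Mc: "M \<in> carrier_mat 2 2" using M unfolding V_mats_eq by blast
    obtain y where y: "y \<in> carrier A" "\<Phi> M = \<one>\<^bsub>A\<^esub> \<ominus>\<^bsub>A\<^esub> f \<oplus>\<^bsub>A\<^esub> y \<otimes>\<^bsub>A\<^esub> f"
      using M sub
      by (auto simp: one_minus_plus_def component_def image_subset_iff simp del: grp_alg_simps)
    have "y \<otimes>\<^bsub>A\<^esub> f \<otimes>\<^bsub>A\<^esub> e = \<zero>\<^bsub>A\<^esub>" unfolding ga_assoc fe by (rule A.r_null[OF y(1)])
    moreover have "(\<one>\<^bsub>A\<^esub> \<ominus>\<^bsub>A\<^esub> f) \<otimes>\<^bsub>A\<^esub> e = e"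
      by (rule one_minus_orthogonal[OF fc e_closed fe])
    moreover have "\<Phi> M \<otimes>\<^bsub>A\<^esub> e = (\<one>\<^bsub>A\<^esub> \<ominus>\<^bsub>A\<^esub> f) \<otimes>\<^bsub>A\<^esub> e \<oplus>\<^bsub>A\<^esub> y \<otimes>\<^bsub>A\<^esub> f \<otimes>\<^bsub>A\<^esub> e"
      unfolding y(2)
      by (rule A.l_distr[OF A.minus_closed[OF A.one_closed fc] A.m_closed[OF y(1) fc] e_closed])
    ultimately have "\<tau> M = e" unfolding Phi_mult_e[OF Mc] by (simp only: A.r_zero[OF e_closed])
    then show ?thesis using tau_inj[OF Mc one_carrier_mat] unfolding e_def by blast
  qed
  moreover have "1\<^sub>m 2 \<in> V_mats m" using mat_group_V unfolding mat_group_def by blast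
  ultimately have "V_mats m = {1\<^sub>m 2}" by blast
  then show False using nontriv Phi_one by simp
qed

section \<open>The image of the integral group ring in the component and its units\<close>

lemma theta_integral:
  assumes "u \<in> carrier (int_grp_ring K)"
  shows "\<theta> u \<in> parity_order"
proof -
  have "mat 2 2 (\<lambda>p. \<Sum>k\<in>S. u k * \<rho> k $$ p) \<in> parity_order" if "finite S" "S \<subseteq> carrier K" for S
    using that
  proof (induction rule: finite_induct)
    case empty
    show ?case by (rule parity_orderI[of 0 0 0 0]) (auto intro!: mat2_eqI)
  next
    case (insert k S)
    have "u k \<in> \<int>" using assms by auto
    then obtain i where i: "u k = of_int i" by (auto elim: Ints_cases)
    have k: "k \<in> carrier K" using insert by simp
    have "mat 2 2 (\<lambda>p. \<Sum>k\<in>insert k S. u k * \<rho> k $$ p) =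
        of_int i \<cdot>\<^sub>m \<rho> k + mat 2 2 (\<lambda>p. \<Sum>k\<in>S. u k * \<rho> k $$ p)"
      using insert(1,2) rho_closed[OF k] by (intro eq_matI) (auto simp: i)
    also have "\<dots> \<in> parity_order"
      using insert by (intro parity_order_add parity_order_smult rho_parity) auto
    finally show ?case .
  qed
  then show ?thesis unfolding \<theta>_def using finite_carrier by blast
qed

lemma theta_smult: "\<theta> (\<lambda>k. c * u k) = c \<cdot>\<^sub>m \<theta> u"
  by (simp add: theta_mat2 sum_distrib_left mult.assoc)

text \<open>The images of 1, a, b and ba generate \<open>parity_order\<close> additively; c1, ...,
  c4 are the half sums and half differences of entries, integral by the parity conditions.\<close>

lemma theta_integral_surj:
  assumes "X \<in> parity_order"
  obtains u where "u \<in> carrier (int_grp_ring K)" "\<theta> u = X"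
proof -
  obtain p q r s
    where X: "X = mat2 (of_int p) (of_int q) (of_int r) (of_int s)" "even (p - s)" "even (q - r)"
    using assms by (rule parity_order_cases)
  have "even (p + s)" "even (q + r)" "even (r - q)" using X(2,3) by auto
  then obtain c1 c2 c3 c4
    where c: "p + s = 2 * c1" "p - s = 2 * c2" "q + r = 2 * c3" "r - q = 2 * c4"
    using X(2) by (elim evenE)
  let ?u = "(\<lambda>k. of_int c1 * ga_basis \<one> k) \<oplus>\<^bsub>A\<^esub> (\<lambda>k. of_int c2 * ga_basis a k)
    \<oplus>\<^bsub>A\<^esub> (\<lambda>k. of_int c3 * ga_basis b k) \<oplus>\<^bsub>A\<^esub> (\<lambda>k. of_int c4 * ga_basis (b \<otimes> a) k)"
  have "\<theta> ?u = of_int c1 \<cdot>\<^sub>m \<rho> \<one> + of_int c2 \<cdot>\<^sub>m \<rho> a + of_int c3 \<cdot>\<^sub>m \<rho> b + of_int c4 \<cdot>\<^sub>m \<rho> (b \<otimes> a)"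
    using ab_closed by (simp only: theta_add theta_smult theta_basis one_closed m_closed)
  also have "\<dots> = mat2 (of_int (c1 + c2)) (of_int (c3 - c4)) (of_int (c3 + c4)) (of_int (c1 - c2))"
    using ab_closed by (simp add: rho_mult rho_one rho_a rho_b one_mat2)
  also have "\<dots> = X"
  proof -
    have "c1 + c2 = p" "c3 - c4 = q" "c3 + c4 = r" "c1 - c2 = s" using c by linarith+
    then show ?thesis unfolding X(1) by (simp only:)
  qed
  finally have "\<theta> ?u = X" .
  moreover have "?u \<in> carrier (int_grp_ring K)"
    using ab_closed by (auto simp: ga_basis_def)
  ultimately show ?thesis using that by blast
qed

lemma int_component_units: "Units (component (int_grp_ring K) e) = \<tau> ` parity_units"
proof -
  let ?Z = "component (int_grp_ring K) e"
  have car: "carrier ?Z = \<tau> ` parity_order"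
  proof -
    have "carrier ?Z = (\<lambda>u. \<tau> (\<theta> u)) ` carrier (int_grp_ring K)"
      by (simp add: component_def mult_e del: grp_alg_simps)
    also have "\<dots> = \<tau> ` \<theta> ` carrier (int_grp_ring K)" by (simp only: image_image)
    also have "\<theta> ` carrier (int_grp_ring K) = parity_order"
    proof (intro equalityI subsetI)
      fix X assume "X \<in> parity_order"
      then obtain u where "u \<in> carrier (int_grp_ring K)" "\<theta> u = X" by (rule theta_integral_surj)
      then show "X \<in> \<theta> ` carrier (int_grp_ring K)" by (intro image_eqI[of _ _ u]) auto
    qed (use theta_integral in blast)
    finally show ?thesis .
  qed
  have ops: "monoid.mult ?Z = monoid.mult A" "one ?Z = e"
    by (simp_all add: component_def del: grp_alg_simps)
  have mult: "\<tau> X \<otimes>\<^bsub>A\<^esub> \<tau> Y = e \<longleftrightarrow> X * Y = 1\<^sub>m 2" if "X \<in> parity_order" "Y \<in> parity_order" for X Y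
  proof -
    have c: "X \<in> carrier_mat 2 2" "Y \<in> carrier_mat 2 2" using that parity_order_subset_carrier
      by auto
    have "X * Y \<in> carrier_mat 2 2" using c by simp
    then show ?thesis unfolding tau_tau[OF c] e_def using tau_inj one_carrier_mat by metis
  qed
  show ?thesis
    unfolding Units_def car ops parity_units_def using mult by blast
qed

text \<open>Normality is \<open>V_mats_conj\<close>. For the index, two units with the same residues
  modulo 2m and the same determinant lie in one coset, and there are finitely many such
  data.\<close>

lemma normal_finite_index:
  defines "N \<equiv> A\<lparr>carrier := \<Phi> ` parity_units\<rparr>"
  shows "\<Phi> ` V_mats m \<lhd> N" "finite (rcosets\<^bsub>N\<^esub> (\<Phi> ` V_mats m))"
proof -
  note PU = mat_group_parity_units[unfolded mat_group_def]
  have PUc: "X \<in> carrier_mat 2 2" if "X \<in> parity_units" for X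
    using that PU by blast
  have PU_mult: "X * Y \<in> parity_units" if "X \<in> parity_units" "Y \<in> parity_units" for X Y
    using that PU by blast
  have PU_inv: "\<exists>Y\<in>parity_units. X * Y = 1\<^sub>m 2 \<and> Y * X = 1\<^sub>m 2" if "X \<in> parity_units" for X
    using that PU by blast
  have PU_one: "1\<^sub>m 2 \<in> parity_units" using PU by blast
  have V_PU: "X \<in> parity_units" if "X \<in> V_mats m" for X using that V_mats_subset_parity_units
    by blast
  have N_simps: "carrier N = \<Phi> ` parity_units" "monoid.mult N = monoid.mult A" "one N = one A"
    by (simp_all add: N_def del: grp_alg_simps)
  interpret N: group N
  proof (rule groupI, unfold N_simps)
    show "\<one>\<^bsub>A\<^esub> \<in> \<Phi> ` parity_units" using PU_one Phi_one by (metis image_eqI)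
    fix x assume "x \<in> \<Phi> ` parity_units"
    then obtain X where X: "X \<in> parity_units" "x = \<Phi> X" by blast
    show "\<one>\<^bsub>A\<^esub> \<otimes>\<^bsub>A\<^esub> x = x" unfolding X(2) by (rule A.l_one[OF Phi_closed])
    obtain X' where X': "X' \<in> parity_units" "X' * X = 1\<^sub>m 2" using PU_inv[OF X(1)] by blast
    have "\<Phi> X' \<otimes>\<^bsub>A\<^esub> x = \<one>\<^bsub>A\<^esub>" unfolding X(2) Phi_mult[OF PUc[OF X'(1)] PUc[OF X(1)]] X'(2)
      by (rule Phi_one)
    then show "\<exists>y\<in>\<Phi> ` parity_units. y \<otimes>\<^bsub>A\<^esub> x = \<one>\<^bsub>A\<^esub>" using X'(1) by blast
    fix y assume "y \<in> \<Phi> ` parity_units"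
    then obtain Y where Y: "Y \<in> parity_units" "y = \<Phi> Y" by blast
    have "x \<otimes>\<^bsub>A\<^esub> y = \<Phi> (X * Y)" unfolding X(2) Y(2) by (rule Phi_mult[OF PUc[OF X(1)] PUc[OF Y(1)]])
    then show "x \<otimes>\<^bsub>A\<^esub> y \<in> \<Phi> ` parity_units" using PU_mult[OF X(1) Y(1)] by blast
  qed (rule ga_assoc)
  have inv: "inv\<^bsub>N\<^esub> \<Phi> X = \<Phi> Y" if "X \<in> parity_units" "Y \<in> parity_units" "Y * X = 1\<^sub>m 2" for X Y
  proof (rule N.inv_equality, unfold N_simps)
    show "\<Phi> Y \<otimes>\<^bsub>A\<^esub> \<Phi> X = \<one>\<^bsub>A\<^esub>" unfolding Phi_mult[OF PUc[OF that(2)] PUc[OF that(1)]] that(3)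
      by (rule Phi_one)
  qed (use that in blast)+
  have sub: "subgroup (\<Phi> ` V_mats m) N"
  proof (rule N.subgroupI, unfold N_simps)
    show "\<Phi> ` V_mats m \<subseteq> \<Phi> ` parity_units" using V_PU by blast
    show "\<Phi> ` V_mats m \<noteq> {}" using mat_group_V[of m] unfolding mat_group_def by blast
    fix x assume "x \<in> \<Phi> ` V_mats m"
    then obtain X where X: "X \<in> V_mats m" "x = \<Phi> X" by blast
    obtain X' where X': "X' \<in> V_mats m" "X' * X = 1\<^sub>m 2" using X(1) mat_group_V[of m]
      unfolding mat_group_def by blast
    show "inv\<^bsub>N\<^esub> x \<in> \<Phi> ` V_mats m" unfolding X(2) inv[OF V_PU[OF X(1)] V_PU[OF X'(1)] X'(2)]
      using X'(1) by blast
    fix y assume "y \<in> \<Phi> ` V_mats m"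
    then obtain Y where Y: "Y \<in> V_mats m" "y = \<Phi> Y" by blast
    have "X * Y \<in> V_mats m" using X(1) Y(1) mat_group_V[of m] unfolding mat_group_def by blast
    then show "x \<otimes>\<^bsub>A\<^esub> y \<in> \<Phi> ` V_mats m"
      unfolding X(2) Y(2) Phi_mult[OF PUc[OF V_PU[OF X(1)]] PUc[OF V_PU[OF Y(1)]]] by blast
  qed
  show "\<Phi> ` V_mats m \<lhd> N"
    unfolding N.normal_inv_iff
  proof (intro conjI ballI sub)
    fix x v assume x: "x \<in> carrier N" and v: "v \<in> \<Phi> ` V_mats m"
    obtain X where X: "X \<in> parity_units" "x = \<Phi> X" using x unfolding N_simps by blast
    obtain Y where Y: "Y \<in> parity_units" "X * Y = 1\<^sub>m 2" "Y * X = 1\<^sub>m 2" using PU_inv[OF X(1)]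
      by blast
    obtain M where M: "M \<in> V_mats m" "v = \<Phi> M" using v by blast
    have "X * M * Y \<in> V_mats m"
      using M(1) X(1) Y(1,2) unfolding parity_units_def by (intro V_mats_conj) auto
    moreover have "x \<otimes>\<^bsub>N\<^esub> v \<otimes>\<^bsub>N\<^esub> inv\<^bsub>N\<^esub> x = \<Phi> (X * M * Y)"
    proof -
      have c: "X \<in> carrier_mat 2 2" "M \<in> carrier_mat 2 2" "Y \<in> carrier_mat 2 2"
        using PUc X(1) Y(1) V_PU[OF M(1)] by auto
      have "X * M \<in> carrier_mat 2 2" using c by simp
      then show ?thesis
        unfolding N_simps X(2) M(2) inv[OF X(1) Y(1,3)] by (simp only: Phi_mult c)
    qed
    ultimately show "x \<otimes>\<^bsub>N\<^esub> v \<otimes>\<^bsub>N\<^esub> inv\<^bsub>N\<^esub> x \<in> \<Phi> ` V_mats m" by blast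
  qed
  have "rcosets\<^bsub>N\<^esub> (\<Phi> ` V_mats m) = (\<lambda>X. \<Phi> ` V_mats m #>\<^bsub>N\<^esub> \<Phi> X) ` parity_units"
    unfolding RCOSETS_def N_simps by blast
  moreover have "finite ((\<lambda>X. \<Phi> ` V_mats m #>\<^bsub>N\<^esub> \<Phi> X) ` parity_units)"
  proof (rule finite_image_of_key)
    show "finite (residue_key (2 * m) ` parity_units)" using m_pos
      by (intro finite_residue_keys) simp
    fix X Y assume X: "X \<in> parity_units" and Y: "Y \<in> parity_units" and key: "residue_key (2 * m) X = residue_key (2 * m) Y"
    have int: "X \<in> M2Z" "Y \<in> M2Z" using X Y parity_order_subset unfolding parity_units_def by auto
    obtain C where C: "C \<in> M2Z" "X = Y + of_nat (2 * m) \<cdot>\<^sub>m C"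
      using residue_key_congruent(2)[OF int key] by blast
    obtain Y' where Y': "Y' \<in> parity_units" "Y * Y' = 1\<^sub>m 2" "Y' * Y = 1\<^sub>m 2" using PU_inv[OF Y]
      by blast
    have V: "X * Y' \<in> V_mats m"
      using X Y Y' unfolding parity_units_def
      by (intro V_mats_of_congruent_units[OF _ _ _ _ residue_key_congruent(1)[OF int key] C]) auto
    have c: "X \<in> carrier_mat 2 2" "Y \<in> carrier_mat 2 2" "Y' \<in> carrier_mat 2 2" using PUc X Y Y'(1)
      by auto
    have "\<Phi> X = \<Phi> (X * Y') \<otimes>\<^bsub>N\<^esub> \<Phi> Y"
    proof -
      have "X * Y' * Y = X" using c Y'(3) by (simp add: assoc_mult_mat[of _ 2 2 _ 2 _ 2])
      moreover have "X * Y' \<in> carrier_mat 2 2" using c by simp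
      ultimately show ?thesis unfolding N_simps by (simp only: Phi_mult c)
    qed
    then have "\<Phi> X \<in> \<Phi> ` V_mats m #>\<^bsub>N\<^esub> \<Phi> Y" using V unfolding r_coset_def by blast
    then show "\<Phi> ` V_mats m #>\<^bsub>N\<^esub> \<Phi> X = \<Phi> ` V_mats m #>\<^bsub>N\<^esub> \<Phi> Y"
      using N.repr_independence[OF _ _ sub] Y unfolding N_simps by blast
  qed
  ultimately show "finite (rcosets\<^bsub>N\<^esub> (\<Phi> ` V_mats m))" by simp
qed

text \<open>The condition \<open>is_e\<close> singles out the constructed e, so the universally
  quantified part has to be checked for this e alone, with the maximal order and its identification
  left arbitrary.\<close>

lemma component_description:
  fixes \<H>
  defines "is_e \<equiv> (\<lambda>e. primitive_central_idempotent A e \<and>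
      \<H> = SL1_int_grp_ring K \<inter> one_minus_plus A e (carrier (component A e)))"
  assumes HV: "\<H> = \<Phi> ` V_mats m" and nontriv: "\<H> \<noteq> {\<one>\<^bsub>A\<^esub>}"
  shows "(\<exists>!e. is_e e) \<and>
    (\<forall>e. is_e e \<longrightarrow>
      (\<exists>\<theta> \<in> ring_iso (component A e) M2Q.
         is_maximal_order (component A e) {x \<in> carrier (component A e). \<theta> x \<in> M2Z} \<and>
         \<H> = one_minus_plus A e {x \<in> carrier (component A e). \<theta> x \<in> V_mats m}) \<and>
      (\<forall>\<O>. is_maximal_order (component A e) \<O> \<longrightarrow>
         (\<exists>\<psi> \<in> ring_iso (component A e) M2Q. \<psi> ` \<O> = M2Z) \<and>
         (\<forall>\<psi> \<in> ring_iso (component A e) M2Q. \<psi> ` \<O> = M2Z \<longrightarrow>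
            congruence_relations (component A e) \<O> \<psi> m)) \<and>
      (let N = A\<lparr>carrier := one_minus_plus A e (Units (component (int_grp_ring K) e))\<rparr>
       in \<H> \<lhd> N \<and> finite (rcosets\<^bsub>N\<^esub> \<H>)))"
proof -
  interpret me: matrix_algebra "component A e" \<theta> by (rule matrix_algebra_theta)
  have is_e: "is_e f \<longleftrightarrow> f = e" for f
  proof
    show "f = e" if "is_e f"
      using that e_unique[of f] nontriv unfolding is_e_def HV by blast
    show "is_e f" if "f = e"
      unfolding is_e_def that HV SL1_component using e_primitive by blast
  qed
  have max: "is_maximal_order (component A e) {x \<in> carrier (component A e). \<theta> x \<in> M2Z}"
    using me.is_maximal_order_integral unfolding me.integral_elements_def .
  have "{x \<in> carrier (component A e). \<theta> x \<in> V_mats m} = \<tau> ` V_mats m"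
    unfolding component_carrier using theta_tau V_mats_eq by (auto simp: image_iff)
  then have HV': "\<H> = one_minus_plus A e {x \<in> carrier (component A e). \<theta> x \<in> V_mats m}"
    unfolding HV one_minus_plus_tau[symmetric] by simp
  have orders: "(\<exists>\<psi> \<in> ring_iso (component A e) M2Q. \<psi> ` \<O> = M2Z) \<and>
         (\<forall>\<psi> \<in> ring_iso (component A e) M2Q. \<psi> ` \<O> = M2Z \<longrightarrow>
            congruence_relations (component A e) \<O> \<psi> m)"
    if O: "is_maximal_order (component A e) \<O>" for \<O>
  proof (intro conjI ballI impI)
    show "\<exists>\<psi> \<in> ring_iso (component A e) M2Q. \<psi> ` \<O> = M2Z" by (rule me.maximal_order_iso[OF O])
    fix \<psi> assume \<psi>: "\<psi> \<in> ring_iso (component A e) M2Q" "\<psi> ` \<O> = M2Z"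
    interpret mp: matrix_algebra "component A e" \<psi> by unfold_locales (rule \<psi>(1))
    have "\<O> \<subseteq> carrier (component A e)"
      using O subringE(1) unfolding is_maximal_order_def is_order_def by blast
    then show "congruence_relations (component A e) \<O> \<psi> m"
      by (rule mp.congruence_subgroups) (rule \<psi>(2) m_even m_pos)+
  qed
  have units: "let N = A\<lparr>carrier := one_minus_plus A e (Units (component (int_grp_ring K) e))\<rparr>
       in \<H> \<lhd> N \<and> finite (rcosets\<^bsub>N\<^esub> \<H>)"
    unfolding Let_def int_component_units one_minus_plus_tau HV using normal_finite_index by blast
  have "\<exists>\<theta> \<in> ring_iso (component A e) M2Q.
      is_maximal_order (component A e) {x \<in> carrier (component A e). \<theta> x \<in> M2Z} \<and>
      \<H> = one_minus_plus A e {x \<in> carrier (component A e). \<theta> x \<in> V_mats m}"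
    using theta_iso max HV' by blast
  then show ?thesis unfolding is_e using orders units by simp
qed

end


section \<open>The set \<open>\<H>(g,h,Q)\<close>\<close>

lemma sum_lessThan_shift_periodic:
  fixes \<phi> :: "nat \<Rightarrow> 'a :: ab_group_add"
  assumes "\<And>i. \<phi> (i + n) = \<phi> i"
  shows "(\<Sum>i<n. \<phi> (i + j)) = (\<Sum>i<n. \<phi> i)"
proof (induction j)
  case (Suc j)
  have "(\<Sum>i<n. \<phi> (Suc i + j)) + \<phi> j = (\<Sum>i<Suc n. \<phi> (i + j))"
    by (subst sum.lessThan_Suc_shift) (simp add: add.commute)
  also have "\<dots> = (\<Sum>i<n. \<phi> (i + j)) + \<phi> j" using assms[of j] by (simp add: add.commute)
  finally show ?case using Suc by simp
qed simp

text \<open>Decodes the congruences with both signs: modulo 2q they mean divisibility by q with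
  quotients of equal parity.\<close>

lemma dvd_add_diff_imp_multiple:
  fixes x y q :: int
  assumes "2 * q dvd y + x" "2 * q dvd y - x"
  obtains s t where "x = q * s" "y = q * t" "even (s - t)"
proof -
  obtain u v where "y + x = 2 * q * u" "y - x = 2 * q * v" using assms by (elim dvdE)
  then have "2 * x = 2 * (q * (u - v))" "2 * y = 2 * (q * (u + v))" by (simp_all add: algebra_simps)
  then have "x = q * (u - v)" "y = q * (u + v)" by simp_all
  moreover have "even ((u - v) - (u + v))" by simp
  ultimately show ?thesis using that by blast
qed

lemma admissible_iff:
  assumes "n = coset_ord K Q g"
  shows "admissible K g Q x1 x2 y1 y2 \<longleftrightarrow>
    y1 + y2 + int n * y1 * y2 = int n * x1 * x2 \<and>
    2 * int (card Q) dvd x2 + x1 \<and> 2 * int (card Q) dvd x2 - x1 \<and>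
    2 * int (card Q) dvd y2 + y1 \<and> 2 * int (card Q) dvd y2 - y1"
  by (simp add: admissible_def Let_def assms cong_0_iff)

text \<open>The determinant is 1 + n (y1 + y2 + n y1 y2 - n x1 x2), so the quadratic condition of
  admissibility is determinant one. The congruences contribute the factor |Q| of the level and the
  parities.\<close>

lemma admissible_matrices:
  assumes n: "n = coset_ord K Q g" "0 < n"
  shows "{1\<^sub>m 2 + of_nat n \<cdot>\<^sub>m mat2 (of_int y2) (of_int x1) (of_int x2) (of_int y1) |x1 x2 y1 y2.
    admissible K g Q x1 x2 y1 y2} = V_mats (n * card Q)" (is "?L = _")
proof (intro equalityI subsetI)
  have det: "det (1\<^sub>m 2 + of_nat n \<cdot>\<^sub>m mat2 (of_int y2) (of_int x1) (of_int x2) (of_int y1)) = (1 :: rat) \<longleftrightarrow>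
    y1 + y2 + int n * y1 * y2 = int n * x1 * x2" for x1 x2 y1 y2
  proof -
    have "det (1\<^sub>m 2 + of_nat n \<cdot>\<^sub>m mat2 (of_int y2) (of_int x1) (of_int x2) (of_int y1)) =
      (of_int (1 + int n * ((y1 + y2 + int n * y1 * y2) - int n * x1 * x2)) :: rat)"
      by (simp add: one_mat2 algebra_simps)
    also have "\<dots> = 1 \<longleftrightarrow> int n * ((y1 + y2 + int n * y1 * y2) - int n * x1 * x2) = 0"
      by (simp only: of_int_eq_1_iff) linarith
    finally show ?thesis using n(2) by simp
  qed
  fix X
  {
    assume "X \<in> ?L"
    then obtain x1 x2 y1 y2
      where X: "X = 1\<^sub>m 2 + of_nat n \<cdot>\<^sub>m mat2 (of_int y2) (of_int x1) (of_int x2) (of_int y1)"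
      and adm: "admissible K g Q x1 x2 y1 y2" by blast
    note adm = adm[unfolded admissible_iff[OF n(1)]]
    obtain t1 t2 where t: "x1 = int (card Q) * t1" "x2 = int (card Q) * t2" "even (t1 - t2)"
      using adm dvd_add_diff_imp_multiple by metis
    obtain l1 l2 where l: "y1 = int (card Q) * l1" "y2 = int (card Q) * l2" "even (l1 - l2)"
      using adm dvd_add_diff_imp_multiple by metis
    show "X \<in> V_mats (n * card Q)"
    proof (rule V_matsI)
      show "mat2 (of_int l2) (of_int t1) (of_int t2) (of_int l1) \<in> parity_order"
        using t(3) l(3) by (auto simp: mat2_of_int_in_parity_order)
      show "X = 1\<^sub>m 2 + of_nat (n * card Q) \<cdot>\<^sub>m mat2 (of_int l2) (of_int t1) (of_int t2) (of_int l1)"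
        by (simp add: X t l mult.assoc)
      show "det X = 1" unfolding X using det adm by blast
    qed
  next
    assume "X \<in> V_mats (n * card Q)"
    then obtain C where C: "C \<in> parity_order" "X = 1\<^sub>m 2 + of_nat (n * card Q) \<cdot>\<^sub>m C" "det X = 1"
      unfolding V_mats_eq by blast
    obtain l2 t1 t2 l1
      where Ce: "C = mat2 (of_int l2) (of_int t1) (of_int t2) (of_int l1)" "even (l2 - l1)"
      "even (t1 - t2)"
      using C(1) by (rule parity_order_cases)
    let ?q = "int (card Q)"
    have X: "X = 1\<^sub>m 2 + of_nat n \<cdot>\<^sub>m mat2 (of_int (?q * l2)) (of_int (?q * t1)) (of_int (?q * t2)) (of_int (?q * l1))"
      by (simp add: C(2) Ce mult.assoc)
    have dvd: "2 * ?q dvd ?q * s + ?q * t" "2 * ?q dvd ?q * s - ?q * t" if st: "even (s - t)"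
      for s t
    proof -
      have "even (s + t)" using st by simp
      then obtain u where "s + t = 2 * u" by blast
      then have "?q * s + ?q * t = 2 * ?q * u" by (metis distrib_left mult.assoc mult.left_commute)
      then show "2 * ?q dvd ?q * s + ?q * t" by simp
      obtain v where "s - t = 2 * v" using st by blast
      then have "?q * s - ?q * t = 2 * ?q * v"
        by (metis right_diff_distrib mult.assoc mult.left_commute)
      then show "2 * ?q dvd ?q * s - ?q * t" by simp
    qed
    have "even (t2 - t1)" using Ce(3) by simp
    have "admissible K g Q (?q * t1) (?q * t2) (?q * l1) (?q * l2)"
      unfolding admissible_iff[OF n(1)]
      using dvd[OF \<open>even (t2 - t1)\<close>] dvd[OF Ce(2)] C(3)[unfolded X det] by blast
    then show "X \<in> ?L" unfolding X by blast
  }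
qed

lemma (in finite_group) finsum_apply:
  assumes "finite S" "\<And>s. s \<in> S \<Longrightarrow> f s \<in> carrier A"
  shows "finsum A f S = (\<lambda>x. \<Sum>s\<in>S. f s x)"
  using assms
proof (induction rule: finite_induct)
  case empty
  show ?case by simp
next
  case (insert s S)
  then have "finsum A f (insert s S) = f s \<oplus>\<^bsub>A\<^esub> finsum A f S"
    by (intro A.finsum_insert) (auto simp del: grp_alg_simps)
  then show ?case using insert by simp
qed

lemma (in finite_group) ga_sum_r:
  "w \<otimes>\<^bsub>A\<^esub> (\<lambda>x. \<Sum>i\<in>I. c i * f i x) = (\<lambda>x. \<Sum>i\<in>I. c i * (w \<otimes>\<^bsub>A\<^esub> f i) x)"
proof
  fix x
  have "(w \<otimes>\<^bsub>A\<^esub> (\<lambda>x. \<Sum>i\<in>I. c i * f i x)) x = (\<Sum>y\<in>carrier K. \<Sum>i\<in>I. c i * (w y * f i (inv y \<otimes> x)))"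
    if "x \<in> carrier K"
    unfolding ga_mult[OF that] by (simp add: sum_distrib_left mult.left_commute)
  also have "\<dots> = (\<Sum>i\<in>I. c i * (w \<otimes>\<^bsub>A\<^esub> f i) x)" if "x \<in> carrier K"
    unfolding ga_mult[OF that] by (subst sum.swap) (simp add: sum_distrib_left)
  finally show "(w \<otimes>\<^bsub>A\<^esub> (\<lambda>x. \<Sum>i\<in>I. c i * f i x)) x = (\<Sum>i\<in>I. c i * (w \<otimes>\<^bsub>A\<^esub> f i) x)"
    by (cases "x \<in> carrier K") (auto simp: ga_mult_outside)
qed

lemma (in finite_group) ga_basis_mult:
  assumes "x \<in> carrier K" "y \<in> carrier K"
  shows "ga_basis x \<otimes>\<^bsub>A\<^esub> ga_basis y = ga_basis (x \<otimes> y)"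
proof
  fix k
  show "(ga_basis x \<otimes>\<^bsub>A\<^esub> ga_basis y) k = ga_basis (x \<otimes> y) k"
  proof (cases "k \<in> carrier K")
    case True
    have "inv x \<otimes> k = y \<longleftrightarrow> k = x \<otimes> y" using assms True by (auto simp: m_assoc[symmetric])
    then show ?thesis
      using assms finite_carrier
      by (simp add: ga_mult[OF True] ga_basis_def if_distrib[of "\<lambda>c. c * _"] cong: if_cong)
  next
    case False
    then show ?thesis using assms by (auto simp: ga_mult_outside ga_basis_def)
  qed
qed

section \<open>The elements \<open>v_elt\<close> in terms of the quotient by Q\<close>

locale normal_triple = finite_group K + normal Q K for K (structure) and Q +
  fixes g h
  assumes gh_closed [simp]: "g \<in> carrier K" "h \<in> carrier K"
    and generated: "carrier K \<subseteq> generate K ({g, h} \<union> Q)"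
    and central: "gp_commutator K g h <# Q \<in> centre (K Mod Q)"
    and coset_ord_h: "coset_ord K Q h = 2"
begin

declare mult_FactGroup [simp del] one_FactGroup [simp del]

abbreviation "\<pi> x \<equiv> Q #> x"

abbreviation "n \<equiv> coset_ord K Q g"

sublocale quo: group_hom K "K Mod Q" "\<lambda>x. Q #> x"
  by (intro group_hom.intro group_hom_axioms.intro is_group factorgroup_is_group r_coset_hom_Mod)

lemma coset_left_eq: "x \<in> carrier K \<Longrightarrow> x <# Q = \<pi> x"
  using coset_eq by simp

lemma pi_eq_iff: "x \<in> carrier K \<Longrightarrow> k \<in> carrier K \<Longrightarrow> \<pi> k = \<pi> x \<longleftrightarrow> k \<otimes> inv x \<in> Q"
  using rcos_module[OF is_group] repr_independence repr_independenceD subgroup_axioms by metis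

lemma quotient_carrier: "carrier (K Mod Q) = \<pi> ` carrier K"
  by (auto simp: FactGroup_def RCOSETS_def)

lemma pi_Q: "x \<in> Q \<Longrightarrow> \<pi> x = \<one>\<^bsub>K Mod Q\<^esub>"
  using coset_join2 subgroup_axioms by (simp add: FactGroup_def mem_carrier)

lemma pi_commutator: "\<pi> (gp_commutator K g h) = gp_commutator (K Mod Q) (\<pi> g) (\<pi> h)"
  by (simp add: gp_commutator_def)

lemma commutator_closed [simp]: "gp_commutator K g h \<in> carrier K"
  by (simp add: gp_commutator_def)

lemma coset_ord_g: "n = group.ord (K Mod Q) (\<pi> g)"
  by (simp add: coset_ord_def coset_left_eq)

sublocale cc: central_commutator "K Mod Q" "\<pi> g" "\<pi> h"
proof (unfold_locales)
  show "finite (carrier (K Mod Q))" unfolding quotient_carrier using finite_carrier by simp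
  show "\<pi> g \<in> carrier (K Mod Q)" "\<pi> h \<in> carrier (K Mod Q)" by (simp_all add: quotient_carrier)
  show "carrier (K Mod Q) \<subseteq> generate (K Mod Q) {\<pi> g, \<pi> h}"
  proof
    fix y assume "y \<in> carrier (K Mod Q)"
    then obtain k where k: "k \<in> carrier K" "y = \<pi> k" unfolding quotient_carrier by blast
    have "k \<in> generate K ({g, h} \<union> Q)" using k(1) generated by blast
    then have "k \<in> carrier K \<and> \<pi> k \<in> generate (K Mod Q) {\<pi> g, \<pi> h}"
    proof (induction rule: generate.induct)
      case one
      show ?case using generate.one[of "K Mod Q"] by simp
    next
      case (incl x)
      then show ?case
        using generate.one[of "K Mod Q" "{\<pi> g, \<pi> h}"] by (auto simp: pi_Q intro: generate.incl)
    next
      case (inv x)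
      then have "x \<in> carrier K" by auto
      moreover have "\<pi> x \<in> {\<pi> g, \<pi> h} \<or> \<pi> x = \<one>\<^bsub>K Mod Q\<^esub>" using inv pi_Q by blast
      then have "inv\<^bsub>K Mod Q\<^esub> (\<pi> x) \<in> generate (K Mod Q) {\<pi> g, \<pi> h}"
      proof
        assume "\<pi> x = \<one>\<^bsub>K Mod Q\<^esub>"
        then show ?thesis using Group.monoid.inv_one[OF group.is_monoid[OF factorgroup_is_group]]
          by (simp only: generate.one)
      qed (rule generate.inv)
      ultimately show ?case by simp
    next
      case (eng x y)
      then show ?case using generate.eng[of "\<pi> x" "K Mod Q" "{\<pi> g, \<pi> h}" "\<pi> y"] by simp
    qed
    then show "y \<in> generate (K Mod Q) {\<pi> g, \<pi> h}" using k(2) by simp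
  qed
  have "group.ord (K Mod Q) (\<pi> h) = 2" using coset_ord_h by (simp add: coset_ord_def coset_left_eq)
  then have "\<pi> h [^]\<^bsub>K Mod Q\<^esub> (2 :: nat) = \<one>\<^bsub>K Mod Q\<^esub>"
    using group.pow_ord_eq_1[OF factorgroup_is_group, of "\<pi> h"] by (simp add: quotient_carrier)
  then show "\<pi> h \<otimes>\<^bsub>K Mod Q\<^esub> \<pi> h = \<one>\<^bsub>K Mod Q\<^esub>"
    by (simp add: numeral_2_eq_2 quotient_carrier)
  show "gp_commutator (K Mod Q) (\<pi> g) (\<pi> h) \<in> centre (K Mod Q)"
    using central by (simp add: coset_left_eq pi_commutator)
qed

lemma n_pos: "0 < n"
  using group.ord_ge_1[OF factorgroup_is_group cc.finite_carrier cc.a_closed]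
  by (simp add: coset_ord_g)

lemma set_tilde_eq: "set_tilde K Q = (\<lambda>x. if x \<in> Q then 1 else 0)"
proof -
  have fin: "finite Q" using finite_carrier subset finite_subset by blast
  have "set_tilde K Q = (\<lambda>x. \<Sum>q\<in>Q. ga_basis q x)"
    unfolding set_tilde_def by (rule finsum_apply[OF fin]) (use ga_basis_closed subset in blast)
  then show ?thesis using fin by (simp add: ga_basis_def)
qed

lemma ga_basis_pow: "ga_basis g [^]\<^bsub>A\<^esub> i = ga_basis (g [^] i)" for i :: nat
  by (induction i) (simp_all add: A.nat_pow_Suc ga_basis_mult nat_pow_Suc del: grp_alg_simps(1,3,4,5))

lemma ga_basis_neg_pow: "(\<ominus>\<^bsub>A\<^esub> ga_basis g) [^]\<^bsub>A\<^esub> i = (\<lambda>x. (-1) ^ i * ga_basis (g [^] i) x)"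
  for i :: nat
proof (induction i)
  case (Suc i)
  have neg: "\<ominus>\<^bsub>A\<^esub> ga_basis g = (\<lambda>x. (-1) * ga_basis g x)"
    using ga_uminus[OF ga_basis_closed[OF gh_closed(1)]] by simp
  have "(\<ominus>\<^bsub>A\<^esub> ga_basis g) [^]\<^bsub>A\<^esub> Suc i =
      (\<lambda>x. (-1) ^ i * ga_basis (g [^] i) x) \<otimes>\<^bsub>A\<^esub> (\<lambda>x. (-1) * ga_basis g x)"
    unfolding A.nat_pow_Suc Suc by (simp only: neg)
  also have "\<dots> = (\<lambda>x. (-1) ^ Suc i * ga_basis (g [^] Suc i) x)"
    unfolding ga_smult_l ga_smult_r by (simp add: ga_basis_mult nat_pow_Suc)
  finally show ?case .
qed simp

lemma pow_tilde_plus: "pow_tilde K Q g (ga_basis g) = (\<lambda>x. \<Sum>i<n. ga_basis (g [^] i) x)"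
  unfolding pow_tilde_def ga_basis_pow
  by (rule finsum_apply) (simp_all add: ga_basis_closed del: grp_alg_simps)

lemma pow_tilde_minus:
  "pow_tilde K Q g (\<ominus>\<^bsub>A\<^esub> ga_basis g) = (\<lambda>x. \<Sum>i<n. (-1) ^ i * ga_basis (g [^] i) x)"
  unfolding pow_tilde_def ga_basis_neg_pow by (rule finsum_apply) (auto simp: ga_basis_def)

definition fibre :: "'a \<Rightarrow> 'a \<Rightarrow> rat" where
  "fibre x k = (if k \<in> carrier K \<and> \<pi> k = \<pi> x then 1 else 0)"

lemma set_tilde_basis:
  assumes "x \<in> carrier K"
  shows "set_tilde K Q \<otimes>\<^bsub>A\<^esub> ga_basis x = fibre x"
proof
  fix k
  show "(set_tilde K Q \<otimes>\<^bsub>A\<^esub> ga_basis x) k = fibre x k"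
  proof (cases "k \<in> carrier K")
    case True
    have "(set_tilde K Q \<otimes>\<^bsub>A\<^esub> ga_basis x) k = set_tilde K Q (k \<otimes> inv x)"
      using assms finite_carrier
      by (simp add: ga_mult_right[OF True] ga_basis_def if_distrib[of "\<lambda>c. _ * c"] cong: if_cong)
    then show ?thesis using assms True by (simp add: set_tilde_eq fibre_def pi_eq_iff)
  qed (simp add: ga_mult_outside fibre_def)
qed

lemma set_tilde_one_minus_basis:
  assumes "x \<in> carrier K" "c \<in> carrier K"
  shows "set_tilde K Q \<otimes>\<^bsub>A\<^esub> (\<one>\<^bsub>A\<^esub> \<ominus>\<^bsub>A\<^esub> ga_basis c) \<otimes>\<^bsub>A\<^esub> ga_basis x = (\<lambda>k. fibre x k - fibre (c \<otimes> x) k)"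
proof -
  have "\<one>\<^bsub>A\<^esub> \<ominus>\<^bsub>A\<^esub> ga_basis c = (\<lambda>k. ga_basis \<one> k + (-1) * ga_basis c k)"
    using assms by (simp add: ga_minus ga_basis_closed del: grp_alg_simps(1,3,4,5))
  then have "(\<one>\<^bsub>A\<^esub> \<ominus>\<^bsub>A\<^esub> ga_basis c) \<otimes>\<^bsub>A\<^esub> ga_basis x = (\<lambda>k. ga_basis x k + (-1) * ga_basis (c \<otimes> x) k)"
    using assms
    by (simp only: ga_l_distr ga_smult_l ga_basis_mult l_one Group.monoid.one_closed[OF is_monoid])
  then have "set_tilde K Q \<otimes>\<^bsub>A\<^esub> ((\<one>\<^bsub>A\<^esub> \<ominus>\<^bsub>A\<^esub> ga_basis c) \<otimes>\<^bsub>A\<^esub> ga_basis x) =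
      (\<lambda>k. fibre x k + (-1) * fibre (c \<otimes> x) k)"
    using assms
    by (simp only: ga_r_distr ga_smult_r set_tilde_basis Group.monoid.m_closed[OF is_monoid])
  then show ?thesis by (simp add: ga_assoc)
qed

text \<open>The coefficients of 2|Q| (v - 1). The factor \<open>set_tilde K Q\<close> makes them
  constant on cosets, so they are functions on the quotient.\<close>

definition w_coeff :: "int \<Rightarrow> int \<Rightarrow> int \<Rightarrow> int \<Rightarrow> 'a set \<Rightarrow> rat" where
  "w_coeff x1 x2 y1 y2 y = (\<Sum>i<n.
     ((-1) ^ i * of_int x1 + of_int x2) *
       (of_bool (y = \<pi> h \<otimes>\<^bsub>K Mod Q\<^esub> \<pi> g [^]\<^bsub>K Mod Q\<^esub> i) -
        of_bool (y = cc.z \<otimes>\<^bsub>K Mod Q\<^esub> (\<pi> h \<otimes>\<^bsub>K Mod Q\<^esub> \<pi> g [^]\<^bsub>K Mod Q\<^esub> i))) +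
     ((-1) ^ i * of_int y1 + of_int y2) *
       (of_bool (y = \<pi> g [^]\<^bsub>K Mod Q\<^esub> i) -
        of_bool (y = cc.z \<otimes>\<^bsub>K Mod Q\<^esub> \<pi> g [^]\<^bsub>K Mod Q\<^esub> i)))"

lemma v_elt_eq:
  "v_elt K g h Q x1 x2 y1 y2 = \<one>\<^bsub>A\<^esub> \<oplus>\<^bsub>A\<^esub>
    (\<lambda>k. if k \<in> carrier K then w_coeff x1 x2 y1 y2 (\<pi> k) / (2 * of_nat (card Q)) else 0)"
proof -
  let ?c = "gp_commutator K g h"
  let ?S = "set_tilde K Q \<otimes>\<^bsub>A\<^esub> (\<one>\<^bsub>A\<^esub> \<ominus>\<^bsub>A\<^esub> ga_basis ?c)"
  let ?gm = "\<lambda>x. \<Sum>i<n. (-1) ^ i * ga_basis (g [^] i) x"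
  let ?gp = "\<lambda>x. \<Sum>i<n. ga_basis (g [^] i) x"
  define \<alpha> where "\<alpha> = (\<lambda>i. (-1) ^ i * of_int x1 + of_int x2 :: rat)"
  define \<beta> where "\<beta> = (\<lambda>i. (-1) ^ i * of_int y1 + of_int y2 :: rat)"
  have comb: "(\<lambda>k. of_int s * ?gm k + of_int t * ?gp k) =
      (\<lambda>k. \<Sum>i<n. ((-1) ^ i * of_int s + of_int t) * ga_basis (g [^] i) k)" for s t :: int
    by (simp add: sum_distrib_left sum.distrib[symmetric] algebra_simps)
  have hg: "ga_basis h \<otimes>\<^bsub>A\<^esub> (\<lambda>k. \<Sum>i<n. \<alpha> i * ga_basis (g [^] i) k) =
      (\<lambda>k. \<Sum>i<n. \<alpha> i * ga_basis (h \<otimes> g [^] i) k)"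
    by (simp add: ga_sum_r ga_basis_mult)
  have inner: "(ga_basis h \<otimes>\<^bsub>A\<^esub> ((of_int x1 \<odot>\<^bsub>A\<^esub> ?gm) \<oplus>\<^bsub>A\<^esub> (of_int x2 \<odot>\<^bsub>A\<^esub> ?gp)))
              \<oplus>\<^bsub>A\<^esub> (of_int y1 \<odot>\<^bsub>A\<^esub> ?gm) \<oplus>\<^bsub>A\<^esub> (of_int y2 \<odot>\<^bsub>A\<^esub> ?gp) =
    (\<lambda>k. (\<Sum>i<n. \<alpha> i * ga_basis (h \<otimes> g [^] i) k) + (\<Sum>i<n. \<beta> i * ga_basis (g [^] i) k))"
    using hg comb[of x1 x2] comb[of y1 y2] by (simp add: \<alpha>_def \<beta>_def fun_eq_iff add.assoc)
  have "?S \<otimes>\<^bsub>A\<^esub> (\<lambda>k. (\<Sum>i<n. \<alpha> i * ga_basis (h \<otimes> g [^] i) k) + (\<Sum>i<n. \<beta> i * ga_basis (g [^] i) k)) =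
    (\<lambda>k. (\<Sum>i<n. \<alpha> i * (fibre (h \<otimes> g [^] i) k - fibre (?c \<otimes> (h \<otimes> g [^] i)) k)) +
      (\<Sum>i<n. \<beta> i * (fibre (g [^] i) k - fibre (?c \<otimes> g [^] i) k)))"
    by (simp add: ga_r_distr ga_sum_r set_tilde_one_minus_basis del: grp_alg_simps)
  also have "\<dots> = (\<lambda>k. if k \<in> carrier K then w_coeff x1 x2 y1 y2 (\<pi> k) else 0)"
  proof
    fix k
    show "(\<Sum>i<n. \<alpha> i * (fibre (h \<otimes> g [^] i) k - fibre (?c \<otimes> (h \<otimes> g [^] i)) k)) +
      (\<Sum>i<n. \<beta> i * (fibre (g [^] i) k - fibre (?c \<otimes> g [^] i) k)) =
      (if k \<in> carrier K then w_coeff x1 x2 y1 y2 (\<pi> k) else 0)"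
      by (simp add: fibre_def w_coeff_def \<alpha>_def \<beta>_def sum.distrib quo.hom_nat_pow pi_commutator cc.z_def of_bool_def)
  qed
  finally show ?thesis
    unfolding v_elt_def Let_def pow_tilde_plus pow_tilde_minus inner
    by (simp add: fun_eq_iff)
qed

text \<open>Every fibre is a coset with |Q| elements. This lifts the orthogonality relations from
  the quotient to K and turns o(gQ) into m = o(gQ)|Q|.\<close>

lemma sum_fibres:
  fixes F :: "'a set \<Rightarrow> rat"
  shows "(\<Sum>k\<in>carrier K. F (\<pi> k)) = of_nat (card Q) * (\<Sum>y\<in>carrier (K Mod Q). F y)"
proof -
  have "(\<Sum>k\<in>carrier K. F (\<pi> k)) = (\<Sum>y\<in>carrier (K Mod Q). \<Sum>k\<in>{k \<in> carrier K. \<pi> k = y}. F (\<pi> k))"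
    by (rule sum.group[symmetric]) (simp_all add: finite_carrier quotient_carrier)
  also have "\<dots> = (\<Sum>y\<in>carrier (K Mod Q). of_nat (card Q) * F y)"
  proof (rule sum.cong[OF refl])
    fix y assume "y \<in> carrier (K Mod Q)"
    then obtain x where x: "x \<in> carrier K" "y = \<pi> x" unfolding quotient_carrier by blast
    have "{k \<in> carrier K. \<pi> k = y} = y"
      using x rcos_module[OF is_group x(1)] pi_eq_iff[OF x(1)] r_coset_subset_G[OF subset x(1)]
      by blast
    moreover have "card y = card Q"
      unfolding x(2) using x(1)
      by (intro card_rcosets_equal[symmetric]) (auto simp: RCOSETS_def subset)
    moreover have "(\<Sum>k\<in>{k \<in> carrier K. \<pi> k = y}. F (\<pi> k)) = (\<Sum>k\<in>{k \<in> carrier K. \<pi> k = y}. F y)"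
      by (rule sum.cong) auto
    ultimately show "(\<Sum>k\<in>{k \<in> carrier K. \<pi> k = y}. F (\<pi> k)) = of_nat (card Q) * F y" by simp
  qed
  finally show ?thesis by (simp add: sum_distrib_left)
qed

text \<open>If the image of the commutator were a power of \<open>g\<close> modulo \<open>Q\<close>, then both alternating sums
  would be annihilated by \<open>1 - [g, h]\<close>.\<close>

lemma w_coeff_zero:
  fixes j :: nat
  assumes z: "cc.z = \<pi> g [^]\<^bsub>K Mod Q\<^esub> j"
  shows "w_coeff x1 x2 y1 y2 y = 0"
proof -
  let ?M = "K Mod Q"
  have z_pow: "cc.z [^]\<^bsub>?M\<^esub> k = \<one>\<^bsub>?M\<^esub>" if "\<pi> g [^]\<^bsub>?M\<^esub> k \<otimes>\<^bsub>?M\<^esub> \<pi> h = \<pi> h \<otimes>\<^bsub>?M\<^esub> \<pi> g [^]\<^bsub>?M\<^esub> k"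
    for k :: nat
  proof -
    have "\<pi> h \<otimes>\<^bsub>?M\<^esub> \<pi> g [^]\<^bsub>?M\<^esub> k \<otimes>\<^bsub>?M\<^esub> cc.z [^]\<^bsub>?M\<^esub> k = \<pi> h \<otimes>\<^bsub>?M\<^esub> \<pi> g [^]\<^bsub>?M\<^esub> k"
      using cc.a_pow_b[of k] that by (simp del: mult_FactGroup one_FactGroup)
    then show ?thesis by (simp del: mult_FactGroup one_FactGroup)
  qed
  have zn: "cc.z [^]\<^bsub>?M\<^esub> n = \<one>\<^bsub>?M\<^esub>"
    by (rule z_pow) (simp add: coset_ord_g)
  have zj: "cc.z [^]\<^bsub>?M\<^esub> j = \<one>\<^bsub>?M\<^esub>"
    by (rule z_pow) (simp add: z[symmetric] cc.z_commute)
  \<comment> \<open>If z \<noteq> 1, then both the period n and the shift j are even, so the cyclic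
    shift of the summation index by j respects the signs (-1)^i.\<close>
  have parity: "cc.z = \<one>\<^bsub>?M\<^esub> \<or> even n \<and> even j" using zn zj unfolding cc.z_pow by metis
  have shift: "(\<Sum>i<n. ((-1) ^ i * s + t) * of_bool (y = u \<otimes>\<^bsub>?M\<^esub> (cc.z \<otimes>\<^bsub>?M\<^esub> \<pi> g [^]\<^bsub>?M\<^esub> i))) =
      (\<Sum>i<n. ((-1) ^ i * s + t) * of_bool (y = u \<otimes>\<^bsub>?M\<^esub> \<pi> g [^]\<^bsub>?M\<^esub> i))"
    if "u \<in> carrier ?M" for u and s t :: rat
    using parity
  proof
    assume "cc.z = \<one>\<^bsub>?M\<^esub>"
    then show ?thesis by simp
  next
    assume even: "even n \<and> even j"
    define \<phi> where "\<phi> = (\<lambda>i. ((-1) ^ i * s + t) * of_bool (y = u \<otimes>\<^bsub>?M\<^esub> \<pi> g [^]\<^bsub>?M\<^esub> i))"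
    have per: "\<phi> (i + n) = \<phi> i" for i
    proof -
      have "\<pi> g [^]\<^bsub>?M\<^esub> (i + n) = \<pi> g [^]\<^bsub>?M\<^esub> i"
        by (simp add: quo.H.nat_pow_mult[symmetric] coset_ord_g)
      then show ?thesis using even by (simp add: \<phi>_def power_add)
    qed
    have "((-1) ^ i * s + t) * of_bool (y = u \<otimes>\<^bsub>?M\<^esub> (cc.z \<otimes>\<^bsub>?M\<^esub> \<pi> g [^]\<^bsub>?M\<^esub> i)) = \<phi> (i + j)" for i
    proof -
      have "cc.z \<otimes>\<^bsub>?M\<^esub> \<pi> g [^]\<^bsub>?M\<^esub> i = \<pi> g [^]\<^bsub>?M\<^esub> (i + j)"
        by (simp add: z quo.H.nat_pow_mult add.commute)
      then show ?thesis using even by (simp add: \<phi>_def power_add)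
    qed
    then have "(\<Sum>i<n. ((-1) ^ i * s + t) * of_bool (y = u \<otimes>\<^bsub>?M\<^esub> (cc.z \<otimes>\<^bsub>?M\<^esub> \<pi> g [^]\<^bsub>?M\<^esub> i))) = (\<Sum>i<n. \<phi> (i + j))"
      by simp
    also have "\<dots> = (\<Sum>i<n. \<phi> i)" by (rule sum_lessThan_shift_periodic) (rule per)
    finally show ?thesis by (simp add: \<phi>_def)
  qed
  have zh: "cc.z \<otimes>\<^bsub>?M\<^esub> (\<pi> h \<otimes>\<^bsub>?M\<^esub> \<pi> g [^]\<^bsub>?M\<^esub> i) = \<pi> h \<otimes>\<^bsub>?M\<^esub> (cc.z \<otimes>\<^bsub>?M\<^esub> \<pi> g [^]\<^bsub>?M\<^esub> i)"
    for i :: nat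
    by (simp add: quo.H.m_assoc[symmetric] cc.z_commute[of "\<pi> h"])
  have "w_coeff x1 x2 y1 y2 y =
      ((\<Sum>i<n. ((-1) ^ i * of_int x1 + of_int x2) * of_bool (y = \<pi> h \<otimes>\<^bsub>?M\<^esub> \<pi> g [^]\<^bsub>?M\<^esub> i)) -
       (\<Sum>i<n. ((-1) ^ i * of_int x1 + of_int x2) * of_bool (y = \<pi> h \<otimes>\<^bsub>?M\<^esub> (cc.z \<otimes>\<^bsub>?M\<^esub> \<pi> g [^]\<^bsub>?M\<^esub> i)))) +
      ((\<Sum>i<n. ((-1) ^ i * of_int y1 + of_int y2) * of_bool (y = \<one>\<^bsub>?M\<^esub> \<otimes>\<^bsub>?M\<^esub> \<pi> g [^]\<^bsub>?M\<^esub> i)) -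
       (\<Sum>i<n. ((-1) ^ i * of_int y1 + of_int y2) * of_bool (y = \<one>\<^bsub>?M\<^esub> \<otimes>\<^bsub>?M\<^esub> (cc.z \<otimes>\<^bsub>?M\<^esub> \<pi> g [^]\<^bsub>?M\<^esub> i))))"
    unfolding w_coeff_def zh by (simp add: sum.distrib sum_subtractf right_diff_distrib)
  also have "\<dots> = 0" using shift[of "\<pi> h"] shift[of "\<one>\<^bsub>?M\<^esub>"] by simp
  finally show ?thesis .
qed

lemma H_set_eq:
  "H_set K g h Q = {\<one>\<^bsub>A\<^esub> \<oplus>\<^bsub>A\<^esub>
    (\<lambda>k. if k \<in> carrier K then w_coeff x1 x2 y1 y2 (\<pi> k) / (2 * of_nat (card Q)) else 0) |x1 x2 y1 y2.
    admissible K g Q x1 x2 y1 y2}"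
  unfolding H_set_def v_elt_eq ..

lemma commutator_not_power:
  assumes "H_set K g h Q \<noteq> {\<one>\<^bsub>A\<^esub>}"
  shows "cc.z \<noteq> \<pi> g [^]\<^bsub>K Mod Q\<^esub> (j :: nat)"
proof
  assume z: "cc.z = \<pi> g [^]\<^bsub>K Mod Q\<^esub> j"
  \<comment> \<open>Some admissible quadruple is needed for the set to be {1} rather than
    empty.\<close>
  have "admissible K g Q 0 0 0 0" by (simp add: admissible_def Let_def)
  then have "H_set K g h Q = {\<one>\<^bsub>A\<^esub>}"
    unfolding H_set_eq w_coeff_zero[OF z] by auto
  with assms show False by contradiction
qed

end

section \<open>Identification of the set with 1 - e + V_m\<close>

locale nontrivial_triple = normal_triple +
  assumes nontrivial: "H_set K g h Q \<noteq> {\<one>\<^bsub>A\<^esub>}"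
begin

sublocale dt: dihedral_type "K Mod Q" "\<pi> g" "\<pi> h"
  by unfold_locales (use commutator_not_power[OF nontrivial] in \<open>simp add: cc.z_def\<close>)

text \<open>For y = b^j a^i z^l only the summand k = i survives; its signs (-1)^k and the difference
  of indicators, l = 0 against l = 1, are the entries of \<open>dt.rep y\<close>.\<close>

lemma w_coeff_eq:
  assumes "y \<in> carrier (K Mod Q)"
  shows "w_coeff x1 x2 y1 y2 y = frob (dt.rep y) (mat2 (of_int y2) (of_int x1) (of_int x2) (of_int y1))"
proof -
  let ?M = "K Mod Q"
  have "y \<in> (\<lambda>(j, i, l). dt.nf j i l) ` ({..<2} \<times> {..<n} \<times> {..<2})"
    using assms dt.nf_bij unfolding bij_betw_def coset_ord_g by blast
  then obtain j i l where jil: "j < 2" "i < n" "l < 2" "y = dt.nf j i l" by auto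
  have nf: "\<pi> g [^]\<^bsub>?M\<^esub> k = dt.nf 0 k 0" "\<pi> h \<otimes>\<^bsub>?M\<^esub> dt.nf 0 k 0 = dt.nf 1 k 0"
      "cc.z \<otimes>\<^bsub>?M\<^esub> dt.nf 1 k 0 = dt.nf 1 k 1" "cc.z \<otimes>\<^bsub>?M\<^esub> dt.nf 0 k 0 = dt.nf 0 k 1" for k
    by (simp_all add: dt.nf_def cc.z_commute)
  have eq: "y = dt.nf j' k l' \<longleftrightarrow> j = j' \<and> i = k \<and> l = l'" if "j' < 2" "k < n" "l' < 2" for j' k l'
  proof -
    have "inj_on (\<lambda>(j, i, l). dt.nf j i l) ({..<2} \<times> {..<n} \<times> {..<2})"
      using dt.nf_bij unfolding bij_betw_def coset_ord_g by blast
    from inj_on_eq_iff[OF this, of "(j, i, l)" "(j', k, l')"] show ?thesis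
      using that jil by simp
  qed
  have "w_coeff x1 x2 y1 y2 y = (\<Sum>k<n. if k = i then
      ((-1) ^ k * of_int x1 + of_int x2) * (of_bool (j = 1 \<and> l = 0) - of_bool (j = 1 \<and> l = 1)) +
      ((-1) ^ k * of_int y1 + of_int y2) * (of_bool (j = 0 \<and> l = 0) - of_bool (j = 0 \<and> l = 1)) else 0)"
    unfolding w_coeff_def nf
  proof (rule sum.cong[OF refl])
    fix k assume "k \<in> {..<n}"
    then have k: "k < n" by simp
    show "((-1) ^ k * of_int x1 + of_int x2) * (of_bool (y = dt.nf 1 k 0) - of_bool (y = dt.nf 1 k 1)) +
        ((-1) ^ k * of_int y1 + of_int y2) * (of_bool (y = dt.nf 0 k 0) - of_bool (y = dt.nf 0 k 1)) =
      (if k = i then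
      ((-1) ^ k * of_int x1 + of_int x2) * (of_bool (j = 1 \<and> l = 0) - of_bool (j = 1 \<and> l = 1)) +
      ((-1) ^ k * of_int y1 + of_int y2) * (of_bool (j = 0 \<and> l = 0) - of_bool (j = 0 \<and> l = 1)) else (0 :: rat))"
      using eq[OF _ k, of 1 0] eq[OF _ k, of 1 1] eq[OF _ k, of 0 0] eq[OF _ k, of 0 1]
      by (cases "k = i") simp_all
  qed
  also have "\<dots> = frob (dt.rep_nf j i l) (mat2 (of_int y2) (of_int x1) (of_int x2) (of_int y1))"
    using jil(1-3) by (auto simp: dt.rep_nf_def less_2_cases_iff)
  finally show ?thesis by (simp add: jil(4) dt.rep_eq)
qed

sublocale pr: planar_rep K "\<lambda>k. dt.rep (\<pi> k)" "n * card Q" g h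
proof unfold_locales
  have "card Q > 0" using finite_carrier subset finite_subset one_closed card_gt_0_iff by blast
  then show "0 < n * card Q" using n_pos by simp
  show "even (n * card Q)" using dt.ord_even by (simp add: coset_ord_g)
  show "dt.rep (\<pi> (x \<otimes> y)) = dt.rep (\<pi> x) * dt.rep (\<pi> y)" if "x \<in> carrier K" "y \<in> carrier K" for x y
    using that by (simp add: dt.rep_mult del: mult_FactGroup)
  show "dt.rep (\<pi> \<one>) = 1\<^sub>m 2" using dt.rep_one by simp
  show "dt.rep (\<pi> x) \<in> parity_order" if "x \<in> carrier K" for x using that
    by (simp add: dt.rep_parity)
  show "frob (dt.rep (\<pi> (inv y)) * X) M = frob X (dt.rep (\<pi> y) * M)"
    "frob (X * dt.rep (\<pi> (inv y))) M = frob X (M * dt.rep (\<pi> y))"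
    if "y \<in> carrier K" "X \<in> carrier_mat 2 2" "M \<in> carrier_mat 2 2" for y X M
    using that by (simp_all add: dt.frob_rep)
  show "(\<Sum>x\<in>carrier K. frob (dt.rep (\<pi> x)) M * dt.rep (\<pi> x) $$ (p, q)) = 2 * of_nat (n * card Q) * M $$ (p, q)"
    if "M \<in> carrier_mat 2 2" "p < 2" "q < 2" for M p q
    unfolding sum_fibres[of "\<lambda>y. frob (dt.rep y) M * dt.rep y $$ (p, q)"] dt.rep_orthogonality[OF that]
    by (simp add: coset_ord_g)
  show "dt.rep (\<pi> g) = mat2 1 0 0 (- 1)" "dt.rep (\<pi> h) = mat2 0 1 1 0" by (rule dt.rep_a dt.rep_b)+
qed simp_all

text \<open>The denominator 2|Q| of v becomes the 2m of \<open>\<tau>\<close> after the matrix is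
  multiplied by n; so v is 1 plus \<open>\<tau>\<close> of n times the matrix of the
  quadruple.\<close>

lemma H_set_Phi: "H_set K g h Q = pr.\<Phi> ` V_mats (n * card Q)"
proof -
  have v_Phi: "\<one>\<^bsub>A\<^esub> \<oplus>\<^bsub>A\<^esub> (\<lambda>k. if k \<in> carrier K then w_coeff x1 x2 y1 y2 (\<pi> k) / (2 * of_nat (card Q)) else 0) =
      pr.\<Phi> (1\<^sub>m 2 + of_nat n \<cdot>\<^sub>m mat2 (of_int y2) (of_int x1) (of_int x2) (of_int y1))" for x1 x2 y1 y2
  proof -
    let ?M = "mat2 (of_int y2) (of_int x1) (of_int x2) (of_int y1) :: rat mat"
    have "(if k \<in> carrier K then w_coeff x1 x2 y1 y2 (\<pi> k) / (2 * of_nat (card Q)) else 0) =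
        pr.\<tau> (of_nat n \<cdot>\<^sub>m ?M) k" for k
    proof (cases "k \<in> carrier K")
      case True
      have "frob X (of_nat n \<cdot>\<^sub>m ?M) = of_nat n * frob X ?M" for X
        by (simp add: frob_def algebra_simps)
      then show ?thesis using True n_pos
        by (simp add: pr.\<tau>_def w_coeff_eq del: mat2_smult)
    qed (simp add: pr.\<tau>_def)
    then show ?thesis by (subst pr.Phi_add_one) (simp_all del: mat2_smult)
  qed
  have "H_set K g h Q = pr.\<Phi> ` {1\<^sub>m 2 + of_nat n \<cdot>\<^sub>m mat2 (of_int y2) (of_int x1) (of_int x2) (of_int y1) |x1 x2 y1 y2.
    admissible K g Q x1 x2 y1 y2}"
    unfolding H_set_eq v_Phi by blast
  then show ?thesis using admissible_matrices[OF refl n_pos] by simp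
qed

lemmas description = pr.component_description[OF H_set_Phi nontrivial]

end

theorem theorem10p8:
  fixes G :: "('a, 'm) monoid_scheme"
    and g h :: 'a
    and Q :: "'a set"
  defines "H \<equiv> triple_group G g h Q"
  defines "QH \<equiv> grp_alg H"
  defines "ZH \<equiv> int_grp_ring H"
  defines "\<H> \<equiv> H_set H g h Q"
  defines "m \<equiv> coset_ord H Q g * card Q"
  defines "is_e \<equiv> (\<lambda>e. primitive_central_idempotent QH e \<and>
      \<H> = SL1_int_grp_ring H \<inter> one_minus_plus QH e (carrier (component QH e)))"
  assumes "group G" and "finite (carrier G)"
    and "g \<in> carrier G" and "h \<in> carrier G" and "subgroup Q G"
    and "Q \<lhd> H"
    and "gp_commutator H g h <#\<^bsub>H\<^esub> Q \<in> centre (H Mod Q)"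
    and "coset_ord H Q h = 2"
    and "\<H> \<noteq> {\<one>\<^bsub>QH\<^esub>}"
  shows "(\<exists>!e. is_e e) \<and>
    (\<forall>e. is_e e \<longrightarrow>
      (\<exists>\<theta> \<in> ring_iso (component QH e) M2Q.
         is_maximal_order (component QH e) {x \<in> carrier (component QH e). \<theta> x \<in> M2Z} \<and>
         \<H> = one_minus_plus QH e {x \<in> carrier (component QH e). \<theta> x \<in> V_mats m}) \<and>
      (\<forall>\<O>. is_maximal_order (component QH e) \<O> \<longrightarrow>
         (\<exists>\<psi> \<in> ring_iso (component QH e) M2Q. \<psi> ` \<O> = M2Z) \<and>
         (\<forall>\<psi> \<in> ring_iso (component QH e) M2Q. \<psi> ` \<O> = M2Z \<longrightarrow>
            (let U = units_of (component QH e);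
                 V = {x \<in> carrier (component QH e). \<psi> x \<in> V_mats m};
                 \<Gamma> = principal_congruence (component QH e) \<O>
             in subgroup (\<Gamma> m) U \<and>
                subgroup V (U\<lparr>carrier := \<Gamma> m\<rparr>) \<and>
                subgroup (\<Gamma> (2 * m)) (U\<lparr>carrier := V\<rparr>) \<and>
                card (rcosets\<^bsub>U\<lparr>carrier := \<Gamma> m\<rparr>\<^esub> V) = 2))) \<and>
      (let N = QH\<lparr>carrier := one_minus_plus QH e (Units (component ZH e))\<rparr>
       in \<H> \<lhd> N \<and> finite (rcosets\<^bsub>N\<^esub> \<H>)))"

proof -
  interpret G: group G by fact
  have sub: "{g, h} \<union> Q \<subseteq> carrier G" using assms(9-11) subgroup.subset by blast
  have subH: "subgroup (generate G ({g, h} \<union> Q)) G" by (rule G.generate_is_subgroup[OF sub])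
  have carH: "carrier H = generate G ({g, h} \<union> Q)" by (simp add: H_def triple_group_def)
  have "group H" unfolding H_def triple_group_def by (rule G.subgroup_imp_group[OF subH])
  moreover have "finite (carrier H)"
    using assms(8) subgroup.subset[OF subH] finite_subset unfolding carH by blast
  ultimately interpret H: finite_group H by (intro finite_group.intro finite_group_axioms.intro)
  have gen: "x \<in> generate G ({g, h} \<union> Q)" if "x \<in> {g, h} \<union> Q" for x using that
    by (rule generate.incl)
  interpret nontrivial_triple H Q g h
  proof (intro nontrivial_triple.intro normal_triple.intro normal_triple_axioms.intro
      nontrivial_triple_axioms.intro)
    show "finite_group H" by (rule H.finite_group_axioms)
    \<comment> \<open>H is defined by generation inside G, whereas the locale speaks of generation
      inside H.\<close>
    have "generate H ({g, h} \<union> Q) = generate G ({g, h} \<union> Q)"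
      unfolding H_def triple_group_def by (rule G.generate_consistent[OF _ subH]) (use gen in blast)
    then show "carrier H \<subseteq> generate H ({g, h} \<union> Q)" unfolding carH by simp
    show "g \<in> carrier H" "h \<in> carrier H" unfolding carH using gen by blast+
    show "normal Q H" by (rule assms(12))
    show "gp_commutator H g h <#\<^bsub>H\<^esub> Q \<in> centre (H Mod Q)" by (rule assms(13))
    show "coset_ord H Q h = 2" by (rule assms(14))
    show "H_set H g h Q \<noteq> {\<one>\<^bsub>grp_alg H\<^esub>}" using assms(15) unfolding \<H>_def QH_def .
  qed
  show ?thesis
    unfolding is_e_def QH_def ZH_def \<H>_def m_def
    by (rule description[unfolded congruence_relations_def])
qed

end
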